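(* Let $K$ be a subfield of $\mathbb{R}$ with $\mathbb{Q}\subsetneq K$. For $k\in K$ let $\lambda_k:\mathbb{R}\to\mathbb{R}$ be $x\mapsto kx$, and consider the structure $\big(\mathbb{R},0,1,<,+,(\lambda_k)_{k\in K}\big)$ expanded by a unary predicate for $\mathbb{Q}$ (the language has one function symbol $\lambda_k$ for each $k\in K$). The first-order theory of this structure is decidable if and only if (i) $K$ has a computable presentation as an ordered field, and (ii) there is an algorithm deciding, for a given finite subset of $K$, whether it is $\mathbb{Q}$-linearly independent. *)

theory Defs
  imports Complex_Main "HOL-Library.Nat_Bijection"
begin

section \<open>Recursive functions\<close>

text \<open>
  \<open>recursive n f\<close>: the restriction of \<open>f\<close> to lists of length \<open>n\<close> is a total recursive function
  of \<open>n\<close> arguments (Kleene's general recursive functions: minimization is applied only to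
  functions that have a zero for every choice of the parameters). Values on lists of any other
  length are irrelevant, which is what rule \<open>ext\<close> expresses.
\<close>

inductive recursive :: "nat \<Rightarrow> (nat list \<Rightarrow> nat) \<Rightarrow> bool" where
  zero: "recursive n (\<lambda>xs. 0)"
| succ: "recursive 1 (\<lambda>xs. Suc (xs ! 0))"
| proj: "i < n \<Longrightarrow> recursive n (\<lambda>xs. xs ! i)"
| comp: "recursive (length fs) g \<Longrightarrow> \<forall>f\<in>set fs. recursive n f \<Longrightarrow>
    recursive n (\<lambda>xs. g (map (\<lambda>f. f xs) fs))"
| prec: "recursive n g \<Longrightarrow> recursive (Suc (Suc n)) h \<Longrightarrow>
    recursive (Suc n) (\<lambda>xs. rec_nat (g (tl xs)) (\<lambda>m r. h (m # r # tl xs)) (hd xs))"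
| mini: "recursive (Suc n) g \<Longrightarrow> \<forall>xs. length xs = n \<longrightarrow> (\<exists>m. g (m # xs) = 0) \<Longrightarrow>
    recursive n (\<lambda>xs. LEAST m. g (m # xs) = 0)"
| ext: "recursive n f \<Longrightarrow> \<forall>xs. length xs = n \<longrightarrow> g xs = f xs \<Longrightarrow> recursive n g"

definition computable1 :: "(nat \<Rightarrow> nat) \<Rightarrow> bool" where
  "computable1 f \<longleftrightarrow> recursive 1 (\<lambda>xs. f (xs ! 0))"

definition computable2 :: "(nat \<Rightarrow> nat \<Rightarrow> nat) \<Rightarrow> bool" where
  "computable2 f \<longleftrightarrow> recursive 2 (\<lambda>xs. f (xs ! 0) (xs ! 1))"

definition decidable_set :: "nat set \<Rightarrow> bool" where
  "decidable_set A \<longleftrightarrow> computable1 (\<lambda>n. if n \<in> A then 1 else 0)"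

definition decidable_rel :: "(nat \<Rightarrow> nat \<Rightarrow> bool) \<Rightarrow> bool" where
  "decidable_rel R \<longleftrightarrow> computable2 (\<lambda>m n. if R m n then 1 else 0)"

section \<open>The language and the structure\<close>

text \<open>
  The type parameter is the type of indices \<open>k\<close> of the function symbols \<open>\<lambda>\<^sub>k\<close>. Thus
  \<open>map_fm \<nu>\<close> renames every symbol index \<open>i\<close> to \<open>\<nu> i\<close>, and \<open>set_fm \<phi>\<close> is the set of indices
  occurring in \<open>\<phi>\<close>.
\<close>

datatype 'k trm =
    Var nat
  | Zero
  | One
  | Plus "'k trm" "'k trm"
  | Lam 'k "'k trm"

datatype 'k fm =
    Eq "'k trm" "'k trm"
  | Less "'k trm" "'k trm"
  | InQ "'k trm"
  | Neg "'k fm"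
  | Conj "'k fm" "'k fm"
  | Ex nat "'k fm"

fun vars :: "'k trm \<Rightarrow> nat set" where
  "vars (Var x) = {x}"
| "vars Zero = {}"
| "vars One = {}"
| "vars (Plus s t) = vars s \<union> vars t"
| "vars (Lam k t) = vars t"

fun free_vars :: "'k fm \<Rightarrow> nat set" where
  "free_vars (Eq s t) = vars s \<union> vars t"
| "free_vars (Less s t) = vars s \<union> vars t"
| "free_vars (InQ t) = vars t"
| "free_vars (Neg \<phi>) = free_vars \<phi>"
| "free_vars (Conj \<phi> \<psi>) = free_vars \<phi> \<union> free_vars \<psi>"
| "free_vars (Ex x \<phi>) = free_vars \<phi> - {x}"

fun trm_val :: "(nat \<Rightarrow> real) \<Rightarrow> real trm \<Rightarrow> real" where
  "trm_val e (Var x) = e x"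
| "trm_val e Zero = 0"
| "trm_val e One = 1"
| "trm_val e (Plus s t) = trm_val e s + trm_val e t"
| "trm_val e (Lam k t) = k * trm_val e t"

fun sat :: "(nat \<Rightarrow> real) \<Rightarrow> real fm \<Rightarrow> bool" where
  "sat e (Eq s t) \<longleftrightarrow> trm_val e s = trm_val e t"
| "sat e (Less s t) \<longleftrightarrow> trm_val e s < trm_val e t"
| "sat e (InQ t) \<longleftrightarrow> trm_val e t \<in> \<rat>"
| "sat e (Neg \<phi>) \<longleftrightarrow> \<not> sat e \<phi>"
| "sat e (Conj \<phi> \<psi>) \<longleftrightarrow> sat e \<phi> \<and> sat e \<psi>"
| "sat e (Ex x \<phi>) \<longleftrightarrow> (\<exists>a. sat (e(x := a)) \<phi>)"

definition theory_of :: "real set \<Rightarrow> real fm set" where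
  "theory_of K = {\<phi>. set_fm \<phi> \<subseteq> K \<and> free_vars \<phi> = {} \<and> (\<forall>e. sat e \<phi>)}"

section \<open>Decidability of the theory\<close>

fun trm_code :: "nat trm \<Rightarrow> nat" where
  "trm_code (Var x) = prod_encode (0, x)"
| "trm_code Zero = prod_encode (1, 0)"
| "trm_code One = prod_encode (2, 0)"
| "trm_code (Plus s t) = prod_encode (3, prod_encode (trm_code s, trm_code t))"
| "trm_code (Lam i t) = prod_encode (4, prod_encode (i, trm_code t))"

fun fm_code :: "nat fm \<Rightarrow> nat" where
  "fm_code (Eq s t) = prod_encode (0, prod_encode (trm_code s, trm_code t))"
| "fm_code (Less s t) = prod_encode (1, prod_encode (trm_code s, trm_code t))"
| "fm_code (InQ t) = prod_encode (2, trm_code t)"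
| "fm_code (Neg \<phi>) = prod_encode (3, fm_code \<phi>)"
| "fm_code (Conj \<phi> \<psi>) = prod_encode (4, prod_encode (fm_code \<phi>, fm_code \<psi>))"
| "fm_code (Ex x \<phi>) = prod_encode (5, prod_encode (x, fm_code \<phi>))"

lemma inj_trm_code: "trm_code s = trm_code t \<longleftrightarrow> s = t"
  by (induction s arbitrary: t; case_tac t) auto

lemma inj_fm_code: "fm_code \<phi> = fm_code \<psi> \<longleftrightarrow> \<phi> = \<psi>"
  by (induction \<phi> arbitrary: \<psi>; case_tac \<psi>) (auto simp: inj_trm_code)

text \<open>
  The language has infinitely many function symbols, so decidability refers to a numbering
  \<open>\<nu>\<close> of these symbols by the natural numbers.
\<close>

definition decidable_theory :: "real set \<Rightarrow> bool" where
  "decidable_theory K \<longleftrightarrow>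
    (\<exists>\<nu>. bij_betw \<nu> UNIV K \<and> decidable_set {fm_code \<phi> |\<phi>. map_fm \<nu> \<phi> \<in> theory_of K})"

section \<open>Presentations of subfields of the reals\<close>

definition real_subfield :: "real set \<Rightarrow> bool" where
  "real_subfield K \<longleftrightarrow> 0 \<in> K \<and> 1 \<in> K \<and>
    (\<forall>x\<in>K. \<forall>y\<in>K. x + y \<in> K \<and> x * y \<in> K) \<and> (\<forall>x\<in>K. - x \<in> K) \<and>
    (\<forall>x\<in>K. x \<noteq> 0 \<longrightarrow> inverse x \<in> K)"

text \<open>
  \<open>\<nu>\<close> is an isomorphism onto \<open>K\<close> from an ordered field with domain the natural numbers whose
  operations and order are computable. As \<open>K\<close> is infinite, taking all of the natural numbers as
  the domain, rather than a decidable set of them, is no restriction.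
\<close>

definition computable_presentation :: "(nat \<Rightarrow> real) \<Rightarrow> real set \<Rightarrow> bool" where
  "computable_presentation \<nu> K \<longleftrightarrow> bij_betw \<nu> UNIV K \<and>
    (\<exists>add. computable2 add \<and> (\<forall>i j. \<nu> (add i j) = \<nu> i + \<nu> j)) \<and>
    (\<exists>neg. computable1 neg \<and> (\<forall>i. \<nu> (neg i) = - \<nu> i)) \<and>
    (\<exists>mul. computable2 mul \<and> (\<forall>i j. \<nu> (mul i j) = \<nu> i * \<nu> j)) \<and>
    decidable_rel (\<lambda>i j. \<nu> i < \<nu> j)"

global_interpretation rat_real: vector_space "\<lambda>(q::rat) (x::real). of_rat q * x"
  by unfold_locales (simp_all add: algebra_simps of_rat_add of_rat_mult)

text \<open>Via \<^const>\<open>set_decode\<close> every natural number codes a finite set of natural numbers, uniquely.\<close>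

definition decidable_rat_independence :: "(nat \<Rightarrow> real) \<Rightarrow> bool" where
  "decidable_rat_independence \<nu> \<longleftrightarrow> decidable_set {n. rat_real.independent (\<nu> ` set_decode n)}"

end

theory Submission
  imports Defs "HOL-Analysis.Continuum_Not_Denumerable"
begin

text \<open>
  If the theory is decidable, then the operations and the order of \<open>K\<close> and the \<open>\<rat>\<close>-linear
  independence of finite subsets can be read off from suitable sentences.

  For the converse, quantifiers are eliminated over points whose coordinates are of two sorts: generic
  reals and rationals. Formulas are evaluated at \<open>K\<close>-linear forms in these coordinates. A form with a
  generic part is neither \<open>0\<close> nor rational, provided that the generic coordinates avoid finitely many
  forms with arbitrary rational coordinates; for a form in the rational coordinates alone, being rational
  is expressed by linear equations, obtained from a \<open>\<rat>\<close>-basis of the span of \<open>1\<close> and its coefficients.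
  A witness for \<open>\<exists>x\<close> is either generic itself, and is then eliminated by the Fourier--Motzkin method
  because the generic reals are dense, or it is one of finitely many forms in new rational coordinates.
  These are eliminated by solving a linear equation, or by the Fourier--Motzkin method and the density of
  \<open>\<rat>\<close>. For a sentence no generic coordinates remain, and only the sign of elements of \<open>K\<close> must be
  decided.
\<close>

section \<open>Computable functions on coded data\<close>

text \<open>The obstacle is the predicate for \<open>\<rat>\<close>: an atom \<open>InQ t\<close>
  cuts out a countable dense set of values, so finding an interval of solutions of the inequalities
  does not settle it. Splitting the coordinates by sort makes such an atom false as soon as a
  generic coordinate really occurs; the price is a finite list of forms to be avoided. This list is
  known only after a subformula has been processed, so the elimination returns it along with its
  result, and the forms in it that contain the new variable cause further calls on the same
  subformula. Avoidance is demanded for all rational coordinates at once: the condition then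
  survives any later change of these coordinates, and it still excludes only countably many values
  of a generic coordinate, so it can be met in every open interval. The independence oracle serves
  to recognise the decompositions that turn rationality into equations; they are found by unbounded
  search. Since the arguments of some recursive calls depend on the results of others, computability
  of the elimination is proved by certificates rather than by a structural recursion on
  codes.\<close>

lemma recursive_compose1:
  assumes "computable1 h" "recursive n f"
  shows "recursive n (\<lambda>xs. h (f xs))"
  using recursive.comp[of "[f]" "\<lambda>xs. h (xs ! 0)" n] assms by (simp add: computable1_def)

lemma recursive_compose2:
  assumes "computable2 h" "recursive n f" "recursive n g"
  shows "recursive n (\<lambda>xs. h (f xs) (g xs))"
  using recursive.comp[of "[f, g]" "\<lambda>xs. h (xs ! 0) (xs ! 1)" n] assms
  by (simp add: computable2_def numeral_2_eq_2)

lemma recursive_const: "recursive n (\<lambda>xs. c)"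
proof (induction c)
  case (Suc c)
  then show ?case
    using recursive_compose1[of Suc n "\<lambda>_. c"] recursive.succ by (simp add: computable1_def)
qed (rule recursive.zero)

section \<open>Arithmetic on natural numbers and the pairing function\<close>

lemma computable1_Suc: "computable1 Suc"
  by (simp add: computable1_def recursive.succ[simplified])

text \<open>A single parameter is enough, because several are later packed into one by
  pairing.\<close>

lemma computable2_rec:
  assumes "computable1 g" "recursive 3 (\<lambda>xs. h (xs ! 0) (xs ! 1) (xs ! 2))"
  shows "computable2 (\<lambda>m x. rec_nat (g x) (\<lambda>k r. h k r x) m)"
proof -
  have "recursive (Suc 1) (\<lambda>xs. rec_nat (g (tl xs ! 0)) 
      (\<lambda>m r. h ((m # r # tl xs) ! 0) ((m # r # tl xs) ! 1) ((m # r # tl xs) ! 2)) (hd xs))"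
    using assms
    by (intro recursive.prec[where g = "\<lambda>xs. g (xs ! 0)" and h = "\<lambda>xs. h (xs ! 0) (xs ! 1) (xs ! 2)"])
      (simp_all add: computable1_def numeral_3_eq_3 numeral_2_eq_2)
  from this[unfolded Suc_1] show ?thesis
    unfolding computable2_def by (rule recursive.ext) (auto simp: length_Suc_conv numeral_2_eq_2)
qed

lemma computable2_swap: "computable2 f \<Longrightarrow> computable2 (\<lambda>x y. f y x)"
  using recursive_compose2[of f 2 "\<lambda>xs. xs ! 1" "\<lambda>xs. xs ! 0"] by (simp add: computable2_def recursive.proj)

lemma computable2_add: "computable2 (+)"
proof -
  have "rec_nat x (\<lambda>k r. Suc r) m = m + x" for m x :: nat
    by (induction m) auto
  moreover have "computable2 (\<lambda>m x. rec_nat x (\<lambda>k r. Suc r) m)"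
    by (rule computable2_rec)
      (auto intro!: recursive_compose1[OF computable1_Suc] recursive.proj simp: computable1_def)
  ultimately show ?thesis by simp
qed

lemma computable2_mult: "computable2 (*)"
proof -
  have "rec_nat 0 (\<lambda>k r. r + x) m = m * x" for m x :: nat
    by (induction m) auto
  moreover have "computable2 (\<lambda>m x. rec_nat 0 (\<lambda>k r. r + x) m)"
    by (rule computable2_rec)
      (auto intro!: recursive_compose2[OF computable2_add] recursive.proj recursive.zero simp: computable1_def)
  ultimately show ?thesis by simp
qed

text \<open>Truncated subtraction iterates the predecessor; the recursion runs on the subtrahend,
  whence the final swap.\<close>

lemma computable2_diff: "computable2 (-)"
proof -
  have "rec_nat 0 (\<lambda>k r. k) m = m - 1" for m :: nat
    by (cases m) auto
  moreover have "computable2 (\<lambda>m x. rec_nat 0 (\<lambda>k r. k) m)"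
    by (rule computable2_rec) (auto intro!: recursive.proj recursive.zero simp: computable1_def)
  ultimately have "computable2 (\<lambda>m x. m - 1)" by simp
  then have p: "computable1 (\<lambda>m. m - 1)"
    using recursive_compose2[of "\<lambda>m x. m - 1" 1 "\<lambda>xs. xs ! 0" "\<lambda>xs. xs ! 0"]
    by (simp add: computable1_def recursive.proj)
  have "rec_nat x (\<lambda>k r. r - 1) m = x - m" for m x :: nat
    by (induction m) auto
  moreover have "computable2 (\<lambda>m x. rec_nat x (\<lambda>k r. r - 1) m)"
    by (rule computable2_rec)
      (auto intro!: recursive_compose1[OF p, simplified] recursive.proj recursive.zero simp: computable1_def)
  ultimately have "computable2 (\<lambda>m x. x - m)" by simp
  then show ?thesis by (rule computable2_swap)
qed

lemma computable1_LEAST: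
  assumes "computable2 g" "\<And>x. \<exists>m. g m x = 0"
  shows "computable1 (\<lambda>x. LEAST m. g m x = 0)"
  unfolding computable1_def
  by (rule recursive.ext[OF recursive.mini[of 1 "\<lambda>xs. g (xs ! 0) (xs ! 1)"]])
    (use assms in \<open>auto simp: computable2_def numeral_2_eq_2\<close>)

lemma computable1_triangle: "computable1 triangle"
proof -
  have "rec_nat 0 (\<lambda>k r. Suc (r + k)) m = triangle m" for m :: nat
    by (induction m) auto
  moreover have "computable2 (\<lambda>m x. rec_nat 0 (\<lambda>k r. Suc (r + k)) m)"
    by (rule computable2_rec)
      (auto intro!: recursive_compose1[OF computable1_Suc] recursive_compose2[OF computable2_add]
         recursive.proj recursive.zero simp: computable1_def)
  ultimately have "computable2 (\<lambda>m x. triangle m)" by simp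
  then show ?thesis
    using recursive_compose2[of "\<lambda>m x. triangle m" 1 "\<lambda>xs. xs ! 0" "\<lambda>xs. xs ! 0"]
    by (simp add: computable1_def recursive.proj)
qed

lemma computable2_prod_encode: "computable2 (\<lambda>m n. prod_encode (m, n))"
  unfolding computable2_def prod_encode_def case_prod_conv
  by (intro recursive_compose2[OF computable2_add] recursive_compose1[OF computable1_triangle] recursive.proj) auto

lemma triangle_mono: "m \<le> n \<Longrightarrow> triangle m \<le> triangle n"
  by (induction rule: dec_induct) auto

text \<open>Since \<open>prod_encode (m, n) = triangle (m + n) + m\<close>, the diagonal
  \<open>m + n\<close> is the least \<open>s\<close> with \<open>c < triangle (Suc s)\<close>, a
  condition that truncated subtraction turns into a zero. Unbounded search finds it, and both
  components follow by subtraction.\<close>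

lemma computable1_prod_decode:
  "computable1 (\<lambda>c. fst (prod_decode c))" "computable1 (\<lambda>c. snd (prod_decode c))"
proof -
  define s where "s c = (LEAST s. Suc c - triangle (Suc s) = 0)" for c
  have "c < triangle (Suc c)" for c by (induction c) auto
  then have "\<exists>m. Suc x - triangle (Suc m) = 0" for x by (metis Suc_leI diff_is_0_eq)
  then have s: "computable1 s"
    unfolding s_def
    by (intro computable1_LEAST)
      (auto intro!: recursive_compose2[OF computable2_diff] recursive_compose1[OF computable1_Suc]
        recursive_compose1[OF computable1_triangle] recursive.proj simp: computable2_def simp del: triangle_Suc)
  have s_eq: "s (prod_encode (m, n)) = m + n" for m n
    unfolding s_def
  proof (rule Least_equality)
    fix y assume "Suc (prod_encode (m, n)) - triangle (Suc y) = 0"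
    then have "triangle (m + n) < triangle (Suc y)" by (simp add: prod_encode_def del: triangle_Suc)
    then have "\<not> Suc y \<le> m + n" using triangle_mono[of "Suc y" "m + n"] by linarith
    then show "m + n \<le> y" by simp
  qed (simp add: prod_encode_def)
  have 1: "fst (prod_decode c) = c - triangle (s c)" for c
    by (rule prod_decode_inverse[of c, THEN subst], cases "prod_decode c")
      (simp del: prod_decode_inverse add: s_eq, simp add: prod_encode_def)
  have 2: "snd (prod_decode c) = s c - (c - triangle (s c))" for c
    by (rule prod_decode_inverse[of c, THEN subst], cases "prod_decode c")
      (simp del: prod_decode_inverse add: s_eq, simp add: prod_encode_def)
  show "computable1 (\<lambda>c. fst (prod_decode c))" "computable1 (\<lambda>c. snd (prod_decode c))"
    unfolding 1 2 computable1_def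
    by (auto intro!: recursive_compose2[OF computable2_diff] recursive_compose1[OF computable1_triangle]
        recursive_compose1[OF s] recursive.proj)
qed

text \<open>A bijection rather than an injection: every number decodes to something, so functions on
  codes are total without a domain test, and a search over all numbers is a search over all
  elements.\<close>

class coded =
  fixes enc :: "'a \<Rightarrow> nat"
  assumes bij_enc: "bij enc"

definition dec :: "nat \<Rightarrow> 'a::coded" where
  "dec = inv enc"

lemma dec_enc [simp]: "dec (enc x) = x"
  by (simp add: dec_def bij_enc bij_is_inj)

lemma enc_dec [simp]: "enc (dec n) = n"
  by (simp add: dec_def bij_enc bij_is_surj surj_f_inv_f)

lemma enc_eq_iff [simp]: "enc x = enc y \<longleftrightarrow> x = y"
  by (metis dec_enc)

instantiation nat :: coded
begin
definition enc_nat :: "nat \<Rightarrow> nat" where "enc_nat n = n"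
instance by standard (simp add: enc_nat_def bij_def inj_def)
end

instantiation prod :: (coded, coded) coded
begin
definition enc_prod :: "'a \<times> 'b \<Rightarrow> nat" where
  "enc_prod p = prod_encode (enc (fst p), enc (snd p))"
instance
proof
  have "prod_encode (enc (fst (dec a :: 'a, dec b :: 'b)), enc (snd (dec a :: 'a, dec b :: 'b))) = prod_encode (a, b)" for a b
    by simp
  then have "\<exists>p::'a \<times> 'b. c = prod_encode (enc (fst p), enc (snd p))" for c
    by (metis prod_decode_inverse surj_pair)
  then show "bij (enc :: 'a \<times> 'b \<Rightarrow> nat)"
    by (auto simp: bij_def inj_def surj_def enc_prod_def prod_eq_iff)
qed
end

instantiation list :: (coded) coded
begin
definition enc_list :: "'a list \<Rightarrow> nat" where
  "enc_list xs = list_encode (map enc xs)"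
instance
proof
  have "map enc (map dec ns :: 'a list) = ns" for ns
    by (simp add: comp_def)
  then have "\<exists>xs::'a list. c = list_encode (map enc xs)" for c
    by (metis list_decode_inverse)
  moreover have "inj (enc :: 'a \<Rightarrow> nat)" by (simp add: bij_enc bij_is_inj)
  ultimately show "bij (enc :: 'a list \<Rightarrow> nat)"
    by (auto simp: bij_def inj_def surj_def enc_list_def list_encode_eq inj_map_eq_map)
qed
end

lemma enc_nat_eq [simp]: "enc (n::nat) = n"
  by (simp add: enc_nat_def)

lemma dec_nat_eq [simp]: "dec n = (n::nat)"
  by (metis dec_enc enc_nat_def)

lemma fst_dec: "fst (dec n :: 'a::coded \<times> 'b::coded) = dec (fst (prod_decode n))"
  and snd_dec: "snd (dec n :: 'a::coded \<times> 'b::coded) = dec (snd (prod_decode n))"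
proof -
  have "prod_decode n = (enc (fst (dec n :: 'a \<times> 'b)), enc (snd (dec n :: 'a \<times> 'b)))"
    by (metis enc_dec enc_prod_def prod_encode_inverse)
  then show "fst (dec n :: 'a \<times> 'b) = dec (fst (prod_decode n))"
    "snd (dec n :: 'a \<times> 'b) = dec (snd (prod_decode n))"
    by simp_all
qed

section \<open>Computability and decidability relative to the codings\<close>

definition computable :: "('a::coded \<Rightarrow> 'b::coded) \<Rightarrow> bool" where
  "computable f \<longleftrightarrow> computable1 (\<lambda>n. enc (f (dec n)))"

definition decidable :: "('a::coded \<Rightarrow> bool) \<Rightarrow> bool" where
  "decidable P \<longleftrightarrow> computable (\<lambda>x. if P x then 1 else 0 :: nat)"

named_theorems computable_intros

lemma computable_const [computable_intros]: "computable (\<lambda>x. c)"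
  by (simp add: computable_def computable1_def recursive_const)

lemma computable_id [computable_intros]: "computable (\<lambda>x. x)"
  by (simp add: computable_def computable1_def recursive.proj)

lemma computable_compose:
  assumes "computable f" "computable g"
  shows "computable (\<lambda>x. f (g x))"
  using recursive_compose1[of "\<lambda>n. enc (f (dec n))" 1 "\<lambda>xs. enc (g (dec (xs ! 0)))"] assms
  by (simp add: computable_def computable1_def)

lemma computable_Pair [computable_intros]:
  assumes "computable f" "computable g"
  shows "computable (\<lambda>x. (f x, g x))"
  using recursive_compose2[OF computable2_prod_encode, of 1 "\<lambda>xs. enc (f (dec (xs ! 0)))" "\<lambda>xs. enc (g (dec (xs ! 0)))"] assms
  by (simp add: computable_def computable1_def enc_prod_def)

lemma computable_fst [computable_intros]: "computable f \<Longrightarrow> computable (\<lambda>x. fst (f x))"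
  by (rule computable_compose[of fst]) (use computable1_prod_decode in \<open>auto simp: computable_def fst_dec\<close>)

lemma computable_snd [computable_intros]: "computable f \<Longrightarrow> computable (\<lambda>x. snd (f x))"
  by (rule computable_compose[of snd]) (use computable1_prod_decode in \<open>auto simp: computable_def snd_dec\<close>)

lemma computable_compose2:
  assumes "computable (\<lambda>p. F (fst p) (snd p))" "computable f" "computable g"
  shows "computable (\<lambda>x. F (f x) (g x))"
  using computable_compose[OF assms(1) computable_Pair[OF assms(2,3)]] by simp

lemma computable_compose3:
  assumes "computable (\<lambda>p. F (fst p) (fst (snd p)) (snd (snd p)))" "computable f" "computable g" "computable h"
  shows "computable (\<lambda>x. F (f x) (g x) (h x))"
  using computable_compose[OF assms(1) computable_Pair[OF assms(2) computable_Pair[OF assms(3,4)]]] by simp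

lemma computable_compose4:
  assumes "computable (\<lambda>p. F (fst p) (fst (snd p)) (fst (snd (snd p))) (snd (snd (snd p))))"
    "computable f" "computable g" "computable h" "computable k"
  shows "computable (\<lambda>x. F (f x) (g x) (h x) (k x))"
  using computable_compose[OF assms(1) computable_Pair[OF assms(2) computable_Pair[OF assms(3)
    computable_Pair[OF assms(4,5)]]]] by simp

lemma computable_iff_computable1: "computable f \<longleftrightarrow> computable1 f"
  by (simp add: computable_def)

lemma computable_computable2:
  assumes "computable2 h" "computable f" "computable g"
  shows "computable (\<lambda>x. h (f x) (g x))"
  using recursive_compose2[OF assms(1), of 1 "\<lambda>xs. f (dec (xs ! 0))" "\<lambda>xs. g (dec (xs ! 0))"] assms(2,3)
  by (simp add: computable_def computable1_def)

lemma computable2_iff: "computable2 h \<longleftrightarrow> computable (\<lambda>p. h (fst p) (snd p))"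
proof
  assume "computable2 h"
  then show "computable (\<lambda>p. h (fst p) (snd p))"
    by (rule computable_computable2) (intro computable_intros)+
next
  assume "computable (\<lambda>p. h (fst p) (snd p))"
  then have "computable1 (\<lambda>n. h (fst (prod_decode n)) (snd (prod_decode n)))"
    by (simp add: computable_def fst_dec snd_dec)
  from recursive_compose1[OF this, of 2, OF computable2_prod_encode[unfolded computable2_def]]
  show "computable2 h" by (simp add: computable2_def)
qed

lemmas computable_add [computable_intros] = computable_computable2[OF computable2_add]
lemmas computable_diff [computable_intros] = computable_computable2[OF computable2_diff]
lemmas computable_mult [computable_intros] = computable_computable2[OF computable2_mult]

lemma computable_Suc [computable_intros]: "computable f \<Longrightarrow> computable (\<lambda>x. Suc (f x))"
  by (rule computable_compose[of Suc]) (auto simp: computable_iff_computable1 computable1_Suc)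

text \<open>On codes this is the identity, as a pair of numbers is coded by its
  \<open>prod_encode\<close>; the next three lemmas hold for the same reason.\<close>

lemma computable_prod_encode [computable_intros]:
  "computable f \<Longrightarrow> computable (\<lambda>x. prod_encode (f x))"
  by (simp add: computable_def enc_prod_def)

lemma computable_prod_decode [computable_intros]:
  "computable f \<Longrightarrow> computable (\<lambda>x. prod_decode (f x))"
  by (simp add: computable_def enc_prod_def)

lemma computable_enc [computable_intros]: "computable f \<Longrightarrow> computable (\<lambda>x. enc (f x))"
  by (simp add: computable_def)

lemma computable_dec [computable_intros]: "computable f \<Longrightarrow> computable (\<lambda>x. dec (f x))"
  by (simp add: computable_def)

text \<open>\<open>R\<close> is the same recursion carried out on codes. The step may depend on the
  argument; case distinctions and the list operations below are reduced to this rule.\<close>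

lemma computable_rec_nat [computable_intros]:
  fixes h :: "'a::coded \<Rightarrow> nat \<Rightarrow> 'b::coded \<Rightarrow> 'b"
  assumes "computable a" "computable (\<lambda>p. h (fst p) (fst (snd p)) (snd (snd p)))" "computable n"
  shows "computable (\<lambda>x. rec_nat (a x) (h x) (n x))"
proof -
  define R where "R m x = rec_nat (enc (a (dec x))) (\<lambda>k r. enc (h (dec x) k (dec r))) m" for m x
  have "computable1 (\<lambda>n. enc (h (dec (fst (prod_decode n))) (fst (prod_decode (snd (prod_decode n))))
      (dec (snd (prod_decode (snd (prod_decode n)))))))"
    using assms(2) by (simp add: computable_def fst_dec snd_dec)
  from recursive_compose1[OF this recursive_compose2[OF computable2_prod_encode _
        recursive_compose2[OF computable2_prod_encode]], of 3 "\<lambda>xs. xs ! 2" "\<lambda>xs. xs ! 0" "\<lambda>xs. xs ! 1"]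
  have "recursive 3 (\<lambda>xs. enc (h (dec (xs ! 2)) (xs ! 0) (dec (xs ! 1))))"
    by (simp add: recursive.proj)
  then have "computable2 R"
    unfolding R_def using assms(1) by (intro computable2_rec) (auto simp: computable_def)
  then have "computable1 (\<lambda>x. R (n (dec x)) x)"
    using recursive_compose2[of R 1 "\<lambda>xs. n (dec (xs ! 0))" "\<lambda>xs. xs ! 0"] assms(3)
    by (simp add: computable_def computable1_def recursive.proj)
  moreover have "R m x = enc (rec_nat (a (dec x)) (h (dec x)) m)" for m x
  proof (induction m)
    case (Suc m)
    have "R (Suc m) x = enc (h (dec x) m (dec (R m x)))" by (simp add: R_def)
    with Suc show ?case by simp
  qed (simp add: R_def)
  ultimately show ?thesis by (simp add: computable_def)
qed

text \<open>A case distinction is a recursion of length \<open>1\<close> or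
  \<open>0\<close>.\<close>

lemma computable_if [computable_intros]:
  assumes "decidable P" "computable f" "computable g"
  shows "computable (\<lambda>x. if P x then f x else g x)"
proof -
  have "computable (\<lambda>x. rec_nat (g x) (\<lambda>_ _. f x) (if P x then 1 else 0))"
    using assms by (intro computable_rec_nat computable_compose[OF assms(2)] computable_intros) (auto simp: decidable_def)
  moreover have "rec_nat (g x) (\<lambda>_ _. f x) (if P x then 1 else 0) = (if P x then f x else g x)" for x
    by simp
  ultimately show ?thesis by simp
qed

lemma decidable_compose: "decidable P \<Longrightarrow> computable f \<Longrightarrow> decidable (\<lambda>x. P (f x))"
  unfolding decidable_def by (rule computable_compose)

lemma decidable_compose2:
  "decidable (\<lambda>p. P (fst p) (snd p)) \<Longrightarrow> computable f \<Longrightarrow> computable g \<Longrightarrow> decidable (\<lambda>x. P (f x) (g x))"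
  using decidable_compose[of "\<lambda>p. P (fst p) (snd p)" "\<lambda>x. (f x, g x)"] computable_Pair[of f g] by simp

lemma decidable_not [computable_intros]:
  assumes "decidable P" shows "decidable (\<lambda>x. \<not> P x)"
proof -
  have "computable (\<lambda>x. if P x then 0 else 1 :: nat)"
    using assms by (intro computable_intros)
  moreover have "(if P x then 0 else 1 :: nat) = (if \<not> P x then 1 else 0)" for x by simp
  ultimately show ?thesis by (simp add: decidable_def)
qed

lemma decidable_conj [computable_intros]:
  assumes "decidable P" "decidable Q" shows "decidable (\<lambda>x. P x \<and> Q x)"
proof -
  have "computable (\<lambda>x. if P x then if Q x then 1 else 0 else 0 :: nat)"
    using assms by (intro computable_intros)
  moreover have "(if P x then if Q x then 1 else 0 else 0 :: nat) = (if P x \<and> Q x then 1 else 0)" for x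
    by simp
  ultimately show ?thesis by (simp add: decidable_def)
qed

lemma decidable_disj [computable_intros]:
  assumes "decidable P" "decidable Q" shows "decidable (\<lambda>x. P x \<or> Q x)"
  using decidable_not[OF decidable_conj[OF decidable_not[OF assms(1)] decidable_not[OF assms(2)]]] by simp

lemma decidable_imp [computable_intros]:
  assumes "decidable P" "decidable Q" shows "decidable (\<lambda>x. P x \<longrightarrow> Q x)"
  using decidable_disj[OF decidable_not[OF assms(1)] assms(2)] by (simp only: imp_conv_disj)

lemma decidable_le [computable_intros]:
  fixes f g :: "'a::coded \<Rightarrow> nat"
  assumes "computable f" "computable g" shows "decidable (\<lambda>x. f x \<le> g x)"
proof -
  have "computable (\<lambda>x. 1 - (f x - g x))"
    using assms by (intro computable_intros)
  moreover have "1 - (f x - g x) = (if f x \<le> g x then 1 else 0)" for x by simp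
  ultimately show ?thesis by (simp add: decidable_def)
qed

lemma decidable_less [computable_intros]:
  fixes f g :: "'a::coded \<Rightarrow> nat"
  assumes "computable f" "computable g" shows "decidable (\<lambda>x. f x < g x)"
  using decidable_not[OF decidable_le[OF assms(2,1)]] by (simp add: not_le)

lemma decidable_eq [computable_intros]:
  assumes "computable f" "computable g" shows "decidable (\<lambda>x. f x = g x)"
proof -
  have "decidable (\<lambda>x. enc (f x) \<le> enc (g x) \<and> enc (g x) \<le> enc (f x))"
    using assms by (intro computable_intros)
  moreover have "enc (f x) \<le> enc (g x) \<and> enc (g x) \<le> enc (f x) \<longleftrightarrow> f x = g x" for x
    using enc_eq_iff[of "f x" "g x"] by (auto simp del: enc_eq_iff)
  ultimately show ?thesis by simp
qed

text \<open>A computable choice operator: once \<open>P\<close> is decidable, a proof that witnesses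
  always exist becomes an algorithm.\<close>

definition least_coded :: "('a::coded \<Rightarrow> bool) \<Rightarrow> 'a" where
  "least_coded P = dec (LEAST n. P (dec n))"

lemma least_codedI: "P x \<Longrightarrow> P (least_coded P)"
  unfolding least_coded_def by (rule LeastI[of _ "enc x"]) simp

lemma computable_least_coded [computable_intros]:
  assumes "decidable (\<lambda>p. P (fst p) (snd p))" "\<And>x. \<exists>y. P x y"
  shows "computable (\<lambda>x. least_coded (P x))"
proof -
  define g where "g m x = (if P (dec x) (dec m) then 0 else 1 :: nat)" for m x
  have "computable2 g"
    unfolding computable2_iff g_def
    by (intro computable_intros decidable_compose2[OF assms(1)])
  moreover have "\<exists>m. g m x = 0" for x
    using assms(2)[of "dec x"] unfolding g_def by (metis dec_enc)
  ultimately have "computable1 (\<lambda>x. LEAST m. g m x = 0)" by (rule computable1_LEAST)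
  moreover have "g m x = 0 \<longleftrightarrow> P (dec x) (dec m)" for m x by (simp add: g_def)
  ultimately show ?thesis by (simp add: computable_def least_coded_def)
qed

section \<open>Lists and course-of-values recursion\<close>

lemma enc_Nil [simp]: "enc ([] :: 'a::coded list) = 0"
  and enc_Cons [simp]: "enc (x # xs) = Suc (prod_encode (enc x, enc xs))"
  by (simp_all add: enc_list_def)

lemma computable_Cons [computable_intros]:
  assumes "computable f" "computable g" shows "computable (\<lambda>x. f x # g x)"
proof -
  have "computable (\<lambda>x. Suc (prod_encode (enc (f x), enc (g x))))"
    using assms by (intro computable_intros)
  then show ?thesis by (simp add: computable_def)
qed

lemma computable_hd [computable_intros]:
  assumes "computable f" shows "computable (\<lambda>x. hd (f x))"
proof (rule computable_compose[OF _ assms])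
  \<comment> \<open>The value \<open>hd []\<close> is unspecified but fixed, hence a legitimate
    constant.\<close>
  have eq: "(hd :: 'b list \<Rightarrow> 'b) = (\<lambda>xs. if xs = [] then hd [] else dec (fst (prod_decode (enc xs - 1))))"
    (is "_ = ?f")
  proof
    fix xs show "hd xs = ?f xs" by (cases xs) auto
  qed
  show "computable (hd :: 'b list \<Rightarrow> 'b)"
    by (subst eq) (intro computable_intros)
qed

lemma computable_tl [computable_intros]:
  assumes "computable f" shows "computable (\<lambda>x. tl (f x))"
proof (rule computable_compose[OF _ assms])
  have eq: "(tl :: 'b list \<Rightarrow> 'b list) = (\<lambda>xs. if xs = [] then [] else dec (snd (prod_decode (enc xs - 1))))"
    (is "_ = ?f")
  proof
    fix xs show "tl xs = ?f xs" by (cases xs) auto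
  qed
  show "computable (tl :: 'b list \<Rightarrow> 'b list)"
    by (subst eq) (intro computable_intros)
qed

lemma computable_drop [computable_intros]:
  assumes "computable n" "computable f" shows "computable (\<lambda>x. drop (n x) (f x))"
proof -
  have "computable (\<lambda>x. rec_nat (f x) (\<lambda>_ r. tl r) (n x))"
    using assms by (intro computable_intros)
  moreover have "rec_nat xs (\<lambda>_ r. tl r) n = drop n xs" for xs :: "'b list" and n
    by (induction n) (simp_all add: drop_Suc tl_drop)
  ultimately show ?thesis by simp
qed

text \<open>The values at the arguments below \<open>n\<close>, the most recent first, as supplied by course-of-values
  recursion.\<close>

definition recall :: "nat \<Rightarrow> 'a list \<Rightarrow> nat \<Rightarrow> 'a" where
  "recall n hist i = hd (drop (n - Suc i) hist)"

lemma recall_map: "i < n \<Longrightarrow> recall n (map f (rev [0..<n])) i = f i"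
  unfolding recall_def by (subst hd_drop_conv_nth) (simp_all add: rev_nth)

lemma computable_recall [computable_intros]:
  assumes "computable n" "computable h" "computable i" shows "computable (\<lambda>x. recall (n x) (h x) (i x))"
  unfolding recall_def using assms by (intro computable_intros)

text \<open>The history is built by primitive recursion, newest value first, so the value at
  \<open>n\<close> is its head after \<open>Suc n\<close> rounds.\<close>

lemma computable_course_of_values:
  fixes f :: "'a::coded \<Rightarrow> nat \<Rightarrow> 'b::coded"
  assumes H: "computable (\<lambda>p. H (fst p) (fst (snd p)) (snd (snd p)))"
    and eq: "\<And>x n. f x n = H x n (map (f x) (rev [0..<n]))"
  shows "computable (\<lambda>p. f (fst p) (snd p))"
proof -
  have "rec_nat [] (\<lambda>m r. H x m r # r) n = map (f x) (rev [0..<n])" for x n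
    by (induction n) (simp_all add: eq[symmetric])
  then have "f x n = hd (rec_nat [] (\<lambda>m r. H x m r # r) (Suc n))" for x n
    by (simp add: eq[symmetric])
  moreover have "computable (\<lambda>p. hd (rec_nat [] (\<lambda>m r. H (fst p) m r # r) (Suc (snd p))))"
    by (intro computable_intros computable_compose3[OF H])
  ultimately show ?thesis by simp
qed

text \<open>List recursion is course-of-values recursion on codes, because the code of a tail is
  smaller than that of the list.\<close>

lemma computable_rec_list [computable_intros]:
  fixes h :: "'a::coded \<Rightarrow> 'b::coded \<Rightarrow> 'b list \<Rightarrow> 'c::coded \<Rightarrow> 'c"
  assumes a: "computable a"
    and h: "computable (\<lambda>p. h (fst p) (fst (snd p)) (fst (snd (snd p))) (snd (snd (snd p))))"
    and l: "computable l"
  shows "computable (\<lambda>x. rec_list (a x) (h x) (l x))"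
proof -
  define f where "f x c = rec_list (a x) (h x) (dec c)" for x c
  define H where "H x c hist = (if c = 0 then a x else
    h x (hd (dec c)) (tl (dec c)) (recall c hist (enc (tl (dec c) :: 'b list))))" for x c hist
  have H': "computable (\<lambda>p. H (fst p) (fst (snd p)) (snd (snd p)))"
    unfolding H_def
    by (intro computable_intros computable_compose[OF a] computable_compose4[OF h])
  have "f x c = H x c (map (f x) (rev [0..<c]))" for x c
  proof (cases "dec c :: 'b list")
    case Nil
    then have "c = 0" by (metis enc_Nil enc_dec)
    with Nil show ?thesis by (simp add: f_def H_def)
  next
    case (Cons y ys)
    then have c: "c = Suc (prod_encode (enc y, enc ys))" by (metis enc_Cons enc_dec)
    then have "enc ys < c" using le_prod_encode_2[of "enc ys" "enc y"] by simp
    then have "recall c (map (f x) (rev [0..<c])) (enc ys) = f x (enc ys)" by (rule recall_map)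
    with Cons c show ?thesis by (simp add: f_def H_def del: enc_Cons)
  qed
  from computable_course_of_values[of H f, OF H' this]
  have "computable (\<lambda>x. f (fst (x, enc (l x))) (snd (x, enc (l x))))"
    by (rule computable_compose) (use l in \<open>intro computable_intros\<close>)
  then show ?thesis by (simp add: f_def)
qed

lemma foldr_conv_rec_list: "foldr f xs s = rec_list s (\<lambda>a _ r. f a r) xs"
  by (induction xs) auto

lemma computable_foldr [computable_intros]:
  assumes "computable (\<lambda>p. f (fst p) (fst (snd p)) (snd (snd p)))" "computable l" "computable s"
  shows "computable (\<lambda>x. foldr (f x) (l x) (s x))"
  unfolding foldr_conv_rec_list
  by (intro computable_intros computable_compose3[OF assms(1)] assms(2,3))

lemma map_conv_foldr: "map f xs = foldr (\<lambda>a r. f a # r) xs []"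
  by (induction xs) auto

lemma filter_conv_foldr: "filter P xs = foldr (\<lambda>a r. if P a then a # r else r) xs []"
  by (induction xs) auto

lemma append_conv_foldr: "xs @ ys = foldr (\<lambda>a r. a # r) xs ys"
  by (induction xs) auto

lemma length_conv_foldr: "length xs = foldr (\<lambda>a r. Suc r) xs 0"
  by (induction xs) auto

lemma computable_map [computable_intros]:
  assumes "computable (\<lambda>p. f (fst p) (snd p))" "computable l"
  shows "computable (\<lambda>x. map (f x) (l x))"
  unfolding map_conv_foldr by (intro computable_intros computable_compose2[OF assms(1)] assms(2))

lemma computable_filter [computable_intros]:
  assumes "decidable (\<lambda>p. P (fst p) (snd p))" "computable l"
  shows "computable (\<lambda>x. filter (P x) (l x))"
  unfolding filter_conv_foldr by (intro computable_intros decidable_compose2[OF assms(1)] assms(2))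

lemma computable_append [computable_intros]:
  assumes "computable f" "computable g" shows "computable (\<lambda>x. f x @ g x)"
  unfolding append_conv_foldr by (intro computable_intros assms)

lemma computable_concat [computable_intros]:
  assumes "computable f" shows "computable (\<lambda>x. concat (f x))"
  unfolding concat_conv_foldr by (intro computable_intros assms)

lemma computable_length [computable_intros]:
  assumes "computable f" shows "computable (\<lambda>x. length (f x))"
  unfolding length_conv_foldr by (intro computable_intros assms)

lemma decidable_Ball_set [computable_intros]:
  assumes "decidable (\<lambda>p. P (fst p) (snd p))" "computable l"
  shows "decidable (\<lambda>x. \<forall>a\<in>set (l x). P x a)"
proof -
  have "decidable (\<lambda>x. filter (\<lambda>a. \<not> P x a) (l x) = [])"
    by (intro computable_intros decidable_compose2[OF assms(1)] assms(2))
  then show ?thesis by (simp add: filter_empty_conv)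
qed

lemma decidable_Bex_set [computable_intros]:
  assumes "decidable (\<lambda>p. P (fst p) (snd p))" "computable l"
  shows "decidable (\<lambda>x. \<exists>a\<in>set (l x). P x a)"
proof -
  have "decidable (\<lambda>x. filter (P x) (l x) \<noteq> [])"
    by (intro computable_intros decidable_compose2[OF assms(1)] assms(2))
  then show ?thesis by (simp add: filter_empty_conv)
qed

lemma decidable_member [computable_intros]:
  assumes "computable f" "computable l" shows "decidable (\<lambda>x. f x \<in> set (l x))"
proof -
  have "decidable (\<lambda>x. \<exists>a\<in>set (l x). a = f x)"
    by (intro computable_intros assms computable_compose[OF assms(1)])
  then show ?thesis by simp
qed

lemma computable_upt [computable_intros]:
  assumes "computable n" shows "computable (\<lambda>x. [0..<n x])"
proof -
  have "computable (\<lambda>x. rec_nat [] (\<lambda>m r. r @ [m]) (n x))"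
    by (intro computable_intros assms)
  moreover have "rec_nat [] (\<lambda>m r. r @ [m]) n = [0..<n]" for n
    by (induction n) auto
  ultimately show ?thesis by simp
qed

lemma decidable_odd [computable_intros]:
  assumes "computable f" shows "decidable (\<lambda>x. odd (f x :: nat))"
proof -
  have "computable (\<lambda>x. rec_nat 0 (\<lambda>m r. 1 - r) (f x) :: nat)"
    by (intro computable_intros assms)
  moreover have "rec_nat 0 (\<lambda>m r. 1 - r) n = (if odd n then 1 else 0 :: nat)" for n
    by (induction n) auto
  ultimately show ?thesis by (simp add: decidable_def)
qed

lemma computable_power [computable_intros]:
  fixes f :: "'a::coded \<Rightarrow> nat"
  assumes "computable f" "computable n" shows "computable (\<lambda>x. f x ^ n x)"
proof -
  have "computable (\<lambda>x. rec_nat 1 (\<lambda>m r. r * f x) (n x))"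
    by (intro computable_intros assms computable_compose[OF assms(1)])
  moreover have "rec_nat 1 (\<lambda>m r. r * k) n = k ^ n" for k n :: nat
    by (induction n) auto
  ultimately show ?thesis by simp
qed

text \<open>
  General recursion: the recursive calls needed for \<open>f x\<close> may depend on the values of other recursive
  calls. A table of input-output pairs in which every entry is justified by the entries after it
  certifies the values of \<open>f\<close>, and such a table is found by unbounded search.
\<close>

lemma computable_by_tables:
  fixes f :: "'a::coded \<Rightarrow> 'b::coded" and m :: "'a \<Rightarrow> nat"
  assumes ready: "decidable (\<lambda>p. ready (fst p) (snd p))"
    and step: "computable (\<lambda>p. step (fst p) (snd p))"
    and sound: "\<And>T x. \<forall>e\<in>set T. snd e = f (fst e) \<Longrightarrow> ready T x \<Longrightarrow> step T x = f x"
    and complete: "\<And>x. \<exists>ds. (\<forall>d\<in>set ds. m d < m x) \<and>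
      (\<forall>T. (\<forall>e\<in>set T. snd e = f (fst e)) \<longrightarrow> set ds \<subseteq> fst ` set T \<longrightarrow> ready T x)"
  shows "computable f"
proof -
  define valid where "valid T \<longleftrightarrow>
    rec_list 1 (\<lambda>e T r. if ready T (fst e) \<and> snd e = step T (fst e) then r else 0) T = (1::nat)" for T
  have valid_Nil: "valid []" by (simp add: valid_def)
  have valid_Cons: "valid (e # T) \<longleftrightarrow> ready T (fst e) \<and> snd e = step T (fst e) \<and> valid T" for e T
    by (auto simp: valid_def)
  have decidable_valid: "decidable valid"
    unfolding valid_def
    by (intro computable_intros decidable_compose2[OF ready] computable_compose2[OF step])
  have correct: "valid T \<Longrightarrow> \<forall>e\<in>set T. snd e = f (fst e)" for T
    by (induction T) (auto simp: valid_Cons sound)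
  \<comment> \<open>Starting from an arbitrary valid \<open>T\<close> lets the tables for several
    dependencies accumulate, so that no two tables have to be merged.\<close>
  have extend: "valid T \<Longrightarrow> \<exists>T'. valid T' \<and> set T \<subseteq> set T' \<and> x \<in> fst ` set T'" for x T
  proof (induction "m x" arbitrary: x T rule: less_induct)
    case less
    obtain ds where ds: "\<forall>d\<in>set ds. m d < m x"
      "\<And>T. \<forall>e\<in>set T. snd e = f (fst e) \<Longrightarrow> set ds \<subseteq> fst ` set T \<Longrightarrow> ready T x"
      using complete[of x] by blast
    from ds(1) have "\<exists>T'. valid T' \<and> set T \<subseteq> set T' \<and> set ds \<subseteq> fst ` set T'"
    proof (induction ds)
      case Nil
      then show ?case using less.prems by auto
    next
      case (Cons d ds)
      then obtain T1 where T1: "valid T1" "set T \<subseteq> set T1" "set ds \<subseteq> fst ` set T1" by auto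
      obtain T2 where "valid T2" "set T1 \<subseteq> set T2" "d \<in> fst ` set T2"
        using less.hyps[of d T1] Cons.prems T1(1) by auto
      moreover from this T1 have "set T \<subseteq> set T2" "set (d # ds) \<subseteq> fst ` set T2"
        using image_mono[of "set T1" "set T2" fst] by auto
      ultimately show ?case by blast
    qed
    then obtain T' where T': "valid T'" "set T \<subseteq> set T'" "set ds \<subseteq> fst ` set T'" by blast
    then have "valid ((x, step T' x) # T')"
      using ds(2) correct by (simp add: valid_Cons)
    with T'(2) show ?case by (intro exI[of _ "(x, step T' x) # T'"]) auto
  qed
  define P where "P x T \<longleftrightarrow> valid T \<and> filter (\<lambda>e. fst e = x) T \<noteq> []" for x T
  have ex: "\<exists>T. P x T" for x
    using extend[OF valid_Nil, of x] by (force simp: P_def filter_empty_conv)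
  have entry: "snd (hd (filter (\<lambda>e. fst e = x) T)) = f x" if "P x T" for x T
  proof -
    have "hd (filter (\<lambda>e. fst e = x) T) \<in> set (filter (\<lambda>e. fst e = x) T)"
      using that by (simp add: P_def del: set_filter)
    then show ?thesis using that correct by (auto simp: P_def)
  qed
  have "computable (\<lambda>x. snd (hd (filter (\<lambda>e. fst e = x) (least_coded (P x)))))"
    by (intro computable_intros ex) (unfold P_def, intro computable_intros decidable_compose[OF decidable_valid])
  moreover have "snd (hd (filter (\<lambda>e. fst e = x) (least_coded (P x)))) = f x" for x
    using ex[of x] by (intro entry) (auto intro: least_codedI)
  ultimately show ?thesis by simp
qed

section \<open>Linear forms over a presented field\<close>

text \<open>
  A form is the list of the codes of its coefficients. The variables at odd positions are generic reals,
  those at even positions are rational, and variable \<open>0\<close> has the value \<open>1\<close>. A clause consists of forms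
  that vanish and forms that are positive.
\<close>

type_synonym form = "nat list"
type_synonym clause = "form list \<times> form list"

lemma vars_map_trm [simp]: "vars (map_trm f t) = vars t"
  by (induction t) auto

lemma free_vars_map_fm [simp]: "free_vars (map_fm f \<phi>) = free_vars \<phi>"
  by (induction \<phi>) auto

lemma trm_val_cong: "(\<And>x. x \<in> vars t \<Longrightarrow> e x = e' x) \<Longrightarrow> trm_val e t = trm_val e' t"
  by (induction t) auto

lemma sat_cong: "(\<And>x. x \<in> free_vars \<phi> \<Longrightarrow> e x = e' x) \<Longrightarrow> sat e \<phi> \<longleftrightarrow> sat e' \<phi>"
proof (induction \<phi> arbitrary: e e')
  case (Eq s t)
  then have "trm_val e s = trm_val e' s" "trm_val e t = trm_val e' t"
    by (auto intro!: trm_val_cong)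
  then show ?case by simp
next
  case (Less s t)
  then have "trm_val e s = trm_val e' s" "trm_val e t = trm_val e' t"
    by (auto intro!: trm_val_cong)
  then show ?case by simp
next
  case (InQ t)
  then have "trm_val e t = trm_val e' t" by (auto intro!: trm_val_cong)
  then show ?case by simp
next
  case (Neg \<phi>)
  have "sat e \<phi> \<longleftrightarrow> sat e' \<phi>" using Neg.prems by (intro Neg.IH) simp
  then show ?case by simp
next
  case (Conj \<phi> \<psi>)
  have "sat e \<phi> \<longleftrightarrow> sat e' \<phi>" "sat e \<psi> \<longleftrightarrow> sat e' \<psi>"
    using Conj.prems by (intro Conj.IH; simp)+
  then show ?case by simp
next
  case (Ex x \<phi>)
  have "sat (e(x := a)) \<phi> \<longleftrightarrow> sat (e'(x := a)) \<phi>" for a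
    using Ex.prems by (intro Ex.IH) auto
  then show ?case by simp
qed

text \<open>An open interval rather than a point, because the witness must still be moved to a
  rational or to a generic position inside it. Weak bounds at the ends suffice, since the points
  used lie strictly inside.\<close>

lemma separating_interval:
  fixes L U :: "real set"
  assumes "finite L" "finite U" "\<And>l u. l \<in> L \<Longrightarrow> u \<in> U \<Longrightarrow> l < u"
  shows "\<exists>a b. a < b \<and> (\<forall>l\<in>L. l \<le> a) \<and> (\<forall>u\<in>U. b \<le> u)"
proof (cases "L = {}")
  case True
  show ?thesis
  proof (cases "U = {}")
    case True
    with \<open>L = {}\<close> show ?thesis by - (rule exI[of _ 0], rule exI[of _ 1], auto)
  next
    case False
    with \<open>L = {}\<close> assms(2) show ?thesis
      by - (rule exI[of _ "Min U - 1"], rule exI[of _ "Min U"], auto simp del: Min_gr_iff)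
  qed
next
  case L: False
  show ?thesis
  proof (cases "U = {}")
    case True
    then show ?thesis using assms(1) by - (rule exI[of _ "Max L"], rule exI[of _ "Max L + 1"], auto)
  next
    case False
    with L assms show ?thesis by - (rule exI[of _ "Max L"], rule exI[of _ "Min U"], auto)
  qed
qed

text \<open>Only the algebra of a presentation: correctness of the elimination is proved here, and
  effectiveness enters in \<open>computable_field\<close>.\<close>

locale presented_field =
  fixes \<nu> :: "nat \<Rightarrow> real" and K :: "real set"
    and add :: "nat \<Rightarrow> nat \<Rightarrow> nat" and neg :: "nat \<Rightarrow> nat" and mul :: "nat \<Rightarrow> nat \<Rightarrow> nat"
  assumes subfield: "real_subfield K"
    and Rats_subset: "\<rat> \<subseteq> K"
    and bij: "bij_betw \<nu> UNIV K"
    and add [simp]: "\<nu> (add i j) = \<nu> i + \<nu> j"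
    and neg [simp]: "\<nu> (neg i) = - \<nu> i"
    and mul [simp]: "\<nu> (mul i j) = \<nu> i * \<nu> j"
begin

section \<open>Codes of field elements; forms and their values\<close>

definition code :: "real \<Rightarrow> nat" where
  "code x = inv_into UNIV \<nu> x"

lemma \<nu>_in_K [simp]: "\<nu> i \<in> K"
  using bij by (auto simp: bij_betw_def)

lemma \<nu>_code [simp]: "x \<in> K \<Longrightarrow> \<nu> (code x) = x"
  using bij by (simp add: code_def bij_betw_def f_inv_into_f)

lemma \<nu>_eq_iff [simp]: "\<nu> i = \<nu> j \<longleftrightarrow> i = j"
  using bij by (auto simp: bij_betw_def inj_def)

definition zer :: nat where "zer = code 0"
definition one :: nat where "one = code 1"
definition recip :: "nat \<Rightarrow> nat" where "recip i = code (inverse (\<nu> i))"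

lemma \<nu>_zer [simp]: "\<nu> zer = 0"
  using subfield by (simp add: zer_def real_subfield_def)

lemma \<nu>_one [simp]: "\<nu> one = 1"
  using subfield by (simp add: one_def real_subfield_def)

lemma \<nu>_recip [simp]: "\<nu> (recip i) = inverse (\<nu> i)"
proof -
  have "inverse (\<nu> i) \<in> K"
    using subfield \<nu>_in_K[of i] by (cases "\<nu> i = 0") (auto simp: real_subfield_def)
  then show ?thesis by (simp add: recip_def)
qed

lemma eq_zer_iff: "k = zer \<longleftrightarrow> \<nu> k = 0"
  using \<nu>_eq_iff[of k zer] by simp

lemma eq_one_iff: "k = one \<longleftrightarrow> \<nu> k = 1"
  using \<nu>_eq_iff[of k one] by simp

text \<open>Reading \<open>zer\<close> past the end lets forms of different lengths be added and
  compared. Several lists represent the same linear form, so the operations are characterised by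
  their coefficients and values rather than by equality of lists.\<close>

definition coef :: "form \<Rightarrow> nat \<Rightarrow> nat" where
  "coef h i = (if i < length h then h ! i else zer)"

definition val :: "(nat \<Rightarrow> real) \<Rightarrow> form \<Rightarrow> real" where
  "val w h = (\<Sum>i<length h. \<nu> (coef h i) * w i)"

lemma coef_Nil [simp]: "coef [] i = zer"
  by (simp add: coef_def)

lemma coef_ge: "length h \<le> i \<Longrightarrow> coef h i = zer"
  by (simp add: coef_def)

lemma coef_map_upt: "coef (map f [0..<n]) i = (if i < n then f i else zer)"
  by (simp add: coef_def)

lemma val_eq_sum:
  assumes "length h \<le> n"
  shows "val w h = (\<Sum>i<n. \<nu> (coef h i) * w i)"
  unfolding val_def by (rule sum.mono_neutral_left) (use assms in \<open>auto simp: coef_ge\<close>)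

lemma val_cong:
  assumes "\<And>i. i < length h \<Longrightarrow> \<nu> (coef h i) \<noteq> 0 \<Longrightarrow> w i = w' i"
  shows "val w h = val w' h"
  unfolding val_def using assms by (intro sum.cong) auto

definition fadd :: "form \<Rightarrow> form \<Rightarrow> form" where
  "fadd h g = map (\<lambda>i. add (coef h i) (coef g i)) [0..<length h + length g]"

definition fscale :: "nat \<Rightarrow> form \<Rightarrow> form" where
  "fscale k h = map (mul k) h"

definition fsub :: "form \<Rightarrow> form \<Rightarrow> form" where
  "fsub h g = fadd h (fscale (neg one) g)"

definition unit_form :: "nat \<Rightarrow> form" where
  "unit_form v = map (\<lambda>i. if i = v then one else zer) [0..<Suc v]"

definition clear :: "nat \<Rightarrow> form \<Rightarrow> form" where
  "clear v h = map (\<lambda>i. if i = v then zer else coef h i) [0..<length h]"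

text \<open>The value that \<open>h = 0\<close> forces on variable \<open>v\<close>, meaningful for
  a nonzero coefficient at \<open>v\<close>; the result does not contain \<open>v\<close>.\<close>

definition solve :: "nat \<Rightarrow> form \<Rightarrow> form" where
  "solve v h = fscale (neg (recip (coef h v))) (clear v h)"

definition fsubst :: "nat \<Rightarrow> form \<Rightarrow> form \<Rightarrow> form" where
  "fsubst v u h = fadd (clear v h) (fscale (coef h v) u)"

lemma coef_fadd [simp]: "\<nu> (coef (fadd h g) i) = \<nu> (coef h i) + \<nu> (coef g i)"
  by (auto simp: fadd_def coef_map_upt coef_ge)

lemma coef_fscale [simp]: "\<nu> (coef (fscale k h) i) = \<nu> k * \<nu> (coef h i)"
  by (auto simp: fscale_def coef_def)

lemma coef_fsub [simp]: "\<nu> (coef (fsub h g) i) = \<nu> (coef h i) - \<nu> (coef g i)"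
  by (simp add: fsub_def)

lemma coef_unit_form [simp]: "\<nu> (coef (unit_form v) i) = of_bool (i = v)"
  by (simp add: unit_form_def coef_map_upt del: upt_Suc)

lemma coef_clear [simp]: "\<nu> (coef (clear v h) i) = (if i = v then 0 else \<nu> (coef h i))"
  by (auto simp: clear_def coef_map_upt coef_ge)

lemma coef_solve [simp]:
  "\<nu> (coef (solve v h) i) = (if i = v then 0 else - \<nu> (coef h i) / \<nu> (coef h v))"
  by (simp add: solve_def field_simps)

lemma coef_fsubst [simp]:
  "\<nu> (coef (fsubst v u h) i) = (if i = v then 0 else \<nu> (coef h i)) + \<nu> (coef h v) * \<nu> (coef u i)"
  by (simp add: fsubst_def)

lemma length_solve [simp]: "length (solve v h) = length h"
  by (simp add: solve_def fscale_def clear_def)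

lemma val_Nil [simp]: "val w [] = 0"
  by (simp add: val_def)

lemma val_fadd [simp]: "val w (fadd h g) = val w h + val w g"
proof -
  have "length (fadd h g) = length h + length g" by (simp add: fadd_def)
  then show ?thesis
    using val_eq_sum[of "fadd h g" "length h + length g"] val_eq_sum[of h "length h + length g"]
      val_eq_sum[of g "length h + length g"]
    by (simp add: distrib_right sum.distrib)
qed

lemma val_fscale [simp]: "val w (fscale k h) = \<nu> k * val w h"
proof -
  have "length (fscale k h) = length h" by (simp add: fscale_def)
  then show ?thesis by (simp add: val_def sum_distrib_left mult.assoc)
qed

lemma val_fsub [simp]: "val w (fsub h g) = val w h - val w g"
  by (simp add: fsub_def)

lemma val_unit_form [simp]: "val w (unit_form v) = w v"
proof -
  have "length (unit_form v) = Suc v" by (simp add: unit_form_def)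
  then show ?thesis by (simp add: val_def of_bool_def if_distrib[of "\<lambda>x. x * _"] cong: if_cong)
qed

lemma val_clear: "val w (clear v h) = val w h - \<nu> (coef h v) * w v"
proof -
  define n where "n = Suc (length h + v)"
  have l: "length (clear v h) \<le> n" "length h \<le> n" by (simp_all add: clear_def n_def)
  have "val w (clear v h) = (\<Sum>i\<in>{..<n} - {v}. \<nu> (coef h i) * w i)"
    unfolding val_eq_sum[OF l(1)] by (subst sum.remove[of _ v]) (auto simp: n_def intro!: sum.cong)
  moreover have "val w h = \<nu> (coef h v) * w v + (\<Sum>i\<in>{..<n} - {v}. \<nu> (coef h i) * w i)"
    unfolding val_eq_sum[OF l(2)] by (subst sum.remove[of _ v]) (auto simp: n_def)
  ultimately show ?thesis by simp
qed

lemma val_upd: "val (w(v := x)) h = val w h + \<nu> (coef h v) * (x - w v)"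
proof -
  have "val (w(v := x)) (clear v h) = val w (clear v h)" by (rule val_cong) auto
  then show ?thesis by (simp add: val_clear algebra_simps)
qed

text \<open>One Newton step in coordinate \<open>v\<close> reaches the root of an affine function.
  In this shape the sign of \<open>val w h\<close> tells on which side of the root
  \<open>w v\<close> lies, which is how Fourier--Motzkin elimination uses it.\<close>

lemma val_solve: "\<nu> (coef h v) \<noteq> 0 \<Longrightarrow> val w (solve v h) = w v - val w h / \<nu> (coef h v)"
  by (simp add: solve_def val_clear field_simps)

lemma val_fsubst: "val w (fsubst v u h) = val (w(v := val w u)) h"
  by (simp add: fsubst_def val_clear val_upd algebra_simps)

text \<open>The quantifier ranges over a list so that decidability is immediate; positions past the
  end carry \<open>zer\<close> anyway.\<close>

definition nogen :: "form \<Rightarrow> bool" where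
  "nogen h \<longleftrightarrow> (\<forall>i\<in>set [0..<length h]. odd i \<longrightarrow> coef h i = zer)"

lemma nogen_iff: "nogen h \<longleftrightarrow> (\<forall>i. odd i \<longrightarrow> \<nu> (coef h i) = 0)"
proof
  assume h: "nogen h"
  show "\<forall>i. odd i \<longrightarrow> \<nu> (coef h i) = 0"
  proof (intro allI impI)
    fix i :: nat assume "odd i"
    with h show "\<nu> (coef h i) = 0"
      by (cases "i < length h") (auto simp: nogen_def coef_ge)
  qed
qed (auto simp: nogen_def eq_zer_iff)

section \<open>Clauses and Fourier--Motzkin elimination\<close>

definition holds_clause :: "(nat \<Rightarrow> real) \<Rightarrow> clause \<Rightarrow> bool" where
  "holds_clause w c \<longleftrightarrow> (\<forall>h\<in>set (fst c). val w h = 0) \<and> (\<forall>h\<in>set (snd c). 0 < val w h)"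

definition holds_dnf :: "(nat \<Rightarrow> real) \<Rightarrow> clause list \<Rightarrow> bool" where
  "holds_dnf w D \<longleftrightarrow> (\<exists>c\<in>set D. holds_clause w c)"

text \<open>The variable \<open>v\<close> must not occur in the equations of \<open>c\<close>, which are kept.\<close>

definition fourier_motzkin :: "nat \<Rightarrow> clause \<Rightarrow> clause" where
  "fourier_motzkin v c = (fst c,
    filter (\<lambda>h. coef h v = zer) (snd c) @
    concat (map (\<lambda>l. map (\<lambda>u. fsub (solve v u) (solve v l)) (filter (\<lambda>h. \<nu> (coef h v) < 0) (snd c)))
      (filter (\<lambda>h. 0 < \<nu> (coef h v)) (snd c))))"

text \<open>The root of an inequality is a lower bound for \<open>v\<close> if the coefficient of
  \<open>v\<close> is positive and an upper bound if it is negative. The new inequalities place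
  every lower bound below every upper bound, which leaves room for an interval.\<close>

lemma fourier_motzkin_interval:
  assumes "\<forall>h\<in>set (fst c). coef h v = zer" and "holds_clause w (fourier_motzkin v c)"
  shows "\<exists>a b. a < b \<and> (\<forall>x. a < x \<and> x < b \<longrightarrow> holds_clause (w(v := x)) c)"
proof -
  let ?L = "(\<lambda>h. val w (solve v h)) ` {h \<in> set (snd c). 0 < \<nu> (coef h v)}"
  let ?U = "(\<lambda>h. val w (solve v h)) ` {h \<in> set (snd c). \<nu> (coef h v) < 0}"
  have "l < u" if "l \<in> ?L" "u \<in> ?U" for l u
  proof -
    from that obtain g h where "l = val w (solve v g)" "g \<in> set (snd c)" "0 < \<nu> (coef g v)"
      "u = val w (solve v h)" "h \<in> set (snd c)" "\<nu> (coef h v) < 0"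
      by auto
    moreover from this have "fsub (solve v h) (solve v g) \<in> set (snd (fourier_motzkin v c))"
      by (auto simp: fourier_motzkin_def)
    with assms(2) have "0 < val w (fsub (solve v h) (solve v g))"
      unfolding holds_clause_def by blast
    ultimately show ?thesis by simp
  qed
  moreover have "finite ?L" "finite ?U" by simp_all
  ultimately obtain a b where ab: "a < b" "\<forall>l\<in>?L. l \<le> a" "\<forall>u\<in>?U. b \<le> u"
    using separating_interval[of ?L ?U] by blast
  have "holds_clause (w(v := x)) c" if x: "a < x" "x < b" for x
    unfolding holds_clause_def
  proof (intro conjI ballI)
    fix h assume "h \<in> set (fst c)"
    with assms show "val (w(v := x)) h = 0"
      by (auto simp: holds_clause_def fourier_motzkin_def val_upd)
  next
    fix h assume h: "h \<in> set (snd c)"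
    consider "\<nu> (coef h v) = 0" | "0 < \<nu> (coef h v)" | "\<nu> (coef h v) < 0" by linarith
    then show "0 < val (w(v := x)) h"
    proof cases
      case 1
      with assms(2) h show ?thesis by (auto simp: holds_clause_def fourier_motzkin_def val_upd eq_zer_iff)
    next
      case 2
      with ab h have "val w (solve v h) \<le> a" by auto
      with x 2 have "w v - val w h / \<nu> (coef h v) < x" by (simp add: val_solve)
      with 2 show ?thesis by (simp add: val_upd field_simps)
    next
      case 3
      with ab h have "b \<le> val w (solve v h)" by auto
      with x 3 have "x < w v - val w h / \<nu> (coef h v)" by (simp add: val_solve)
      with 3 show ?thesis by (simp add: val_upd field_simps)
    qed
  qed
  with ab(1) show ?thesis by blast
qed

lemma fourier_motzkin_necessary:
  assumes "\<forall>h\<in>set (fst c). coef h v = zer" and "holds_clause (w(v := x)) c"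
  shows "holds_clause w (fourier_motzkin v c)"
proof -
  have less: "val w (solve v l) < val w (solve v u)"
    if "l \<in> set (snd c)" "0 < \<nu> (coef l v)" "u \<in> set (snd c)" "\<nu> (coef u v) < 0" for l u
  proof -
    have "0 < val w l + \<nu> (coef l v) * (x - w v)" "0 < val w u + \<nu> (coef u v) * (x - w v)"
      using assms(2) that by (auto simp: holds_clause_def val_upd)
    then have "w v - val w l / \<nu> (coef l v) < x" "x < w v - val w u / \<nu> (coef u v)"
      using that by (simp_all add: field_simps)
    with that show ?thesis by (simp add: val_solve)
  qed
  with assms show ?thesis
    by (auto simp: holds_clause_def fourier_motzkin_def val_upd eq_zer_iff)
qed

lemma val_coef_cong:
  assumes "\<And>i. \<nu> (coef h i) = \<nu> (coef g i)"
  shows "val w h = val w g"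
  using val_eq_sum[of h "length h + length g" w] val_eq_sum[of g "length h + length g" w] assms by simp

subsection \<open>Rationality and elimination of rational variables\<close>

definition ratl :: "(nat \<Rightarrow> real) \<Rightarrow> bool" where
  "ratl w \<longleftrightarrow> (\<forall>i. even i \<longrightarrow> w i \<in> \<rat>)"

lemma ratl_upd: "ratl w \<Longrightarrow> x \<in> \<rat> \<or> odd v \<Longrightarrow> ratl (w(v := x))"
  by (auto simp: ratl_def)

definition lin :: "(nat \<times> form) list \<Rightarrow> form" where
  "lin ps = foldr (\<lambda>p acc. fadd (fscale (fst p) (snd p)) acc) ps []"

lemma coef_lin: "\<nu> (coef (lin ps) i) = (\<Sum>p\<leftarrow>ps. \<nu> (fst p) * \<nu> (coef (snd p) i))"
  by (induction ps) (auto simp: lin_def)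

lemma val_lin: "val w (lin ps) = (\<Sum>p\<leftarrow>ps. \<nu> (fst p) * val w (snd p))"
  by (induction ps) (auto simp: lin_def)

text \<open>\<open>h = \<Sum> b \<cdot> c\<close> over the pairs \<open>(b, c)\<close> of \<open>ps\<close>, with \<open>\<rat>\<close>-linearly independent scalars \<open>b\<close>, the
  first of which is \<open>1\<close>, and forms \<open>c\<close> with rational coefficients.\<close>

definition decomposition :: "form \<Rightarrow> (nat \<times> form) list \<Rightarrow> bool" where
  "decomposition h ps \<longleftrightarrow> ps \<noteq> [] \<and> fst (hd ps) = one \<and> distinct (map fst ps) \<and>
    rat_real.independent (\<nu> ` set (map fst ps)) \<and>
    (\<forall>p\<in>set ps. \<forall>k\<in>set (snd p). \<nu> k \<in> \<rat>) \<and>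
    (\<forall>p\<in>set ps. \<forall>i\<in>set [0..<length (snd p)]. coef h i = zer \<longrightarrow> coef (snd p) i = zer) \<and>
    (\<forall>i\<in>set [0..<length h + length (lin ps)]. coef h i = coef (lin ps) i)"

text \<open>A maximal independent subset of \<open>1\<close> and the coefficients of
  \<open>h\<close> that contains \<open>1\<close> spans them all. The coordinates of the
  coefficients at a basis element \<open>b\<close>, taken position by position, make up the form
  that belongs to \<open>b\<close>.\<close>

lemma decomposition_exists: "\<exists>ps. decomposition h ps"
proof -
  have "rat_real.independent {1}" by simp
  then obtain B where B: "{1} \<subseteq> B" "B \<subseteq> insert 1 (\<nu> ` set h)" "rat_real.independent B"
    "insert 1 (\<nu> ` set h) \<subseteq> rat_real.span B"
    using rat_real.maximal_independent_subset_extend[of "{1}" "insert 1 (\<nu> ` set h)"] by auto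
  have fin: "finite B" using B(2) by (rule finite_subset) simp
  then obtain xs where xs: "set xs = B - {1}" "distinct xs" using finite_distinct_list by blast
  have "insert 1 (\<nu> ` set h) \<subseteq> K" using \<nu>_in_K[of one] by auto
  with B(2) have BK: "B \<subseteq> K" by blast
  \<comment> \<open>Coordinates are rational, hence lie in \<open>K\<close> and have codes.\<close>
  define r where "r k b = code (of_rat (rat_real.representation B (\<nu> k) b))" for k b
  have r: "\<nu> (r k b) = of_rat (rat_real.representation B (\<nu> k) b)" for k b
    unfolding r_def using Rats_subset by (intro \<nu>_code) auto
  define ps where "ps = map (\<lambda>b. (code b, map (\<lambda>k. r k b) h)) (1 # xs)"
  have inj: "inj_on code B" using BK by (metis \<nu>_code inj_onI subsetD)
  have set_xs: "set (1 # xs) = B" "distinct (1 # xs)" using xs B(1) by auto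
  have coef_r: "\<nu> (coef (map (\<lambda>k. r k b) h) i) = of_rat (rat_real.representation B (\<nu> (coef h i)) b)" for b i
    by (simp add: coef_def r rat_real.representation_zero)
  have img: "\<nu> ` set (map fst ps) = B"
  proof -
    have "\<nu> ` set (map fst ps) = (\<lambda>b. \<nu> (code b)) ` B"
      unfolding set_xs(1)[symmetric] by (simp add: ps_def image_image)
    also have "\<dots> = (\<lambda>b. b) ` B" using BK by (intro image_cong) auto
    finally show ?thesis by simp
  qed
  have lin: "\<nu> (coef (lin ps) i) = \<nu> (coef h i)" for i
  proof -
    have "\<nu> (coef h i) \<in> insert 0 (\<nu> ` set h)" by (auto simp: coef_def)
    then have "\<nu> (coef h i) \<in> rat_real.span B" using B(4) rat_real.span_zero by auto
    then have "(\<Sum>b\<in>B. of_rat (rat_real.representation B (\<nu> (coef h i)) b) * b) = \<nu> (coef h i)"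
      using B(3) fin by (intro rat_real.sum_representation_eq) auto
    moreover have "\<nu> (coef (lin ps) i) = (\<Sum>b\<leftarrow>1 # xs. \<nu> (code b) * of_rat (rat_real.representation B (\<nu> (coef h i)) b))"
      unfolding coef_lin ps_def by (simp add: comp_def coef_r)
    moreover have "\<dots> = (\<Sum>b\<in>B. \<nu> (code b) * of_rat (rat_real.representation B (\<nu> (coef h i)) b))"
      using set_xs by (simp only: sum_list_distinct_conv_sum_set)
    moreover have "\<dots> = (\<Sum>b\<in>B. of_rat (rat_real.representation B (\<nu> (coef h i)) b) * b)"
      using BK by (intro sum.cong) auto
    ultimately show ?thesis by simp
  qed
  have "decomposition h ps"
    unfolding decomposition_def
  proof (intro conjI ballI impI)
    show "ps \<noteq> []" "fst (hd ps) = one" by (simp_all add: ps_def one_def)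
    have "map fst ps = map code (1 # xs)" by (simp add: ps_def)
    then show "distinct (map fst ps)" using inj set_xs by (metis distinct_map)
    show "rat_real.independent (\<nu> ` set (map fst ps))" using B(3) unfolding img .
    show "\<nu> k \<in> \<rat>" if "p \<in> set ps" "k \<in> set (snd p)" for p k
      using that by (auto simp: ps_def r)
    show "coef (snd p) i = zer" if "p \<in> set ps" "coef h i = zer" for p i
      using that by (auto simp: ps_def eq_zer_iff coef_r rat_real.representation_zero)
    show "coef h i = coef (lin ps) i" for i using lin[of i] by simp
  qed
  then show ?thesis ..
qed

text \<open>The first scalar is \<open>1\<close>, and its form takes rational values at rational
  points; so only the other forms have to vanish.\<close>

definition ratl_conds :: "form \<Rightarrow> form list" where
  "ratl_conds h = map snd (tl (least_coded (decomposition h)))"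

lemma val_in_Rats:
  assumes "ratl w" "nogen c" "\<forall>k\<in>set c. \<nu> k \<in> \<rat>"
  shows "val w c \<in> \<rat>"
  unfolding val_def
proof (rule Rats_sum)
  fix i assume "i \<in> {..<length c}"
  then have "\<nu> (coef c i) \<in> \<rat>" using assms(3) by (auto simp: coef_def)
  then show "\<nu> (coef c i) * w i \<in> \<rat>"
    using assms(1,2) by (cases "odd i") (auto simp: nogen_iff ratl_def)
qed

lemma ratl_conds_decomposition:
  obtains c ps where "decomposition h ((one, c) # ps)" "ratl_conds h = map snd ps"
proof -
  let ?ps = "least_coded (decomposition h)"
  have "decomposition h ?ps"
    using decomposition_exists[of h] by (auto intro: least_codedI)
  moreover from this obtain c ps where "?ps = (one, c) # ps"
    by (cases ?ps) (auto simp: decomposition_def)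
  ultimately show ?thesis using that by (simp add: ratl_conds_def)
qed

text \<open>The clause of \<open>decomposition\<close> about zero coefficients serves this purpose:
  rationality conditions bring in neither generic variables nor variables that have already been
  eliminated.\<close>

lemma decomposition_support:
  assumes "decomposition h ps" "p \<in> set ps" "\<nu> (coef h i) = 0"
  shows "\<nu> (coef (snd p) i) = 0"
proof (cases "i < length (snd p)")
  case True
  then show ?thesis using assms by (auto simp: decomposition_def eq_zer_iff)
qed (simp add: coef_ge)

lemma ratl_conds_support:
  assumes "\<nu> (coef h i) = 0" "c \<in> set (ratl_conds h)"
  shows "\<nu> (coef c i) = 0"
  using assms by (rule_tac ratl_conds_decomposition[of h]) (auto dest: decomposition_support)

text \<open>If all forms but the one at the scalar \<open>1\<close> vanish, a rational value
  remains. Conversely, a rational value of \<open>h\<close> can be moved to the scalar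
  \<open>1\<close>, which yields a vanishing rational combination of independent scalars; so all its
  coefficients are zero.\<close>

lemma ratl_conds_iff:
  assumes "ratl w" "nogen h"
  shows "(\<forall>c\<in>set (ratl_conds h). val w c = 0) \<longleftrightarrow> val w h \<in> \<rat>"
proof -
  obtain c0 ps where d: "decomposition h ((one, c0) # ps)" and conds: "ratl_conds h = map snd ps"
    by (rule ratl_conds_decomposition)
  let ?ps = "(one, c0) # ps"
  have rat: "val w (snd p) \<in> \<rat>" if "p \<in> set ?ps" for p
  proof (rule val_in_Rats[OF assms(1)])
    show "nogen (snd p)"
      using decomposition_support[OF d that] assms(2) by (auto simp: nogen_iff)
    show "\<forall>k\<in>set (snd p). \<nu> k \<in> \<rat>" using d that unfolding decomposition_def by blast
  qed
  have "\<nu> (coef h i) = \<nu> (coef (lin ?ps) i)" for i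
    using d by (cases "i < length h + length (lin ?ps)") (auto simp: decomposition_def coef_ge)
  then have val_h: "val w h = val w c0 + (\<Sum>p\<leftarrow>ps. \<nu> (fst p) * val w (snd p))"
    using val_coef_cong[of h "lin ?ps"] by (simp add: val_lin)
  show ?thesis
  proof
    assume "\<forall>c\<in>set (ratl_conds h). val w c = 0"
    then have "(\<Sum>p\<leftarrow>ps. \<nu> (fst p) * val w (snd p)) = 0"
      by (subst map_cong[OF refl, of _ _ "\<lambda>_. 0"]) (auto simp: conds)
    then show "val w h \<in> \<rat>" using rat[of "(one, c0)"] by (simp add: val_h)
  next
    assume h: "val w h \<in> \<rat>"
    \<comment> \<open>The coefficient of the scalar \<open>1\<close> absorbs
      \<open>- val w h\<close>.\<close>
    define q where "q p = (if p = (one, c0) then val w c0 - val w h else val w (snd p))" for p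
    have "q p \<in> \<rat>" if "p \<in> set ?ps" for p
      using rat[OF that] rat[of "(one, c0)"] h by (auto simp: q_def)
    then have "\<forall>p\<in>set ?ps. \<exists>r. q p = of_rat r" by (auto simp: Rats_def)
    then obtain r where r: "\<And>p. p \<in> set ?ps \<Longrightarrow> q p = of_rat (r p)" by metis
    have dist: "distinct (map fst ?ps)" using d by (simp add: decomposition_def)
    let ?f = "\<lambda>p. \<nu> (fst p)"
    have "inj_on fst (set ?ps)" using dist unfolding distinct_map by blast
    then have inj: "inj_on ?f (set ?ps)" by (simp only: inj_on_def \<nu>_eq_iff)
    have "one \<notin> fst ` set ps" using dist by simp
    then have notin: "(one, c0) \<notin> set ps" by (metis fst_conv imageI)
    have "(\<Sum>p\<in>set ?ps. of_rat (r p) * ?f p) = (\<Sum>p\<in>set ?ps. q p * ?f p)"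
      using r by simp
    also have "\<dots> = (\<Sum>p\<leftarrow>?ps. q p * ?f p)"
      using dist notin by (subst sum_list_distinct_conv_sum_set) (auto simp: distinct_map)
    also have "\<dots> = val w c0 - val w h + (\<Sum>p\<leftarrow>ps. ?f p * val w (snd p))"
    proof -
      have "(\<Sum>p\<leftarrow>ps. q p * ?f p) = (\<Sum>p\<leftarrow>ps. ?f p * val w (snd p))"
        using notin by (intro arg_cong[of _ _ sum_list] map_cong) (auto simp: q_def)
      then show ?thesis by (simp add: q_def)
    qed
    finally have zero: "(\<Sum>p\<in>set ?ps. of_rat (r p) * ?f p) = 0" by (simp add: val_h)
    \<comment> \<open>Independence speaks of a set of reals, the combination of a list of pairs; as
      the scalars are distinct, the coefficients can be transported.\<close>
    define u where "u x = r (inv_into (set ?ps) ?f x)" for x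
    have "(\<Sum>x\<in>?f ` set ?ps. of_rat (u x) * x) = (\<Sum>p\<in>set ?ps. of_rat (u (?f p)) * ?f p)"
      using sum.reindex[OF inj] by (simp only: comp_def)
    also have "\<dots> = (\<Sum>p\<in>set ?ps. of_rat (r p) * ?f p)"
      by (intro sum.cong refl) (simp only: u_def inv_into_f_f[OF inj])
    finally have "(\<Sum>x\<in>?f ` set ?ps. of_rat (u x) * x) = 0" by (simp only: zero)
    moreover have "rat_real.independent (?f ` set ?ps)"
      using d by (simp add: decomposition_def image_image)
    ultimately have "u x = 0" if "x \<in> ?f ` set ?ps" for x
      using that by (intro rat_real.independentD[of "?f ` set ?ps" "?f ` set ?ps" u]) (auto simp del: list.set)
    then have "r p = 0" if "p \<in> set ?ps" for p
      using that inj unfolding u_def by (metis imageI inv_into_f_f)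
    then have "val w (snd p) = 0" if "p \<in> set ps" for p
      using r[of p] that notin by (auto simp: q_def split: if_splits)
    then show "\<forall>c\<in>set (ratl_conds h). val w c = 0" by (auto simp: conds)
  qed
qed

text \<open>An equation containing \<open>v\<close> leaves one candidate, admissible only if it is
  rational; \<open>ratl_conds\<close> expresses this by further equations. Without such an equation,
  density of \<open>\<rat>\<close> makes the Fourier--Motzkin step exact.\<close>

definition elim_rat :: "nat \<Rightarrow> clause \<Rightarrow> clause" where
  "elim_rat v c = (let es = filter (\<lambda>h. coef h v \<noteq> zer) (fst c) in
    if es = [] then fourier_motzkin v c else
    (let u = solve v (hd es) in (ratl_conds u @ map (fsubst v u) (fst c), map (fsubst v u) (snd c))))"

definition elim_rats :: "nat list \<Rightarrow> clause list \<Rightarrow> clause list" where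
  "elim_rats vs D = foldr (\<lambda>v D. map (elim_rat v) D) vs D"

text \<open>The invariant of the elimination. It makes \<open>ratl_conds_iff\<close> applicable to a
  solved equation, and it keeps generic variables out of the equations, as
  \<open>fourier_motzkin\<close> requires.\<close>

definition nogen_eqs :: "clause \<Rightarrow> bool" where
  "nogen_eqs c \<longleftrightarrow> (\<forall>h\<in>set (fst c). nogen h)"

lemma nogen_solve: "nogen h \<Longrightarrow> nogen (solve v h)"
  by (auto simp: nogen_iff)

lemma elim_rat_cases:
  obtains "\<forall>h\<in>set (fst c). coef h v = zer" "elim_rat v c = fourier_motzkin v c"
  | e where "e \<in> set (fst c)" "\<nu> (coef e v) \<noteq> 0"
    "elim_rat v c = (ratl_conds (solve v e) @ map (fsubst v (solve v e)) (fst c), map (fsubst v (solve v e)) (snd c))"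
proof (cases "filter (\<lambda>h. coef h v \<noteq> zer) (fst c)")
  case Nil
  then show ?thesis using that(1) by (auto simp: elim_rat_def filter_empty_conv)
next
  case (Cons e es)
  then have "e \<in> set (filter (\<lambda>h. coef h v \<noteq> zer) (fst c))" by simp
  then have "e \<in> set (fst c)" "\<nu> (coef e v) \<noteq> 0" by (simp_all add: eq_zer_iff)
  then show ?thesis by (rule that(2)) (simp add: elim_rat_def Cons Let_def)
qed

lemma nogen_elim_rat:
  assumes "nogen_eqs c" shows "nogen_eqs (elim_rat v c)"
proof (rule elim_rat_cases[of c v])
  fix e assume e: "e \<in> set (fst c)"
    "elim_rat v c = (ratl_conds (solve v e) @ map (fsubst v (solve v e)) (fst c), map (fsubst v (solve v e)) (snd c))"
  from e(1) assms have "nogen (solve v e)" by (simp add: nogen_eqs_def nogen_solve)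
  then show ?thesis
    using assms e(2) by (auto simp: nogen_eqs_def nogen_iff ratl_conds_support simp del: coef_solve)
qed (use assms in \<open>auto simp: nogen_eqs_def fourier_motzkin_def\<close>)

lemma elim_rat_correct:
  assumes "ratl w" "nogen_eqs c"
  shows "holds_clause w (elim_rat v c) \<longleftrightarrow> (\<exists>x\<in>\<rat>. holds_clause (w(v := x)) c)"
proof (rule elim_rat_cases[of c v])
  assume *: "\<forall>h\<in>set (fst c). coef h v = zer" "elim_rat v c = fourier_motzkin v c"
  show ?thesis
  proof
    assume "holds_clause w (elim_rat v c)"
    then obtain a b where "a < b" "\<forall>x. a < x \<and> x < b \<longrightarrow> holds_clause (w(v := x)) c"
      using fourier_motzkin_interval[OF *(1), of w] unfolding *(2) by blast
    then show "\<exists>x\<in>\<rat>. holds_clause (w(v := x)) c" using Rats_dense_in_real[of a b] by auto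
  qed (use fourier_motzkin_necessary[OF *(1)] *(2) in auto)
next
  fix e assume e: "e \<in> set (fst c)" "\<nu> (coef e v) \<noteq> 0"
    "elim_rat v c = (ratl_conds (solve v e) @ map (fsubst v (solve v e)) (fst c), map (fsubst v (solve v e)) (snd c))"
  let ?x = "val w (solve v e)"
  from e(1) assms(2) have "nogen (solve v e)" by (simp add: nogen_eqs_def nogen_solve)
  then have "holds_clause w (elim_rat v c) \<longleftrightarrow> ?x \<in> \<rat> \<and> holds_clause (w(v := ?x)) c"
    using ratl_conds_iff[OF assms(1)] by (simp add: e(3) holds_clause_def val_fsubst ball_Un)
  moreover have "x = ?x" if "holds_clause (w(v := x)) c" for x
  proof -
    have "val (w(v := x)) e = 0" using that e(1) by (simp add: holds_clause_def)
    then show ?thesis using e(2) by (simp add: val_upd val_solve field_simps)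
  qed
  ultimately show ?thesis by auto
qed

lemma nogen_elim_rats: "\<forall>c\<in>set D. nogen_eqs c \<Longrightarrow> \<forall>c\<in>set (elim_rats vs D). nogen_eqs c"
  by (induction vs) (auto simp: elim_rats_def nogen_elim_rat)

lemma elim_rats_correct:
  assumes "\<forall>c\<in>set D. nogen_eqs c" "ratl w" "\<forall>v\<in>set vs. even v"
  shows "holds_dnf w (elim_rats vs D) \<longleftrightarrow>
    (\<exists>w'. (\<forall>i. i \<notin> set vs \<longrightarrow> w' i = w i) \<and> ratl w' \<and> holds_dnf w' D)"
  using assms(2,3)
proof (induction vs arbitrary: w)
  case Nil
  have "w' = w" if "\<forall>i. w' i = w i" for w' using that by auto
  with Nil show ?case by (auto simp: elim_rats_def)
next
  case (Cons v vs)
  have "holds_dnf w (elim_rats (v # vs) D) \<longleftrightarrow> (\<exists>c\<in>set (elim_rats vs D). \<exists>x\<in>\<rat>. holds_clause (w(v := x)) c)"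
    using nogen_elim_rats[OF assms(1), of vs] elim_rat_correct[OF Cons.prems(1)]
    by (simp add: elim_rats_def holds_dnf_def)
  also have "\<dots> \<longleftrightarrow> (\<exists>x\<in>\<rat>. holds_dnf (w(v := x)) (elim_rats vs D))"
    by (auto simp: holds_dnf_def)
  also have "\<dots> \<longleftrightarrow> (\<exists>x\<in>\<rat>. \<exists>w'. (\<forall>i. i \<notin> set vs \<longrightarrow> w' i = (w(v := x)) i) \<and> ratl w' \<and> holds_dnf w' D)"
  proof (intro bex_cong refl)
    fix x :: real assume "x \<in> \<rat>"
    with Cons.prems show "holds_dnf (w(v := x)) (elim_rats vs D) \<longleftrightarrow>
      (\<exists>w'. (\<forall>i. i \<notin> set vs \<longrightarrow> w' i = (w(v := x)) i) \<and> ratl w' \<and> holds_dnf w' D)"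
      by (intro Cons.IH[of "w(v := x)"] ratl_upd) auto
  qed
  also have "\<dots> \<longleftrightarrow> (\<exists>w'. (\<forall>i. i \<notin> set (v # vs) \<longrightarrow> w' i = w i) \<and> ratl w' \<and> holds_dnf w' D)" (is "?l \<longleftrightarrow> ?r")
  proof
    assume ?r
    then obtain w' where w': "\<forall>i. i \<notin> set (v # vs) \<longrightarrow> w' i = w i" "ratl w'" "holds_dnf w' D" by blast
    moreover from Cons.prems w'(2) have "w' v \<in> \<rat>" by (simp add: ratl_def)
    ultimately show ?l by (intro bexI[of _ "w' v"] exI[of _ w']) auto
  next
    assume ?l
    then obtain x w' where "\<forall>i. i \<notin> set vs \<longrightarrow> w' i = (w(v := x)) i" "ratl w'" "holds_dnf w' D" by blast
    then show ?r by (intro exI[of _ w']) auto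
  qed
  finally show ?case .
qed

section \<open>Conjunction and negation of disjunctive normal forms\<close>

definition conj_dnf :: "clause list \<Rightarrow> clause list \<Rightarrow> clause list" where
  "conj_dnf C D = concat (map (\<lambda>c. map (\<lambda>d. (fst c @ fst d, snd c @ snd d)) D) C)"

text \<open>A form with a generic part does not vanish at generic points, so no equation is needed for it.\<close>

definition neg_clause :: "clause \<Rightarrow> clause list" where
  "neg_clause c =
    concat (map (\<lambda>h. [([], [h]), ([], [fscale (neg one) h])]) (fst c)) @
    concat (map (\<lambda>h. ([], [fscale (neg one) h]) # (if nogen h then [([h], [])] else [])) (snd c))"

definition neg_dnf :: "clause list \<Rightarrow> clause list" where
  "neg_dnf D = foldr (\<lambda>c acc. conj_dnf (neg_clause c) acc) D [([], [])]"

lemma holds_conj_dnf: "holds_dnf w (conj_dnf C D) \<longleftrightarrow> holds_dnf w C \<and> holds_dnf w D"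
proof -
  have "holds_clause w (fst c @ fst d, snd c @ snd d) \<longleftrightarrow> holds_clause w c \<and> holds_clause w d" for c d
    by (auto simp: holds_clause_def)
  then show ?thesis by (auto simp: holds_dnf_def conj_dnf_def)
qed

lemma holds_neg_clause:
  assumes "\<And>h. h \<in> set (snd c) \<Longrightarrow> \<not> nogen h \<Longrightarrow> val w h \<noteq> 0"
  shows "holds_dnf w (neg_clause c) \<longleftrightarrow> \<not> holds_clause w c"
proof -
  have "holds_dnf w (neg_clause c) \<longleftrightarrow>
    (\<exists>h\<in>set (fst c). val w h > 0 \<or> val w h < 0) \<or>
    (\<exists>h\<in>set (snd c). val w h < 0 \<or> (nogen h \<and> val w h = 0))"
    by (auto simp: holds_dnf_def neg_clause_def holds_clause_def bex_Un split: if_splits)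
  also have "\<dots> \<longleftrightarrow> (\<exists>h\<in>set (fst c). val w h \<noteq> 0) \<or> (\<exists>h\<in>set (snd c). \<not> 0 < val w h)"
  proof (intro arg_cong2[of _ _ _ _ "(\<or>)"] bex_cong refl)
    fix h assume "h \<in> set (snd c)"
    with assms[of h] show "val w h < 0 \<or> (nogen h \<and> val w h = 0) \<longleftrightarrow> \<not> 0 < val w h"
      by (cases "nogen h") auto
  qed auto
  finally show ?thesis by (auto simp: holds_clause_def)
qed

lemma holds_neg_dnf:
  assumes "\<And>c h. c \<in> set D \<Longrightarrow> h \<in> set (snd c) \<Longrightarrow> \<not> nogen h \<Longrightarrow> val w h \<noteq> 0"
  shows "holds_dnf w (neg_dnf D) \<longleftrightarrow> \<not> holds_dnf w D"
  using assms
proof (induction D)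
  case Nil
  then show ?case by (simp add: neg_dnf_def holds_dnf_def holds_clause_def)
next
  case (Cons c D)
  have "holds_dnf w (neg_dnf (c # D)) \<longleftrightarrow> holds_dnf w (neg_clause c) \<and> holds_dnf w (neg_dnf D)"
    by (simp add: neg_dnf_def holds_conj_dnf)
  also have "\<dots> \<longleftrightarrow> \<not> holds_clause w c \<and> \<not> holds_dnf w D"
  proof (intro arg_cong2[of _ _ _ _ "(\<and>)"])
    show "holds_dnf w (neg_clause c) \<longleftrightarrow> \<not> holds_clause w c"
      by (rule holds_neg_clause) (rule Cons.prems, simp_all)
    show "holds_dnf w (neg_dnf D) \<longleftrightarrow> \<not> holds_dnf w D"
      by (rule Cons.IH) (rule Cons.prems, simp_all)
  qed
  finally show ?case by (simp add: holds_dnf_def)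
qed

lemma nogen_conj_dnf:
  "\<forall>c\<in>set C. nogen_eqs c \<Longrightarrow> \<forall>c\<in>set D. nogen_eqs c \<Longrightarrow> \<forall>c\<in>set (conj_dnf C D). nogen_eqs c"
  by (auto simp: conj_dnf_def nogen_eqs_def)

lemma nogen_neg_dnf: "\<forall>c\<in>set (neg_dnf D). nogen_eqs c"
proof (induction D)
  case Nil
  then show ?case by (simp add: neg_dnf_def nogen_eqs_def)
next
  case (Cons c D)
  have "\<forall>c'\<in>set (neg_clause c). nogen_eqs c'"
    by (auto simp: neg_clause_def nogen_eqs_def split: if_splits)
  from nogen_conj_dnf[OF this Cons] show ?case by (simp add: neg_dnf_def)
qed

subsection \<open>Quantifier elimination\<close>

text \<open>Later bindings come first and shadow earlier ones; the appended sentinel gives an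
  unbound variable the value \<open>0\<close>.\<close>

definition look :: "(nat \<times> form) list \<Rightarrow> nat \<Rightarrow> form" where
  "look \<sigma> x = snd (hd (filter (\<lambda>p. fst p = x) \<sigma> @ [(x, [])]))"

definition env :: "(nat \<times> form) list \<Rightarrow> (nat \<Rightarrow> real) \<Rightarrow> nat \<Rightarrow> real" where
  "env \<sigma> w x = val w (look \<sigma> x)"

definition bound :: "(nat \<times> form) list \<Rightarrow> nat" where
  "bound \<sigma> = foldr (\<lambda>p n. length (snd p) + n) \<sigma> 0"

lemma look_Nil: "look [] x = []"
  by (simp add: look_def)

lemma look_Cons: "look (p # \<sigma>) x = (if fst p = x then snd p else look \<sigma> x)"
  by (simp add: look_def)

lemma env_Cons: "env ((x, u) # \<sigma>) w = (env \<sigma> w)(x := val w u)"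
  by (auto simp: env_def look_Cons)

lemma length_look_le_bound: "length (look \<sigma> x) \<le> bound \<sigma>"
  by (induction \<sigma>) (auto simp: look_Nil look_Cons bound_def)

lemma env_cong:
  assumes "\<And>i. i < bound \<sigma> \<Longrightarrow> w i = w' i"
  shows "env \<sigma> w = env \<sigma> w'"
proof
  fix x show "env \<sigma> w x = env \<sigma> w' x"
    unfolding env_def using length_look_le_bound[of \<sigma> x] assms by (intro val_cong) auto
qed

primrec linear_form :: "(nat \<times> form) list \<Rightarrow> nat trm \<Rightarrow> form" where
  "linear_form \<sigma> (Var x) = look \<sigma> x"
| "linear_form \<sigma> Zero = []"
| "linear_form \<sigma> One = unit_form 0"
| "linear_form \<sigma> (Plus s t) = fadd (linear_form \<sigma> s) (linear_form \<sigma> t)"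
| "linear_form \<sigma> (Lam k t) = fscale k (linear_form \<sigma> t)"

lemma val_linear_form: "w 0 = 1 \<Longrightarrow> val w (linear_form \<sigma> t) = trm_val (env \<sigma> w) (map_trm \<nu> t)"
  by (induction t) (auto simp: env_def)

text \<open>Odd, hence a generic coordinate, and larger than \<open>bound \<sigma>\<close>, hence
  absent from all forms of \<open>\<sigma>\<close>.\<close>

definition fresh :: "(nat \<times> form) list \<Rightarrow> nat" where
  "fresh \<sigma> = Suc (2 * bound \<sigma>)"

text \<open>Even, so that shifting preserves the sort of a coordinate; large, so that the
  coordinates of \<open>\<sigma>\<close> are left alone; positive, so that coordinate
  \<open>0\<close> keeps its value \<open>1\<close>.\<close>

definition offset :: "(nat \<times> form) list \<Rightarrow> form \<Rightarrow> nat" where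
  "offset \<sigma> h = 2 * Suc (bound \<sigma> + length h)"

definition part :: "bool \<Rightarrow> form \<Rightarrow> form" where
  "part b h = map (\<lambda>i. if odd i = b then coef h i else zer) [0..<length h]"

definition shift :: "nat \<Rightarrow> form \<Rightarrow> form" where
  "shift m h = map (\<lambda>i. zer) [0..<m] @ h"

text \<open>A value of a new variable that makes \<open>h\<close> vanish at some choice of its rational variables, which
  are renamed apart from those of \<open>\<sigma>\<close>.\<close>

definition exceptional :: "(nat \<times> form) list \<Rightarrow> form \<Rightarrow> form" where
  "exceptional \<sigma> h = (let u = solve (fresh \<sigma>) h in fadd (part True u) (shift (offset \<sigma> h) (part False u)))"

text \<open>Position \<open>0\<close> of \<open>h\<close> is renamed as well, so its constant term
  gets a free rational factor. This agrees with \<open>generic\<close>, which does not fix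
  coordinate \<open>0\<close> to \<open>1\<close>.\<close>

definition renamed_vars :: "(nat \<times> form) list \<Rightarrow> form \<Rightarrow> nat list" where
  "renamed_vars \<sigma> h = map (\<lambda>i. offset \<sigma> h + 2 * i) [0..<length h]"

text \<open>If \<open>h\<close> has a generic part, \<open>0 < h\<close> is negated to
  \<open>h < 0\<close>. This is correct only off the zeros of \<open>h\<close>, so such forms join
  the list to be avoided.\<close>

definition neg_result :: "form list \<times> clause list \<Rightarrow> form list \<times> clause list" where
  "neg_result r = (fst r @ filter (\<lambda>h. \<not> nogen h) (concat (map snd (snd r))), neg_dnf (snd r))"

definition conj_result :: "form list \<times> clause list \<Rightarrow> form list \<times> clause list \<Rightarrow> form list \<times> clause list" where
  "conj_result r s = (fst r @ fst s, conj_dnf (snd r) (snd s))"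

definition exceptions :: "(nat \<times> form) list \<Rightarrow> form list \<times> clause list \<Rightarrow> form list" where
  "exceptions \<sigma> r = filter (\<lambda>h. coef h (fresh \<sigma>) \<noteq> zer) (fst r)"

text \<open>Forms without the new variable constrain the outer coordinates and are passed on. Those
  containing it are discharged, since their zeros are treated by the branches \<open>rs\<close>,
  each of which adds the forms that its own call must avoid.\<close>

definition ex_result :: "(nat \<times> form) list \<Rightarrow> form list \<times> clause list \<Rightarrow>
    (form \<times> form list \<times> clause list) list \<Rightarrow> form list \<times> clause list" where
  "ex_result \<sigma> r rs =
    (filter (\<lambda>h. coef h (fresh \<sigma>) = zer) (fst r) @ concat (map (\<lambda>p. fst (snd p)) rs),
     map (fourier_motzkin (fresh \<sigma>)) (snd r) @
     concat (map (\<lambda>p. elim_rats (renamed_vars \<sigma> (fst p)) (snd (snd p))) rs))"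

text \<open>
  \<open>qe \<phi> \<sigma> = (G, D)\<close>: if the variables of \<open>\<phi>\<close> take the values of the linear forms \<open>\<sigma>\<close>, then \<open>\<phi>\<close> is
  equivalent to the disjunctive normal form \<open>D\<close>, provided that no form of \<open>G\<close> vanishes, however its
  rational variables are chosen.
\<close>

primrec qe :: "nat fm \<Rightarrow> (nat \<times> form) list \<Rightarrow> form list \<times> clause list" where
  "qe (Eq s t) \<sigma> = (let h = fsub (linear_form \<sigma> s) (linear_form \<sigma> t) in
     if nogen h then ([], [([h], [])]) else ([h], []))"
| "qe (Less s t) \<sigma> = ([], [([], [fsub (linear_form \<sigma> t) (linear_form \<sigma> s)])])"
| "qe (InQ t) \<sigma> = (let h = linear_form \<sigma> t in
     if nogen h then ([], [(ratl_conds h, [])]) else ([fsub h (unit_form (2 * length h))], []))"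
| "qe (Neg \<phi>) \<sigma> = neg_result (qe \<phi> \<sigma>)"
| "qe (Conj \<phi> \<psi>) \<sigma> = conj_result (qe \<phi> \<sigma>) (qe \<psi> \<sigma>)"
| "qe (Ex x \<phi>) \<sigma> = (let r = qe \<phi> ((x, unit_form (fresh \<sigma>)) # \<sigma>) in
     ex_result \<sigma> r (map (\<lambda>h. (h, qe \<phi> ((x, exceptional \<sigma> h) # \<sigma>))) (exceptions \<sigma> r)))"

section \<open>Generic points and their existence in intervals\<close>

definition generic :: "(nat \<Rightarrow> real) \<Rightarrow> form list \<Rightarrow> bool" where
  "generic w G \<longleftrightarrow> (\<forall>h\<in>set G. \<forall>w'. ratl w' \<longrightarrow> (\<forall>i. odd i \<longrightarrow> w' i = w i) \<longrightarrow> val w' h \<noteq> 0)"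

lemma generic_append: "generic w (G @ H) \<longleftrightarrow> generic w G \<and> generic w H"
  by (auto simp: generic_def)

text \<open>The rational coordinates are quantified inside \<open>generic\<close>, so genericity
  survives a change of the renamed variables in the exceptional branches.\<close>

lemma generic_cong: "(\<And>i. odd i \<Longrightarrow> w i = w' i) \<Longrightarrow> generic w G \<longleftrightarrow> generic w' G"
  by (simp add: generic_def)

lemma genericD: "generic w G \<Longrightarrow> ratl w \<Longrightarrow> h \<in> set G \<Longrightarrow> val w h \<noteq> 0"
  by (auto simp: generic_def)

text \<open>With the generic coordinates fixed, each remaining one ranges over
  \<open>\<rat>\<close>. The induction adds one coordinate at a time;
  \<open>insert (w n) \<rat>\<close> covers both sorts.\<close>

lemma countable_vals: "countable {val w' u | w'. ratl w' \<and> (\<forall>i. odd i \<longrightarrow> w' i = w i)}"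
proof -
  have "countable {\<Sum>i<n. c i * w' i | w'. ratl w' \<and> (\<forall>i. odd i \<longrightarrow> w' i = w i)}" (is "countable (?S n)")
    for n and c :: "nat \<Rightarrow> real"
  proof (induction n)
    case 0
    have "?S 0 \<subseteq> {0}" by auto
    then show ?case by (rule countable_subset) simp
  next
    case (Suc n)
    have "?S (Suc n) \<subseteq> (\<lambda>p. fst p + c n * snd p) ` (?S n \<times> insert (w n) \<rat>)"
    proof
      fix y assume "y \<in> ?S (Suc n)"
      then obtain w' where w': "y = (\<Sum>i<Suc n. c i * w' i)" "ratl w'" "\<forall>i. odd i \<longrightarrow> w' i = w i" by blast
      moreover from w' have "w' n \<in> insert (w n) \<rat>" by (cases "odd n") (auto simp: ratl_def)
      ultimately show "y \<in> (\<lambda>p. fst p + c n * snd p) ` (?S n \<times> insert (w n) \<rat>)"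
        by (intro image_eqI[of _ _ "(\<Sum>i<n. c i * w' i, w' n)"]) auto
    qed
    moreover have "countable (?S n \<times> insert (w n) \<rat>)"
      using Suc countable_rat by (intro countable_SIGMA) auto
    ultimately show ?case by (meson countable_image countable_subset)
  qed
  then show ?thesis unfolding val_def .
qed

text \<open>The values to be avoided are roots, in coordinate \<open>g\<close>, of forms containing
  \<open>g\<close>: countably many, whereas the interval is uncountable. Forms without
  \<open>g\<close> are covered by the assumption.\<close>

lemma generic_between:
  assumes "generic w (filter (\<lambda>h. coef h g = zer) G)" "odd g" "a < b"
  shows "\<exists>x. a < x \<and> x < b \<and> generic (w(g := x)) G"
proof -
  let ?B = "\<Union>h\<in>set G. {val w' (solve g h) | w'. ratl w' \<and> (\<forall>i. odd i \<longrightarrow> w' i = w i)}"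
  have "countable ?B" by (intro countable_UN countable_finite countable_vals) auto
  then have "\<not> {a<..<b} \<subseteq> ?B"
    using uncountable_open_interval[of a b] assms(3) countable_subset by blast
  then obtain x where "x \<in> {a<..<b}" "x \<notin> ?B" by blast
  then have x: "a < x" "x < b" "x \<notin> ?B" by simp_all
  have "generic (w(g := x)) G"
    unfolding generic_def
  proof (intro ballI allI impI notI)
    fix h w' assume h: "h \<in> set G" and w': "ratl w'" "\<forall>i. odd i \<longrightarrow> w' i = (w(g := x)) i" and 0: "val w' h = 0"
    \<comment> \<open>Resetting coordinate \<open>g\<close> gives a point that agrees with
      \<open>w\<close> at all odd positions, and it does not affect the root
      \<open>solve g h\<close>, which does not contain \<open>g\<close>.\<close>
    let ?w = "w'(g := w g)"
    have w: "ratl ?w" "\<forall>i. odd i \<longrightarrow> ?w i = w i" using w' assms(2) by (auto simp: ratl_def)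
    show False
    proof (cases "\<nu> (coef h g) = 0")
      case True
      then have "val ?w h = 0" using 0 by (simp add: val_upd)
      moreover have "h \<in> set (filter (\<lambda>h. coef h g = zer) G)" using h True by (simp add: eq_zer_iff)
      ultimately show False using assms(1) w unfolding generic_def by blast
    next
      case False
      then have "val ?w (solve g h) = x"
        using 0 w'(2) assms(2) by (simp add: val_upd[of w' g "w g" "solve g h"] val_solve)
      then have "x \<in> ?B" using h w by blast
      with x(3) show False by (rule notE)
    qed
  qed
  with x show ?thesis by blast
qed

lemma coef_part: "\<nu> (coef (part b h) i) = (if odd i = b then \<nu> (coef h i) else 0)"
  by (auto simp: part_def coef_map_upt coef_ge)

lemma length_part [simp]: "length (part b h) = length h"
  by (simp add: part_def)

lemma val_part: "val w h = val w (part True h) + val w (part False h)"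
proof -
  have "val w h = val w (fadd (part True h) (part False h))"
    by (rule val_coef_cong) (simp add: coef_part)
  then show ?thesis by simp
qed

lemma coef_shift: "coef (shift m h) i = (if i < m then zer else coef h (i - m))"
  by (auto simp: shift_def coef_def nth_append)

lemma val_shift: "val w (shift m h) = val (\<lambda>i. w (i + m)) h"
proof -
  have "(\<Sum>i<m + n. \<nu> (coef (shift m h) i) * w i) = (\<Sum>i<n. \<nu> (coef h i) * w (i + m))" for n
    by (induction n) (auto simp: coef_shift add.commute)
  moreover have "length (shift m h) = m + length h" by (simp add: shift_def)
  ultimately show ?thesis by (simp add: val_def)
qed

lemma val_exceptional:
  "val w (exceptional \<sigma> h) = val w (part True (solve (fresh \<sigma>) h)) +
    val (\<lambda>i. w (i + offset \<sigma> h)) (part False (solve (fresh \<sigma>) h))"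
  by (simp add: exceptional_def Let_def val_shift)

lemma renamed_vars_bounds:
  "i \<in> set (renamed_vars \<sigma> h) \<Longrightarrow> even i \<and> bound \<sigma> < i \<and> 0 < i"
  by (auto simp: renamed_vars_def offset_def)

text \<open>At \<open>w''\<close> the rational coordinates of \<open>w'\<close> are stored at the
  renamed places, so the form evaluates to the root of \<open>h\<close> at \<open>w'\<close>; this
  root is the coordinate \<open>fresh \<sigma>\<close> of \<open>w'\<close>, as \<open>h\<close>
  vanishes there.\<close>

lemma val_exceptional_eq:
  assumes "\<nu> (coef h (fresh \<sigma>)) \<noteq> 0" "val w' h = 0"
    and "\<And>i. odd i \<Longrightarrow> i \<noteq> fresh \<sigma> \<Longrightarrow> w'' i = w' i"
    and "\<And>i. i < length h \<Longrightarrow> even i \<Longrightarrow> w'' (i + offset \<sigma> h) = w' i"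
  shows "val w'' (exceptional \<sigma> h) = w' (fresh \<sigma>)"
proof -
  let ?u = "solve (fresh \<sigma>) h"
  have "val w'' (part True ?u) = val w' (part True ?u)"
    using assms(3) by (intro val_cong) (auto simp: coef_part split: if_splits)
  moreover have "val (\<lambda>i. w'' (i + offset \<sigma> h)) (part False ?u) = val w' (part False ?u)"
    using assms(4) by (intro val_cong) (auto simp: coef_part split: if_splits)
  moreover have "val w' ?u = w' (fresh \<sigma>)" using assms(1,2) by (simp add: val_solve)
  ultimately show ?thesis by (simp add: val_exceptional val_part[of w' ?u])
qed

text \<open>An atom whose form has a generic part contributes no equation, negation creates none for
  such a form, and \<open>ratl_conds\<close> introduces no new variables.\<close>

lemma qe_nogen: "\<forall>c\<in>set (snd (qe \<phi> \<sigma>)). nogen_eqs c"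
proof (induction \<phi> arbitrary: \<sigma>)
  case (InQ t)
  then show ?case
    by (auto simp: Let_def nogen_eqs_def nogen_iff ratl_conds_support)
next
  case (Conj \<phi> \<psi>)
  from nogen_conj_dnf[OF this] show ?case by (simp add: conj_result_def)
next
  case (Ex x \<phi>)
  then have "\<forall>c\<in>set (elim_rats vs (snd (qe \<phi> \<sigma>))). nogen_eqs c" for vs \<sigma>
    by (rule nogen_elim_rats)
  with Ex show ?case
    by (auto simp: Let_def ex_result_def fourier_motzkin_def nogen_eqs_def)
qed (use nogen_neg_dnf in \<open>simp_all add: Let_def neg_result_def nogen_eqs_def\<close>)

text \<open>Genericity is used three times: it makes equations and rationality atoms with a generic
  part false, it justifies \<open>neg_dnf\<close>, and at a quantifier it divides the values of the
  new coordinate into generic and exceptional ones.\<close>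

theorem qe_correct:
  assumes "ratl w" "w 0 = 1" "generic w (fst (qe \<phi> \<sigma>))"
  shows "sat (env \<sigma> w) (map_fm \<nu> \<phi>) \<longleftrightarrow> holds_dnf w (snd (qe \<phi> \<sigma>))"
  using assms
proof (induction \<phi> arbitrary: \<sigma> w)
  case (Eq s t)
  let ?h = "fsub (linear_form \<sigma> s) (linear_form \<sigma> t)"
  have "sat (env \<sigma> w) (map_fm \<nu> (Eq s t)) \<longleftrightarrow> val w ?h = 0"
    using Eq.prems by (simp add: val_linear_form)
  then show ?case
    using Eq.prems(1,3) by (cases "nogen ?h") (auto simp: holds_dnf_def holds_clause_def Let_def dest: genericD)
next
  case (Less s t)
  then show ?case by (simp add: val_linear_form holds_dnf_def holds_clause_def)
next
  case (InQ t)
  let ?h = "linear_form \<sigma> t"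
  have sat: "sat (env \<sigma> w) (map_fm \<nu> (InQ t)) \<longleftrightarrow> val w ?h \<in> \<rat>"
    using InQ.prems by (simp add: val_linear_form)
  show ?case
  proof (cases "nogen ?h")
    case True
    then show ?thesis using sat ratl_conds_iff[OF InQ.prems(1) True]
      by (simp add: Let_def holds_dnf_def holds_clause_def)
  next
    case False
    \<comment> \<open>Coordinate \<open>2 * length ?h\<close> is rational and lies beyond
      \<open>?h\<close>. If the value of \<open>?h\<close> were rational, it could be assigned to
      this coordinate, and the form recorded by \<open>qe\<close> would vanish.\<close>
    let ?i = "2 * length ?h" and ?w = "w(2 * length ?h := val w ?h)"
    have "val w ?h \<notin> \<rat>"
    proof
      assume "val w ?h \<in> \<rat>"
      then have "ratl ?w" using InQ.prems(1) by (simp add: ratl_upd)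
      moreover have "val ?w (fsub ?h (unit_form ?i)) = 0"
        by (simp add: val_upd[of w _ _ ?h] coef_ge)
      moreover have "\<forall>i. odd i \<longrightarrow> ?w i = w i" by auto
      ultimately show False using InQ.prems(3) False by (auto simp: generic_def Let_def simp del: val_fsub)
    qed
    then show ?thesis using sat False by (simp add: Let_def holds_dnf_def)
  qed
next
  case (Neg \<phi>)
  let ?r = "qe \<phi> \<sigma>"
  have g: "generic w (fst ?r)" "generic w (filter (\<lambda>h. \<not> nogen h) (concat (map snd (snd ?r))))"
    using Neg.prems(3) by (simp_all add: neg_result_def generic_append)
  have "holds_dnf w (neg_dnf (snd ?r)) \<longleftrightarrow> \<not> holds_dnf w (snd ?r)"
    by (rule holds_neg_dnf) (use genericD[OF g(2) Neg.prems(1)] in auto)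
  then show ?case using Neg.IH[OF Neg.prems(1,2) g(1)] by (simp add: neg_result_def)
next
  case (Conj \<phi> \<psi>)
  then show ?case by (simp add: conj_result_def generic_append holds_conj_dnf)
next
  case (Ex x \<phi>)
  let ?g = "fresh \<sigma>"
  define r where "r = qe \<phi> ((x, unit_form ?g) # \<sigma>)"
  define rh where "rh h = qe \<phi> ((x, exceptional \<sigma> h) # \<sigma>)" for h
  have qe: "qe (Ex x \<phi>) \<sigma> = ex_result \<sigma> r (map (\<lambda>h. (h, rh h)) (exceptions \<sigma> r))"
    by (simp add: r_def rh_def Let_def)
  have odd: "odd ?g" by (simp add: fresh_def)
  have g: "generic w (filter (\<lambda>h. coef h ?g = zer) (fst r))"
    and gh: "\<And>h. h \<in> set (exceptions \<sigma> r) \<Longrightarrow> generic w (fst (rh h))"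
    using Ex.prems(3) unfolding qe by (auto simp: ex_result_def generic_def)
  have dnf: "holds_dnf w (snd (qe (Ex x \<phi>) \<sigma>)) \<longleftrightarrow>
    (\<exists>c\<in>set (snd r). holds_clause w (fourier_motzkin ?g c)) \<or>
    (\<exists>h\<in>set (exceptions \<sigma> r). holds_dnf w (elim_rats (renamed_vars \<sigma> h) (snd (rh h))))"
    unfolding qe by (auto simp: ex_result_def holds_dnf_def bex_Un)
  have nogen: "\<forall>c\<in>set (snd r). nogen_eqs c" "\<forall>c\<in>set (snd (rh h)). nogen_eqs c" for h
    by (simp_all add: r_def rh_def qe_nogen)
  have fm: "\<forall>h\<in>set (fst c). coef h ?g = zer" if "c \<in> set (snd r)" for c
    using nogen(1) that odd by (auto simp: nogen_eqs_def nogen_iff eq_zer_iff)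
  have env_generic: "env ((x, unit_form ?g) # \<sigma>) (w(?g := y)) = (env \<sigma> w)(x := y)" for y
  proof -
    have "env \<sigma> (w(?g := y)) = env \<sigma> w" by (rule env_cong) (simp add: fresh_def)
    then show ?thesis by (simp add: env_Cons)
  qed
  have IH_generic: "sat ((env \<sigma> w)(x := y)) (map_fm \<nu> \<phi>) \<longleftrightarrow> holds_dnf (w(?g := y)) (snd r)"
    if "generic (w(?g := y)) (fst r)" for y
  proof -
    have "ratl (w(?g := y))" "(w(?g := y)) 0 = 1" using Ex.prems(1,2) odd by (auto simp: ratl_def fresh_def)
    from Ex.IH[OF this that[unfolded r_def]] show ?thesis by (simp only: env_generic r_def)
  qed
  \<comment> \<open>Renamed variables are even and beyond \<open>\<sigma>\<close>: changing them
    affects neither genericity nor the other variables of the formula, only the value of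
    \<open>x\<close>.\<close>
  have IH_exceptional: "sat ((env \<sigma> w)(x := val w' (exceptional \<sigma> h))) (map_fm \<nu> \<phi>) \<longleftrightarrow> holds_dnf w' (snd (rh h))"
    if w': "\<forall>i. i \<notin> set (renamed_vars \<sigma> h) \<longrightarrow> w' i = w i" "ratl w'" and h: "h \<in> set (exceptions \<sigma> r)" for w' h
  proof -
    have eq: "w' i = w i" if "odd i \<or> i \<le> bound \<sigma> \<or> i = 0" for i
      using that w'(1) renamed_vars_bounds[of i \<sigma> h] by (metis leD neq0_conv)
    have "generic w' (fst (rh h))" using gh[OF h] generic_cong[of w w'] eq by simp
    moreover have "env \<sigma> w' = env \<sigma> w" by (rule env_cong) (simp add: eq)
    moreover have "w' 0 = 1" using eq Ex.prems(2) by simp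
    ultimately show ?thesis
      using Ex.IH[of w' "(x, exceptional \<sigma> h) # \<sigma>"] w'(2) by (simp only: env_Cons rh_def)
  qed
  show ?case
    unfolding dnf
  proof
    assume "sat (env \<sigma> w) (map_fm \<nu> (Ex x \<phi>))"
    then obtain y where y: "sat ((env \<sigma> w)(x := y)) (map_fm \<nu> \<phi>)" by auto
    show "(\<exists>c\<in>set (snd r). holds_clause w (fourier_motzkin ?g c)) \<or>
      (\<exists>h\<in>set (exceptions \<sigma> r). holds_dnf w (elim_rats (renamed_vars \<sigma> h) (snd (rh h))))"
    proof (cases "generic (w(?g := y)) (fst r)")
      case True
      then obtain c where "c \<in> set (snd r)" "holds_clause (w(?g := y)) c"
        using y IH_generic by (auto simp: holds_dnf_def)
      then show ?thesis using fourier_motzkin_necessary[OF fm] by blast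
    next
      case False
      then obtain h w' where h: "h \<in> set (fst r)" and w': "ratl w'" "\<forall>i. odd i \<longrightarrow> w' i = (w(?g := y)) i"
        and 0: "val w' h = 0"
        by (auto simp: generic_def)
      \<comment> \<open>A form without the new coordinate would already vanish over the generic
        coordinates of \<open>w\<close>, contrary to \<open>g\<close>.\<close>
      have nz: "\<nu> (coef h ?g) \<noteq> 0"
      proof
        assume z: "\<nu> (coef h ?g) = 0"
        then have "h \<in> set (filter (\<lambda>h. coef h ?g = zer) (fst r))" using h by (simp add: eq_zer_iff)
        moreover have "val (w'(?g := w ?g)) h = 0" using z 0 by (simp add: val_upd)
        moreover have "ratl (w'(?g := w ?g))" using w'(1) odd by (simp add: ratl_upd)
        moreover have "\<forall>i. odd i \<longrightarrow> (w'(?g := w ?g)) i = w i" using w'(2) by auto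
        ultimately show False using g unfolding generic_def by blast
      qed
      then have ex: "h \<in> set (exceptions \<sigma> r)" using h by (simp add: exceptions_def eq_zer_iff)
      \<comment> \<open>The rational coordinates of \<open>w'\<close> go to the renamed places,
        while those of \<open>w\<close> stay in force for \<open>\<sigma>\<close>.\<close>
      define w'' where "w'' i = (if i \<in> set (renamed_vars \<sigma> h) then w' (i - offset \<sigma> h) else w i)" for i
      have w'': "\<forall>i. i \<notin> set (renamed_vars \<sigma> h) \<longrightarrow> w'' i = w i" by (simp add: w''_def)
      have even_offset: "even (offset \<sigma> h)" by (simp add: offset_def)
      have ratl: "ratl w''" using w'(1) Ex.prems(1) even_offset
        by (auto simp: ratl_def w''_def)
      have "val w'' (exceptional \<sigma> h) = w' ?g"
      proof (rule val_exceptional_eq[OF nz 0])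
        show "w'' i = w' i" if "odd i" "i \<noteq> ?g" for i
          using that w'(2) renamed_vars_bounds[of i \<sigma> h] by (auto simp: w''_def)
        show "w'' (i + offset \<sigma> h) = w' i" if "i < length h" "even i" for i
        proof -
          have "i + offset \<sigma> h = offset \<sigma> h + 2 * (i div 2)" using that(2) by simp
          moreover have "i div 2 < length h" using that(1) by simp
          ultimately have "i + offset \<sigma> h \<in> set (renamed_vars \<sigma> h)"
            unfolding renamed_vars_def by auto
          then show ?thesis by (simp add: w''_def)
        qed
      qed
      also have "w' ?g = y" using w'(2) odd by simp
      finally have "holds_dnf w'' (snd (rh h))"
        using IH_exceptional[OF w'' ratl ex] y by simp
      then have "holds_dnf w (elim_rats (renamed_vars \<sigma> h) (snd (rh h)))"
        using elim_rats_correct[OF nogen(2) Ex.prems(1), of "renamed_vars \<sigma> h"] renamed_vars_bounds w'' ratl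
        by blast
      with ex show ?thesis by blast
    qed
  next
    assume "(\<exists>c\<in>set (snd r). holds_clause w (fourier_motzkin ?g c)) \<or>
      (\<exists>h\<in>set (exceptions \<sigma> r). holds_dnf w (elim_rats (renamed_vars \<sigma> h) (snd (rh h))))"
    then show "sat (env \<sigma> w) (map_fm \<nu> (Ex x \<phi>))"
    proof
      assume "\<exists>c\<in>set (snd r). holds_clause w (fourier_motzkin ?g c)"
      then obtain c where c: "c \<in> set (snd r)" "holds_clause w (fourier_motzkin ?g c)" by blast
      from fourier_motzkin_interval[OF fm[OF c(1)] c(2)]
      obtain a b where ab: "a < b" "\<forall>y. a < y \<and> y < b \<longrightarrow> holds_clause (w(?g := y)) c" by blast
      \<comment> \<open>The clause holds on a whole interval, so the witness can be chosen to avoid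
        all forms of \<open>fst r\<close>.\<close>
      from generic_between[OF g odd ab(1)] obtain y where "a < y" "y < b" "generic (w(?g := y)) (fst r)" by blast
      then have "sat ((env \<sigma> w)(x := y)) (map_fm \<nu> \<phi>)"
        using IH_generic ab(2) c(1) by (auto simp: holds_dnf_def)
      then show ?thesis by auto
    next
      assume "\<exists>h\<in>set (exceptions \<sigma> r). holds_dnf w (elim_rats (renamed_vars \<sigma> h) (snd (rh h)))"
      then obtain h where h: "h \<in> set (exceptions \<sigma> r)" "holds_dnf w (elim_rats (renamed_vars \<sigma> h) (snd (rh h)))"
        by blast
      then obtain w' where "\<forall>i. i \<notin> set (renamed_vars \<sigma> h) \<longrightarrow> w' i = w i" "ratl w'" "holds_dnf w' (snd (rh h))"
        using elim_rats_correct[OF nogen(2) Ex.prems(1), of "renamed_vars \<sigma> h"] renamed_vars_bounds by blast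
      \<comment> \<open>Nothing about \<open>h\<close> has to be checked: whatever value the
        exceptional form takes is a real witness for \<open>x\<close>.\<close>
      then have "sat ((env \<sigma> w)(x := val w' (exceptional \<sigma> h))) (map_fm \<nu> \<phi>)"
        using IH_exceptional h(1) by blast
      then show ?thesis by auto
    qed
  qed
qed

section \<open>Variables occurring in the output, and the case of sentences\<close>

definition absent :: "nat \<Rightarrow> clause \<Rightarrow> bool" where
  "absent i c \<longleftrightarrow> (\<forall>h\<in>set (fst c) \<union> set (snd c). \<nu> (coef h i) = 0)"

lemma absent_fourier_motzkin:
  assumes "absent i c \<or> i = v \<and> (\<forall>h\<in>set (fst c). coef h v = zer)"
  shows "absent i (fourier_motzkin v c)"
  using assms by (auto simp: absent_def fourier_motzkin_def eq_zer_iff)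

lemma absent_elim_rat:
  assumes "absent i c \<or> i = v"
  shows "absent i (elim_rat v c)"
proof (rule elim_rat_cases[of c v])
  assume "\<forall>h\<in>set (fst c). coef h v = zer" "elim_rat v c = fourier_motzkin v c"
  then show ?thesis using absent_fourier_motzkin[of i c v] assms by auto
next
  fix e assume e: "e \<in> set (fst c)" "\<nu> (coef e v) \<noteq> 0"
    "elim_rat v c = (ratl_conds (solve v e) @ map (fsubst v (solve v e)) (fst c), map (fsubst v (solve v e)) (snd c))"
  have "\<nu> (coef (solve v e) i) = 0" using assms e(1) by (auto simp: absent_def)
  with assms show ?thesis
    by (auto simp: absent_def e(3) ratl_conds_support simp del: coef_solve)
qed

lemma absent_elim_rats:
  "\<forall>c\<in>set D. absent i c \<or> i \<in> set vs \<Longrightarrow> c \<in> set (elim_rats vs D) \<Longrightarrow> absent i c"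
proof (induction vs arbitrary: c)
  case (Cons v vs)
  then obtain c' where "c' \<in> set (elim_rats vs D)" "c = elim_rat v c'"
    by (auto simp: elim_rats_def)
  moreover have "absent i c'" if "i \<noteq> v"
    using that Cons.prems(1) by (intro Cons.IH[OF _ \<open>c' \<in> set (elim_rats vs D)\<close>]) auto
  then have "absent i c' \<or> i = v" by blast
  ultimately show ?case by (simp add: absent_elim_rat)
qed (simp add: elim_rats_def)

lemma absent_conj_dnf:
  "\<forall>c\<in>set C. absent i c \<Longrightarrow> \<forall>c\<in>set D. absent i c \<Longrightarrow> \<forall>c\<in>set (conj_dnf C D). absent i c"
  by (auto simp: conj_dnf_def absent_def)

lemma absent_neg_dnf: "\<forall>c\<in>set D. absent i c \<Longrightarrow> \<forall>c\<in>set (neg_dnf D). absent i c"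
proof (induction D)
  case Nil
  then show ?case by (simp add: neg_dnf_def absent_def)
next
  case (Cons c D)
  then have "\<forall>c'\<in>set (neg_clause c). absent i c'"
    by (auto simp: neg_clause_def absent_def split: if_splits)
  moreover have "\<forall>c\<in>set (neg_dnf D). absent i c" using Cons by simp
  ultimately have "\<forall>c'\<in>set (conj_dnf (neg_clause c) (neg_dnf D)). absent i c'" by (rule absent_conj_dnf)
  then show ?case by (simp add: neg_dnf_def)
qed

lemma coef_linear_form:
  assumes "i \<noteq> 0" "\<forall>p\<in>set \<sigma>. \<nu> (coef (snd p) i) = 0"
  shows "\<nu> (coef (linear_form \<sigma> t) i) = 0"
proof -
  have "\<nu> (coef (look \<sigma> x) i) = 0" for x
    using assms(2) by (induction \<sigma>) (auto simp: look_Nil look_Cons)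
  then show ?thesis using assms(1) by (induction t) auto
qed

lemma coef_exceptional:
  assumes "i \<notin> set (renamed_vars \<sigma> h)" "odd i \<Longrightarrow> i \<noteq> fresh \<sigma> \<Longrightarrow> \<nu> (coef h i) = 0"
  shows "\<nu> (coef (exceptional \<sigma> h) i) = 0"
proof -
  let ?u = "solve (fresh \<sigma>) h" and ?m = "offset \<sigma> h"
  have "\<nu> (coef (part True ?u) i) = 0" using assms(2) by (auto simp: coef_part)
  moreover have "\<nu> (coef (part False ?u) (i - ?m)) = 0" if "?m \<le> i"
  proof (cases "odd (i - ?m) \<or> length h \<le> i - ?m")
    case True
    then show ?thesis by (auto simp: coef_part coef_ge simp del: coef_solve)
  next
    case False
    then have "i = ?m + 2 * ((i - ?m) div 2)" "(i - ?m) div 2 < length h" using that by auto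
    then have "i \<in> set (renamed_vars \<sigma> h)"
      unfolding renamed_vars_def by (metis (mono_tags, lifting) atLeastLessThan_iff imageI le0 list.set_map set_upt)
    with assms(1) show ?thesis by simp
  qed
  ultimately show ?thesis by (simp add: exceptional_def Let_def coef_shift)
qed

text \<open>For the forms to be avoided only odd \<open>i\<close> is claimed, as their rational
  coordinates stay quantified in \<open>generic\<close>. In the clauses,
  \<open>fourier_motzkin\<close> removes the generic variable and \<open>elim_rats\<close> the
  renamed ones.\<close>

lemma qe_support:
  assumes "i \<noteq> 0" "\<forall>p\<in>set \<sigma>. \<nu> (coef (snd p) i) = 0"
  shows "(odd i \<longrightarrow> (\<forall>h\<in>set (fst (qe \<phi> \<sigma>)). \<nu> (coef h i) = 0)) \<and> (\<forall>c\<in>set (snd (qe \<phi> \<sigma>)). absent i c)"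
  using assms(2)
proof (induction \<phi> arbitrary: \<sigma>)
  case (InQ t)
  then show ?case
    using coef_linear_form[OF assms(1) InQ, of t]
    by (auto simp: Let_def absent_def ratl_conds_support)
next
  case (Neg \<phi>)
  from Neg.IH[OF Neg.prems] have "odd i \<longrightarrow> (\<forall>h\<in>set (fst (qe \<phi> \<sigma>)). \<nu> (coef h i) = 0)"
    "\<forall>c\<in>set (snd (qe \<phi> \<sigma>)). absent i c" by simp_all
  moreover from this(2) have "\<forall>c\<in>set (neg_dnf (snd (qe \<phi> \<sigma>))). absent i c" by (rule absent_neg_dnf)
  ultimately show ?case by (auto simp: neg_result_def absent_def)
next
  case (Conj \<phi> \<psi>)
  note IH = Conj.IH(1)[OF Conj.prems] Conj.IH(2)[OF Conj.prems]
  from IH have "\<forall>c\<in>set (conj_dnf (snd (qe \<phi> \<sigma>)) (snd (qe \<psi> \<sigma>))). absent i c"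
    by (intro absent_conj_dnf) blast+
  with IH show ?case by (simp add: conj_result_def ball_Un)
next
  case (Ex x \<phi>)
  let ?g = "fresh \<sigma>"
  define r where "r = qe \<phi> ((x, unit_form ?g) # \<sigma>)"
  define rh where "rh h = qe \<phi> ((x, exceptional \<sigma> h) # \<sigma>)" for h
  have qe: "qe (Ex x \<phi>) \<sigma> = ex_result \<sigma> r (map (\<lambda>h. (h, rh h)) (exceptions \<sigma> r))"
    by (simp add: r_def rh_def Let_def)
  have r: "(odd i \<longrightarrow> (\<forall>h\<in>set (fst r). \<nu> (coef h i) = 0)) \<and> (\<forall>c\<in>set (snd r). absent i c)" if "i \<noteq> ?g"
    unfolding r_def using Ex.prems that by (intro Ex.IH) auto
  have rh: "(odd i \<longrightarrow> (\<forall>h'\<in>set (fst (rh h)). \<nu> (coef h' i) = 0)) \<and> (\<forall>c\<in>set (snd (rh h)). absent i c)"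
    if "h \<in> set (exceptions \<sigma> r)" "i \<notin> set (renamed_vars \<sigma> h)" for h
  proof -
    have "\<nu> (coef (exceptional \<sigma> h) i) = 0"
      using that r by (intro coef_exceptional) (auto simp: exceptions_def)
    then show ?thesis unfolding rh_def using Ex.prems by (intro Ex.IH) auto
  qed
  have "absent i (fourier_motzkin ?g c)" if "c \<in> set (snd r)" for c
  proof (rule absent_fourier_motzkin)
    have "nogen_eqs c" using that qe_nogen by (auto simp: r_def)
    then have "\<forall>h\<in>set (fst c). coef h ?g = zer" by (auto simp: nogen_eqs_def nogen_iff eq_zer_iff fresh_def)
    then show "absent i c \<or> i = ?g \<and> (\<forall>h\<in>set (fst c). coef h ?g = zer)" using r that by auto
  qed
  moreover have "absent i c"
    if "h \<in> set (exceptions \<sigma> r)" "c \<in> set (elim_rats (renamed_vars \<sigma> h) (snd (rh h)))" for h c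
    using rh[OF that(1)] by (intro absent_elim_rats[OF _ that(2)]) auto
  moreover have "\<nu> (coef h i) = 0" if "odd i" "h \<in> set (filter (\<lambda>h. coef h ?g = zer) (fst r))" for h
    using r that by (cases "i = ?g") (auto simp: eq_zer_iff)
  moreover have "\<nu> (coef h' i) = 0" if "odd i" "h \<in> set (exceptions \<sigma> r)" "h' \<in> set (fst (rh h))" for h h'
    using rh[OF that(2)] that renamed_vars_bounds[of i \<sigma> h] by blast
  ultimately show ?case unfolding qe ex_result_def by auto
qed (use coef_linear_form[OF assms(1)] in \<open>auto simp: Let_def absent_def\<close>)

text \<open>Combined with \<open>qe_support\<close>, this empties the list for sentences: a member
  would need a generic coordinate, and none can occur.\<close>

lemma qe_generic_forms: "h \<in> set (fst (qe \<phi> \<sigma>)) \<Longrightarrow> \<not> nogen h"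
proof (induction \<phi> arbitrary: \<sigma> h)
  case (InQ t)
  then obtain i where "odd i" "\<nu> (coef (linear_form \<sigma> t) i) \<noteq> 0"
    by (auto simp: Let_def nogen_iff split: if_splits)
  moreover have "i \<noteq> 2 * length (linear_form \<sigma> t)" using \<open>odd i\<close> by auto
  ultimately show ?case using InQ by (auto simp: Let_def nogen_iff split: if_splits intro!: exI[of _ i])
qed (auto simp: Let_def neg_result_def conj_result_def ex_result_def split: if_splits)

text \<open>Nothing has to be avoided, so \<open>qe_correct\<close> applies at the point with
  \<open>1\<close> in coordinate \<open>0\<close> and \<open>0\<close> elsewhere, where every form
  reduces to its constant coefficient. The truth of a sentence does not depend on the
  assignment.\<close>

theorem sentence_iff:
  assumes "free_vars \<phi> = {}"
  shows "(\<forall>e. sat e (map_fm \<nu> \<phi>)) \<longleftrightarrow>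
    (\<exists>c\<in>set (snd (qe \<phi> [])). (\<forall>h\<in>set (fst c). coef h 0 = zer) \<and> (\<forall>h\<in>set (snd c). 0 < \<nu> (coef h 0)))"
proof -
  define w :: "nat \<Rightarrow> real" where "w i = (if i = 0 then 1 else 0)" for i
  have w: "ratl w" "w 0 = 1" by (auto simp: w_def ratl_def)
  have "fst (qe \<phi> []) = []"
  proof (rule ccontr)
    assume "fst (qe \<phi> []) \<noteq> []"
    then obtain h where h: "h \<in> set (fst (qe \<phi> []))" by (meson list.set_sel(1))
    then have "\<not> nogen h" by (rule qe_generic_forms)
    then obtain i where "odd i" "\<nu> (coef h i) \<noteq> 0" by (auto simp: nogen_iff)
    moreover from this(1) have "i \<noteq> 0" by (metis even_zero)
    ultimately show False using qe_support[of i "[]" \<phi>] h by auto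
  qed
  then have "generic w (fst (qe \<phi> []))" by (simp add: generic_def)
  then have 1: "sat (env [] w) (map_fm \<nu> \<phi>) \<longleftrightarrow> holds_dnf w (snd (qe \<phi> []))"
    by (rule qe_correct[OF w])
  have 2: "val w h = \<nu> (coef h 0)" for h
  proof -
    have "val w h = (\<Sum>i<Suc (length h). if i = 0 then \<nu> (coef h 0) else 0)"
      unfolding val_eq_sum[OF le_SucI[OF order_refl]] by (intro sum.cong) (auto simp: w_def)
    then show ?thesis by simp
  qed
  have "(\<forall>e. sat e (map_fm \<nu> \<phi>)) \<longleftrightarrow> sat (env [] w) (map_fm \<nu> \<phi>)"
    using sat_cong[of "map_fm \<nu> \<phi>"] assms by (metis empty_iff free_vars_map_fm)
  then show ?thesis unfolding 1 holds_dnf_def holds_clause_def 2 eq_zer_iff .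
qed

end

section \<open>Computability of quantifier elimination\<close>

text \<open>Constructors with recursive arguments have positive tags, so this makes decoding
  terminate.\<close>

lemma prod_decode_less: "0 < fst (prod_decode c) \<Longrightarrow> snd (prod_decode c) < c"
proof -
  assume pos: "0 < fst (prod_decode c)"
  obtain t a where p: "prod_decode c = (t, a)" by fastforce
  then have "c = prod_encode (t, a)" by (metis prod_decode_inverse)
  with p pos show ?thesis by (cases t) (auto simp: prod_encode_def)
qed

lemma prod_decode_le: "fst (prod_decode c) \<le> c" "snd (prod_decode c) \<le> c"
  using le_prod_encode_1[of "fst (prod_decode c)" "snd (prod_decode c)"]
    le_prod_encode_2[of "snd (prod_decode c)" "fst (prod_decode c)"]
  by simp_all

text \<open>Decoding is total: numbers that do not code a term or formula are decoded to some junk.\<close>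

function trm_of :: "nat \<Rightarrow> nat trm" where
  "trm_of c = (let t = fst (prod_decode c); a = snd (prod_decode c) in
    if t = 0 then Var a
    else if t = 1 then Zero
    else if t = 3 then Plus (trm_of (fst (prod_decode a))) (trm_of (snd (prod_decode a)))
    else if t = 4 then Lam (fst (prod_decode a)) (trm_of (snd (prod_decode a)))
    else One)"
  by auto
termination
  by (relation "measure id")
    (auto intro!: le_less_trans[OF prod_decode_le(1)] le_less_trans[OF prod_decode_le(2)] prod_decode_less)

function fm_of :: "nat \<Rightarrow> nat fm" where
  "fm_of c = (let t = fst (prod_decode c); a = snd (prod_decode c) in
    if t = 0 then Eq (trm_of (fst (prod_decode a))) (trm_of (snd (prod_decode a)))
    else if t = 1 then Less (trm_of (fst (prod_decode a))) (trm_of (snd (prod_decode a)))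
    else if t = 3 then Neg (fm_of a)
    else if t = 4 then Conj (fm_of (fst (prod_decode a))) (fm_of (snd (prod_decode a)))
    else if t = 5 then Ex (fst (prod_decode a)) (fm_of (snd (prod_decode a)))
    else InQ (trm_of a))"
  by auto
termination
  by (relation "measure id")
    (auto intro!: le_less_trans[OF prod_decode_le(1)] le_less_trans[OF prod_decode_le(2)] prod_decode_less)

declare trm_of.simps [simp del] fm_of.simps [simp del]

lemma trm_of_code [simp]: "trm_of (trm_code t) = t"
  by (induction t) (subst trm_of.simps, simp)+

lemma fm_of_code [simp]: "fm_of (fm_code \<phi>) = \<phi>"
  by (induction \<phi>) (subst fm_of.simps, simp)+

text \<open>Subterms have smaller numbers, so structural recursion on the decoded term is
  course-of-values recursion on its number.\<close>

lemma computable_trm_recursion: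
  fixes F :: "'a::coded \<Rightarrow> nat trm \<Rightarrow> 'b::coded"
  assumes F: "\<And>x v. F x (Var v) = fv x v" "\<And>x. F x Zero = fz x" "\<And>x. F x One = fo x"
      "\<And>x s t. F x (Plus s t) = fp x (F x s) (F x t)" "\<And>x k t. F x (Lam k t) = fl x k (F x t)"
    and c: "computable (\<lambda>p. fv (fst p) (snd p))" "computable fz" "computable fo"
      "computable (\<lambda>p. fp (fst p) (fst (snd p)) (snd (snd p)))"
      "computable (\<lambda>p. fl (fst p) (fst (snd p)) (snd (snd p)))"
  shows "computable (\<lambda>p. F (fst p) (trm_of (snd p)))"
proof -
  define H where "H x c hist = (if fst (prod_decode c) = 0 then fv x (snd (prod_decode c))
    else if fst (prod_decode c) = 1 then fz x
    else if fst (prod_decode c) = 3 then fp x (recall c hist (fst (prod_decode (snd (prod_decode c)))))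
      (recall c hist (snd (prod_decode (snd (prod_decode c)))))
    else if fst (prod_decode c) = 4 then fl x (fst (prod_decode (snd (prod_decode c))))
      (recall c hist (snd (prod_decode (snd (prod_decode c)))))
    else fo x)" for x c hist
  have H: "computable (\<lambda>p. H (fst p) (fst (snd p)) (snd (snd p)))"
    unfolding H_def
    by (intro computable_intros computable_compose2[OF c(1)] computable_compose[OF c(2)]
        computable_compose[OF c(3)] computable_compose3[OF c(4)] computable_compose3[OF c(5)])
  have less: "fst (prod_decode (snd (prod_decode c))) < c" "snd (prod_decode (snd (prod_decode c))) < c"
    if "0 < fst (prod_decode c)" for c
    using prod_decode_less[OF that] prod_decode_le[of "snd (prod_decode c)"] by simp_all
  have "F x (trm_of c) = H x c (map (\<lambda>c. F x (trm_of c)) (rev [0..<c]))" for x c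
    by (subst trm_of.simps) (simp add: H_def F recall_map less Let_def)
  from computable_course_of_values[of H "\<lambda>x c. F x (trm_of c)", OF H this]
  show ?thesis .
qed

text \<open>No parameter is passed down: this suits re-encoding and free variables, but not
  \<open>qe\<close>, whose argument \<open>\<sigma>\<close> changes along the recursion.\<close>

lemma computable_fm_recursion:
  fixes F :: "nat fm \<Rightarrow> 'b::coded"
  assumes F: "\<And>a b. F (Eq (trm_of a) (trm_of b)) = fe a b" "\<And>a b. F (Less (trm_of a) (trm_of b)) = fl a b"
      "\<And>a. F (InQ (trm_of a)) = fq a" "\<And>\<phi>. F (Neg \<phi>) = fn (F \<phi>)"
      "\<And>\<phi> \<psi>. F (Conj \<phi> \<psi>) = fc (F \<phi>) (F \<psi>)" "\<And>x \<phi>. F (Ex x \<phi>) = fx x (F \<phi>)"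
    and c: "computable (\<lambda>p. fe (fst p) (snd p))" "computable (\<lambda>p. fl (fst p) (snd p))"
      "computable fq" "computable fn" "computable (\<lambda>p. fc (fst p) (snd p))" "computable (\<lambda>p. fx (fst p) (snd p))"
  shows "computable (\<lambda>c. F (fm_of c))"
proof -
  define H where "H c hist = (if fst (prod_decode c) = 0 then
      fe (fst (prod_decode (snd (prod_decode c)))) (snd (prod_decode (snd (prod_decode c))))
    else if fst (prod_decode c) = 1 then
      fl (fst (prod_decode (snd (prod_decode c)))) (snd (prod_decode (snd (prod_decode c))))
    else if fst (prod_decode c) = 3 then fn (recall c hist (snd (prod_decode c)))
    else if fst (prod_decode c) = 4 then fc (recall c hist (fst (prod_decode (snd (prod_decode c)))))
      (recall c hist (snd (prod_decode (snd (prod_decode c)))))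
    else if fst (prod_decode c) = 5 then fx (fst (prod_decode (snd (prod_decode c))))
      (recall c hist (snd (prod_decode (snd (prod_decode c)))))
    else fq (snd (prod_decode c)))" for c hist
  have H: "computable (\<lambda>p. H (fst (snd p)) (snd (snd p)))"
    unfolding H_def
    by (intro computable_intros computable_compose2[OF c(1)] computable_compose2[OF c(2)]
        computable_compose[OF c(3)] computable_compose[OF c(4)] computable_compose2[OF c(5)]
        computable_compose2[OF c(6)])
  have less: "fst (prod_decode (snd (prod_decode c))) < c" "snd (prod_decode (snd (prod_decode c))) < c"
    if "0 < fst (prod_decode c)" for c
    using prod_decode_less[OF that] prod_decode_le[of "snd (prod_decode c)"] by simp_all
  have "F (fm_of c) = H c (map (\<lambda>c. F (fm_of c)) (rev [0..<c]))" for c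
    by (subst fm_of.simps) (simp add: H_def F recall_map less prod_decode_less Let_def)
  from computable_course_of_values[of "\<lambda>x::nat. H" "\<lambda>x c. F (fm_of c)", OF H this]
  have "computable (\<lambda>p::nat \<times> nat. F (fm_of (snd p)))" .
  from computable_compose[OF this, of "\<lambda>c. (0, c)"] show ?thesis
    by (simp add: computable_Pair computable_const computable_id)
qed

lemma computable_trm_code_of: "computable (\<lambda>c. trm_code (trm_of c))"
proof -
  have "computable (\<lambda>p::nat \<times> nat. trm_code (trm_of (snd p)))"
    by (rule computable_trm_recursion[where F = "\<lambda>x. trm_code" and fv = "\<lambda>x v. prod_encode (0, v)"
        and fz = "\<lambda>x. prod_encode (1, 0)" and fo = "\<lambda>x. prod_encode (2, 0)"
        and fp = "\<lambda>x s t. prod_encode (3, prod_encode (s, t))" and fl = "\<lambda>x k t. prod_encode (4, prod_encode (k, t))"];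
      (simp; fail | intro computable_intros))
  from computable_compose[OF this, of "\<lambda>c. (0, c)"] show ?thesis
    by (simp add: computable_Pair computable_const computable_id)
qed

text \<open>Re-encoding tells genuine codes from junk: a number is a code exactly if it is returned
  unchanged.\<close>

lemma computable_fm_code_of: "computable (\<lambda>c. fm_code (fm_of c))"
  by (rule computable_fm_recursion[where F = fm_code
      and fe = "\<lambda>a b. prod_encode (0, prod_encode (trm_code (trm_of a), trm_code (trm_of b)))"
      and fl = "\<lambda>a b. prod_encode (1, prod_encode (trm_code (trm_of a), trm_code (trm_of b)))"
      and fq = "\<lambda>a. prod_encode (2, trm_code (trm_of a))" and fn = "\<lambda>r. prod_encode (3, r)"
      and fc = "\<lambda>r s. prod_encode (4, prod_encode (r, s))" and fx = "\<lambda>x r. prod_encode (5, prod_encode (x, r))"];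
    (simp; fail | intro computable_intros computable_compose[OF computable_trm_code_of]))

primrec var_list :: "'k trm \<Rightarrow> nat list" where
  "var_list (Var x) = [x]"
| "var_list Zero = []"
| "var_list One = []"
| "var_list (Plus s t) = var_list s @ var_list t"
| "var_list (Lam k t) = var_list t"

primrec free_var_list :: "'k fm \<Rightarrow> nat list" where
  "free_var_list (Eq s t) = var_list s @ var_list t"
| "free_var_list (Less s t) = var_list s @ var_list t"
| "free_var_list (InQ t) = var_list t"
| "free_var_list (Neg \<phi>) = free_var_list \<phi>"
| "free_var_list (Conj \<phi> \<psi>) = free_var_list \<phi> @ free_var_list \<psi>"
| "free_var_list (Ex x \<phi>) = filter (\<lambda>y. y \<noteq> x) (free_var_list \<phi>)"

lemma set_free_var_list: "set (free_var_list \<phi>) = free_vars \<phi>"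
proof -
  have "set (var_list t) = vars t" for t :: "'a trm" by (induction t) auto
  then show ?thesis by (induction \<phi>) auto
qed

lemma computable_var_list: "computable (\<lambda>c. var_list (trm_of c))"
proof -
  have "computable (\<lambda>p::nat \<times> nat. var_list (trm_of (snd p)))"
    by (rule computable_trm_recursion[where F = "\<lambda>x. var_list" and fv = "\<lambda>x v. [v]"
        and fz = "\<lambda>x. []" and fo = "\<lambda>x. []" and fp = "\<lambda>x s t. s @ t" and fl = "\<lambda>x k t. t"];
      (simp; fail | intro computable_intros))
  from computable_compose[OF this, of "\<lambda>c. (0, c)"] show ?thesis
    by (simp add: computable_Pair computable_const computable_id)
qed

lemma computable_free_var_list: "computable (\<lambda>c. free_var_list (fm_of c))"
  by (rule computable_fm_recursion[where F = free_var_list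
      and fe = "\<lambda>a b. var_list (trm_of a) @ var_list (trm_of b)"
      and fl = "\<lambda>a b. var_list (trm_of a) @ var_list (trm_of b)"
      and fq = "\<lambda>a. var_list (trm_of a)" and fn = "\<lambda>r. r"
      and fc = "\<lambda>r s. r @ s" and fx = "\<lambda>x r. filter (\<lambda>y. y \<noteq> x) r"];
    (simp; fail | intro computable_intros computable_compose[OF computable_var_list]))

text \<open>The bridge between two codings of finite sets: the oracle takes numbers read by
  \<open>set_decode\<close>, the algorithm works with lists. The membership test prevents a repeated
  element from adding its power of two twice.\<close>

lemma computable_set_encode [computable_intros]:
  assumes "computable l" shows "computable (\<lambda>x. set_encode (set (l x)))"
proof -
  have "computable (\<lambda>x. rec_list (0::nat) (\<lambda>b bs r. if b \<in> set bs then r else 2 ^ b + r) (l x))"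
    by (intro computable_intros assms)
  moreover have "rec_list (0::nat) (\<lambda>b bs r. if b \<in> set bs then r else 2 ^ b + r) bs = set_encode (set bs)" for bs
    by (induction bs) (auto simp: insert_absorb)
  ultimately show ?thesis by simp
qed

lemma decidable_distinct [computable_intros]:
  assumes "computable l" shows "decidable (\<lambda>x. distinct (l x))"
proof -
  have "decidable (\<lambda>x. rec_list 1 (\<lambda>b bs r. if b \<in> set bs then 0 else r) (l x) = (1::nat))"
    by (intro computable_intros assms)
  moreover have "rec_list 1 (\<lambda>b bs r. if b \<in> set bs then 0 else r) bs = (1::nat) \<longleftrightarrow> distinct bs" for bs :: "'b list"
    by (induction bs) auto
  ultimately show ?thesis by simp
qed

definition table_value :: "('a \<times> 'b) list \<Rightarrow> 'a \<Rightarrow> 'b" where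
  "table_value T x = snd (hd (filter (\<lambda>e. fst e = x) T))"

lemma table_value_eq:
  assumes "\<forall>e\<in>set T. snd e = f (fst e)" "x \<in> set (map fst T)"
  shows "table_value T x = f x"
proof -
  have "filter (\<lambda>e. fst e = x) T \<noteq> []" using assms(2) by (auto simp: filter_empty_conv)
  then have "hd (filter (\<lambda>e. fst e = x) T) \<in> set (filter (\<lambda>e. fst e = x) T)" by (rule hd_in_set)
  then show ?thesis using assms(1) by (auto simp: table_value_def)
qed

lemma computable_table_value [computable_intros]:
  assumes "computable T" "computable f" shows "computable (\<lambda>x. table_value (T x) (f x))"
  unfolding table_value_def by (intro computable_intros assms computable_compose[OF assms(2)])

abbreviation tag :: "nat \<Rightarrow> nat" where "tag c \<equiv> fst (prod_decode c)"
abbreviation arg :: "nat \<Rightarrow> nat" where "arg c \<equiv> snd (prod_decode c)"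
abbreviation arg1 :: "nat \<Rightarrow> nat" where "arg1 c \<equiv> fst (prod_decode (arg c))"
abbreviation arg2 :: "nat \<Rightarrow> nat" where "arg2 c \<equiv> snd (prod_decode (arg c))"

section \<open>Effectiveness of the operations on forms\<close>

locale computable_field = presented_field +
  assumes computable_add': "computable2 add" and computable_neg': "computable1 neg"
    and computable_mul': "computable2 mul" and decidable_less': "decidable_rel (\<lambda>i j. \<nu> i < \<nu> j)"
    and decidable_independent': "decidable_rat_independence \<nu>"
begin

lemmas computable_code_add [computable_intros] = computable_computable2[OF computable_add']
lemmas computable_code_mul [computable_intros] = computable_computable2[OF computable_mul']
lemmas computable_code_neg [computable_intros] = computable_compose[OF computable_neg'[folded computable_iff_computable1]]

lemma decidable_\<nu>_less:
  assumes "computable f" "computable g" shows "decidable (\<lambda>x. \<nu> (f x) < \<nu> (g x))"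
  using decidable_less' assms unfolding decidable_rel_def decidable_def
  by (rule computable_computable2)

lemma decidable_\<nu>_sign [computable_intros]:
  assumes "computable f" shows "decidable (\<lambda>x. \<nu> (f x) < 0)" "decidable (\<lambda>x. 0 < \<nu> (f x))"
  using decidable_\<nu>_less[OF assms computable_const[of zer]] decidable_\<nu>_less[OF computable_const[of zer] assms]
  by simp_all

lemma decidable_independent [computable_intros]:
  assumes "computable l" shows "decidable (\<lambda>x. rat_real.independent (\<nu> ` set (l x)))"
proof -
  have "decidable (\<lambda>n. rat_real.independent (\<nu> ` set_decode n))"
    using decidable_independent'
    by (simp add: decidable_rat_independence_def decidable_set_def decidable_def computable_iff_computable1)
  then have "decidable (\<lambda>x. rat_real.independent (\<nu> ` set_decode (set_encode (set (l x)))))"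
    by (rule decidable_compose) (intro computable_intros assms)
  then show ?thesis by simp
qed

text \<open>The span of \<open>1\<close> over \<open>\<rat>\<close> is \<open>\<rat>\<close>. The
  case \<open>k = one\<close> is separate because the set then collapses to \<open>{1}\<close>,
  which is independent although \<open>1\<close> is rational.\<close>

lemma \<nu>_in_Rats_iff: "\<nu> k \<in> \<rat> \<longleftrightarrow> k = one \<or> \<not> rat_real.independent (\<nu> ` set [one, k])"
proof (cases "k = one")
  case False
  then have "\<nu> k \<noteq> 1" by (simp add: eq_one_iff)
  then have "rat_real.independent {\<nu> k, 1} \<longleftrightarrow> \<nu> k \<notin> rat_real.span {1}"
    by (simp add: rat_real.independent_insert)
  also have "rat_real.span {1} = \<rat>"
    by (auto simp: rat_real.span_singleton Rats_def)
  finally show ?thesis using False by (simp add: insert_commute)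
qed simp

lemma decidable_Rats [computable_intros]:
  assumes "computable f" shows "decidable (\<lambda>x. \<nu> (f x) \<in> \<rat>)"
  unfolding \<nu>_in_Rats_iff by (intro computable_intros assms)

text \<open>A presentation supplies no inverses, so they are searched for. Prescribing
  \<open>zer\<close> at zero matches \<open>inverse 0 = 0\<close> and lets every search
  succeed.\<close>

lemma computable_recip [computable_intros]:
  assumes "computable f" shows "computable (\<lambda>x. recip (f x))"
proof (rule computable_compose[OF _ assms])
  define P where "P i m \<longleftrightarrow> (i = zer \<longrightarrow> m = zer) \<and> (i \<noteq> zer \<longrightarrow> mul i m = one)" for i m
  have uniq: "P i m \<longleftrightarrow> m = recip i" for i m
    using \<nu>_eq_iff[of m "recip i"] by (auto simp: P_def eq_zer_iff eq_one_iff field_simps simp del: \<nu>_eq_iff)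
  have "computable (\<lambda>i. least_coded (P i))"
    by (intro computable_intros) (unfold P_def, intro computable_intros, fold P_def, simp add: uniq)
  moreover have "least_coded (P i) = recip i" for i
    using least_codedI[of "P i" "recip i"] uniq by blast
  ultimately show "computable recip" by simp
qed

lemma computable_coef [computable_intros]:
  assumes "computable f" "computable i" shows "computable (\<lambda>x. coef (f x) (i x))"
proof -
  have "coef h i = (if i < length h then hd (drop i h) else zer)" for h i
    by (simp add: coef_def hd_drop_conv_nth)
  then show ?thesis by (simp only:) (intro computable_intros assms)
qed

lemma computable_fadd [computable_intros]:
  assumes "computable f" "computable g" shows "computable (\<lambda>x. fadd (f x) (g x))"
proof (rule computable_compose2[OF _ assms])
  show "computable (\<lambda>p. fadd (fst p) (snd p))" unfolding fadd_def by (intro computable_intros)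
qed

lemma computable_fscale [computable_intros]:
  assumes "computable f" "computable g" shows "computable (\<lambda>x. fscale (f x) (g x))"
proof (rule computable_compose2[OF _ assms])
  show "computable (\<lambda>p. fscale (fst p) (snd p))" unfolding fscale_def by (intro computable_intros)
qed

lemma computable_fsub [computable_intros]:
  assumes "computable f" "computable g" shows "computable (\<lambda>x. fsub (f x) (g x))"
proof (rule computable_compose2[OF _ assms])
  show "computable (\<lambda>p. fsub (fst p) (snd p))" unfolding fsub_def by (intro computable_intros)
qed

lemma computable_unit_form [computable_intros]:
  assumes "computable f" shows "computable (\<lambda>x. unit_form (f x))"
proof (rule computable_compose[OF _ assms])
  show "computable (\<lambda>x. unit_form x)" unfolding unit_form_def by (intro computable_intros)
qed

lemma computable_clear [computable_intros]:
  assumes "computable f" "computable g" shows "computable (\<lambda>x. clear (f x) (g x))"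
proof (rule computable_compose2[OF _ assms])
  show "computable (\<lambda>p. clear (fst p) (snd p))" unfolding clear_def by (intro computable_intros)
qed

lemma computable_solve [computable_intros]:
  assumes "computable f" "computable g" shows "computable (\<lambda>x. solve (f x) (g x))"
proof (rule computable_compose2[OF _ assms])
  show "computable (\<lambda>p. solve (fst p) (snd p))" unfolding solve_def by (intro computable_intros)
qed

lemma computable_fsubst [computable_intros]:
  assumes "computable f" "computable g" "computable h" shows "computable (\<lambda>x. fsubst (f x) (g x) (h x))"
proof (rule computable_compose3[OF _ assms])
  show "computable (\<lambda>p. fsubst (fst p) (fst (snd p)) (snd (snd p)))" unfolding fsubst_def by (intro computable_intros)
qed

lemma decidable_nogen [computable_intros]:
  assumes "computable f" shows "decidable (\<lambda>x. nogen (f x))"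
proof (rule decidable_compose[OF _ assms])
  show "decidable (\<lambda>x. nogen x)" unfolding nogen_def by (intro computable_intros)
qed

lemma computable_fourier_motzkin [computable_intros]:
  assumes "computable f" "computable g" shows "computable (\<lambda>x. fourier_motzkin (f x) (g x))"
proof (rule computable_compose2[OF _ assms])
  show "computable (\<lambda>p. fourier_motzkin (fst p) (snd p))" unfolding fourier_motzkin_def by (intro computable_intros)
qed

lemma computable_lin [computable_intros]:
  assumes "computable f" shows "computable (\<lambda>x. lin (f x))"
proof (rule computable_compose[OF _ assms])
  show "computable (\<lambda>x. lin x)" unfolding lin_def by (intro computable_intros)
qed

text \<open>Here the algorithm consults the independence oracle, directly and through the test for
  rational coefficients; the other conditions are equality tests and quantifiers over lists.\<close>

lemma decidable_decomposition [computable_intros]: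
  assumes "computable f" "computable g" shows "decidable (\<lambda>x. decomposition (f x) (g x))"
proof (rule decidable_compose2[OF _ assms])
  show "decidable (\<lambda>p. decomposition (fst p) (snd p))" unfolding decomposition_def by (intro computable_intros)
qed

lemma computable_ratl_conds [computable_intros]:
  assumes "computable f" shows "computable (\<lambda>x. ratl_conds (f x))"
proof (rule computable_compose[OF _ assms])
  show "computable (\<lambda>x. ratl_conds x)"
    unfolding ratl_conds_def by (intro computable_intros decomposition_exists)
qed

lemma computable_elim_rat [computable_intros]:
  assumes "computable f" "computable g" shows "computable (\<lambda>x. elim_rat (f x) (g x))"
proof (rule computable_compose2[OF _ assms])
  show "computable (\<lambda>p. elim_rat (fst p) (snd p))" unfolding elim_rat_def Let_def by (intro computable_intros)
qed

lemma computable_elim_rats [computable_intros]: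
  assumes "computable f" "computable g" shows "computable (\<lambda>x. elim_rats (f x) (g x))"
proof (rule computable_compose2[OF _ assms])
  show "computable (\<lambda>p. elim_rats (fst p) (snd p))" unfolding elim_rats_def by (intro computable_intros)
qed

lemma computable_conj_dnf [computable_intros]:
  assumes "computable f" "computable g" shows "computable (\<lambda>x. conj_dnf (f x) (g x))"
proof (rule computable_compose2[OF _ assms])
  show "computable (\<lambda>p. conj_dnf (fst p) (snd p))" unfolding conj_dnf_def by (intro computable_intros)
qed

lemma computable_neg_clause [computable_intros]:
  assumes "computable f" shows "computable (\<lambda>x. neg_clause (f x))"
proof (rule computable_compose[OF _ assms])
  show "computable (\<lambda>x. neg_clause x)" unfolding neg_clause_def by (intro computable_intros)
qed

lemma computable_neg_dnf [computable_intros]: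
  assumes "computable f" shows "computable (\<lambda>x. neg_dnf (f x))"
proof (rule computable_compose[OF _ assms])
  show "computable (\<lambda>x. neg_dnf x)" unfolding neg_dnf_def by (intro computable_intros)
qed

lemma computable_look [computable_intros]:
  assumes "computable f" "computable g" shows "computable (\<lambda>x. look (f x) (g x))"
proof (rule computable_compose2[OF _ assms])
  show "computable (\<lambda>p. look (fst p) (snd p))" unfolding look_def by (intro computable_intros)
qed

lemma computable_bound [computable_intros]:
  assumes "computable f" shows "computable (\<lambda>x. bound (f x))"
proof (rule computable_compose[OF _ assms])
  show "computable (\<lambda>x. bound x)" unfolding bound_def by (intro computable_intros)
qed

lemma computable_fresh [computable_intros]:
  assumes "computable f" shows "computable (\<lambda>x. fresh (f x))"
proof (rule computable_compose[OF _ assms])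
  show "computable (\<lambda>x. fresh x)" unfolding fresh_def by (intro computable_intros)
qed

lemma computable_offset [computable_intros]:
  assumes "computable f" "computable g" shows "computable (\<lambda>x. offset (f x) (g x))"
proof (rule computable_compose2[OF _ assms])
  show "computable (\<lambda>p. offset (fst p) (snd p))" unfolding offset_def by (intro computable_intros)
qed

text \<open>\<open>bool\<close> is finite and so has no coding; the two values of the flag are
  treated separately.\<close>

lemma computable_part [computable_intros]:
  assumes "computable f" shows "computable (\<lambda>x. part True (f x))" "computable (\<lambda>x. part False (f x))"
proof -
  have "computable (\<lambda>h. map (\<lambda>i. if odd i then coef h i else zer) [0..<length h])"
    "computable (\<lambda>h. map (\<lambda>i. if \<not> odd i then coef h i else zer) [0..<length h])"
    by (intro computable_intros)+
  then have "computable (part True)" "computable (part False)"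
    unfolding part_def by simp_all
  then show "computable (\<lambda>x. part True (f x))" "computable (\<lambda>x. part False (f x))"
    using assms by (auto intro: computable_compose)
qed

lemma computable_shift [computable_intros]:
  assumes "computable f" "computable g" shows "computable (\<lambda>x. shift (f x) (g x))"
proof (rule computable_compose2[OF _ assms])
  show "computable (\<lambda>p. shift (fst p) (snd p))" unfolding shift_def by (intro computable_intros)
qed

lemma computable_exceptional [computable_intros]:
  assumes "computable f" "computable g" shows "computable (\<lambda>x. exceptional (f x) (g x))"
proof (rule computable_compose2[OF _ assms])
  show "computable (\<lambda>p. exceptional (fst p) (snd p))" unfolding exceptional_def Let_def by (intro computable_intros)
qed

lemma computable_renamed_vars [computable_intros]:
  assumes "computable f" "computable g" shows "computable (\<lambda>x. renamed_vars (f x) (g x))"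
proof (rule computable_compose2[OF _ assms])
  show "computable (\<lambda>p. renamed_vars (fst p) (snd p))" unfolding renamed_vars_def by (intro computable_intros)
qed

lemma computable_neg_result [computable_intros]:
  assumes "computable f" shows "computable (\<lambda>x. neg_result (f x))"
proof (rule computable_compose[OF _ assms])
  show "computable (\<lambda>x. neg_result x)" unfolding neg_result_def by (intro computable_intros)
qed

lemma computable_conj_result [computable_intros]:
  assumes "computable f" "computable g" shows "computable (\<lambda>x. conj_result (f x) (g x))"
proof (rule computable_compose2[OF _ assms])
  show "computable (\<lambda>p. conj_result (fst p) (snd p))" unfolding conj_result_def by (intro computable_intros)
qed

lemma computable_exceptions [computable_intros]:
  assumes "computable f" "computable g" shows "computable (\<lambda>x. exceptions (f x) (g x))"
proof (rule computable_compose2[OF _ assms])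
  show "computable (\<lambda>p. exceptions (fst p) (snd p))" unfolding exceptions_def by (intro computable_intros)
qed

lemma computable_ex_result [computable_intros]:
  assumes "computable f" "computable g" "computable h" shows "computable (\<lambda>x. ex_result (f x) (g x) (h x))"
proof (rule computable_compose3[OF _ assms])
  show "computable (\<lambda>p. ex_result (fst p) (fst (snd p)) (snd (snd p)))" unfolding ex_result_def by (intro computable_intros)
qed

lemma computable_linear_form [computable_intros]:
  assumes "computable f" "computable g" shows "computable (\<lambda>x. linear_form (f x) (trm_of (g x)))"
proof (rule computable_compose2[OF _ assms])
  show "computable (\<lambda>p. linear_form (fst p) (trm_of (snd p)))"
    by (rule computable_trm_recursion[where F = linear_form and fv = look and fz = "\<lambda>\<sigma>. []"
        and fo = "\<lambda>\<sigma>. unit_form 0" and fp = "\<lambda>\<sigma>. fadd" and fl = "\<lambda>\<sigma>. fscale"];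
      (simp; fail | intro computable_intros))
qed

section \<open>Quantifier elimination by certified tables\<close>

definition generic_call :: "nat \<times> (nat \<times> form) list \<Rightarrow> nat \<times> (nat \<times> form) list" where
  "generic_call k = (arg2 (fst k), (arg1 (fst k), unit_form (fresh (snd k))) # snd k)"

definition exceptional_call :: "nat \<times> (nat \<times> form) list \<Rightarrow> form \<Rightarrow> nat \<times> (nat \<times> form) list" where
  "exceptional_call k h = (arg2 (fst k), (arg1 (fst k), exceptional (snd k) h) # snd k)"

text \<open>At a quantifier the table itself tells which exceptional calls must be present: they are
  computed from the stored value of the generic call.\<close>

definition qe_ready :: "((nat \<times> (nat \<times> form) list) \<times> form list \<times> clause list) list \<Rightarrow>
    nat \<times> (nat \<times> form) list \<Rightarrow> bool" where
  "qe_ready T k \<longleftrightarrow>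
    (tag (fst k) = 3 \<longrightarrow> (arg (fst k), snd k) \<in> set (map fst T)) \<and>
    (tag (fst k) = 4 \<longrightarrow> (arg1 (fst k), snd k) \<in> set (map fst T) \<and> (arg2 (fst k), snd k) \<in> set (map fst T)) \<and>
    (tag (fst k) = 5 \<longrightarrow> generic_call k \<in> set (map fst T) \<and>
      (\<forall>h\<in>set (exceptions (snd k) (table_value T (generic_call k))). exceptional_call k h \<in> set (map fst T)))"

definition qe_step :: "((nat \<times> (nat \<times> form) list) \<times> form list \<times> clause list) list \<Rightarrow>
    nat \<times> (nat \<times> form) list \<Rightarrow> form list \<times> clause list" where
  "qe_step T k =
    (if tag (fst k) = 0 then
      let h = fsub (linear_form (snd k) (trm_of (arg1 (fst k)))) (linear_form (snd k) (trm_of (arg2 (fst k)))) in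
      if nogen h then ([], [([h], [])]) else ([h], [])
    else if tag (fst k) = 1 then
      ([], [([], [fsub (linear_form (snd k) (trm_of (arg2 (fst k)))) (linear_form (snd k) (trm_of (arg1 (fst k))))])])
    else if tag (fst k) = 3 then neg_result (table_value T (arg (fst k), snd k))
    else if tag (fst k) = 4 then
      conj_result (table_value T (arg1 (fst k), snd k)) (table_value T (arg2 (fst k), snd k))
    else if tag (fst k) = 5 then
      let r = table_value T (generic_call k) in
      ex_result (snd k) r (map (\<lambda>h. (h, table_value T (exceptional_call k h))) (exceptions (snd k) r))
    else
      let h = linear_form (snd k) (trm_of (arg (fst k))) in
      if nogen h then ([], [(ratl_conds h, [])]) else ([fsub h (unit_form (2 * length h))], []))"

lemma computable_generic_call [computable_intros]:
  assumes "computable f" shows "computable (\<lambda>x. generic_call (f x))"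
proof (rule computable_compose[OF _ assms])
  show "computable (\<lambda>x. generic_call x)" unfolding generic_call_def by (intro computable_intros)
qed

lemma computable_exceptional_call [computable_intros]:
  assumes "computable f" "computable g" shows "computable (\<lambda>x. exceptional_call (f x) (g x))"
proof (rule computable_compose2[OF _ assms])
  show "computable (\<lambda>p. exceptional_call (fst p) (snd p))" unfolding exceptional_call_def by (intro computable_intros)
qed

lemma decidable_qe_ready [computable_intros]:
  assumes "computable f" "computable g" shows "decidable (\<lambda>x. qe_ready (f x) (g x))"
proof (rule decidable_compose2[OF _ assms])
  show "decidable (\<lambda>p. qe_ready (fst p) (snd p))" unfolding qe_ready_def by (intro computable_intros)
qed

lemma computable_qe_step [computable_intros]:
  assumes "computable f" "computable g" shows "computable (\<lambda>x. qe_step (f x) (g x))"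
proof (rule computable_compose2[OF _ assms])
  show "computable (\<lambda>p. qe_step (fst p) (snd p))" unfolding qe_step_def Let_def by (intro computable_intros)
qed

text \<open>The measure is the code of the formula: it decreases in every recursive call, although
  \<open>\<sigma>\<close> grows and the number of calls depends on computed values.\<close>

lemma computable_qe: "computable (\<lambda>k. qe (fm_of (fst k)) (snd k))"
proof (rule computable_by_tables[where m = fst and ready = qe_ready and step = qe_step])
  show "decidable (\<lambda>p. qe_ready (fst p) (snd p))" "computable (\<lambda>p. qe_step (fst p) (snd p))"
    by (intro computable_intros)+
next
  fix T and k :: "nat \<times> (nat \<times> form) list"
  assume T: "\<forall>e\<in>set T. snd e = qe (fm_of (fst (fst e))) (snd (fst e))" and ready: "qe_ready T k"
  note entry = table_value_eq[of T "\<lambda>k. qe (fm_of (fst k)) (snd k)", OF T]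
  have step5: "qe_step T k = qe (fm_of (fst k)) (snd k)" if tag: "tag (fst k) = 5"
  proof -
    have call: "generic_call k \<in> set (map fst T)"
      "\<And>h. h \<in> set (exceptions (snd k) (table_value T (generic_call k))) \<Longrightarrow> exceptional_call k h \<in> set (map fst T)"
      using ready tag by (auto simp: qe_ready_def)
    define r where "r = table_value T (generic_call k)"
    have r: "r = qe (fm_of (arg2 (fst k))) ((arg1 (fst k), unit_form (fresh (snd k))) # snd k)"
      unfolding r_def entry[OF call(1)] by (simp add: generic_call_def)
    have eq: "map (\<lambda>h. (h, table_value T (exceptional_call k h))) (exceptions (snd k) r) =
      map (\<lambda>h. (h, qe (fm_of (arg2 (fst k))) ((arg1 (fst k), exceptional (snd k) h) # snd k))) (exceptions (snd k) r)"
      using entry[OF call(2)] by (intro map_cong refl) (simp add: r_def exceptional_call_def)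
    have "qe_step T k = ex_result (snd k) r (map (\<lambda>h. (h, table_value T (exceptional_call k h))) (exceptions (snd k) r))"
      using tag by (simp add: qe_step_def Let_def r_def)
    also have "\<dots> = qe (Ex (arg1 (fst k)) (fm_of (arg2 (fst k)))) (snd k)"
      unfolding eq by (simp add: r Let_def)
    also have "Ex (arg1 (fst k)) (fm_of (arg2 (fst k))) = fm_of (fst k)"
      using tag by (simp add: fm_of.simps[of "fst k"] Let_def)
    finally show ?thesis .
  qed
  show "qe_step T k = qe (fm_of (fst k)) (snd k)"
  proof (cases "tag (fst k) = 5")
    case False
    with ready show ?thesis
      by (subst fm_of.simps) (auto simp: qe_step_def qe_ready_def entry Let_def)
  qed (rule step5)
next
  fix k :: "nat \<times> (nat \<times> form) list"
  \<comment> \<open>The true value of the generic call. Every correct table that has this call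
    stores it, so the dependencies can be listed without reference to a table.\<close>
  define r where "r = qe (fm_of (fst (generic_call k))) (snd (generic_call k))"
  \<comment> \<open>The calls for all recursive tags are listed uniformly; under a positive tag each
    of them has a smaller code.\<close>
  define ds where "ds = (if 0 < tag (fst k) then [(arg (fst k), snd k), (arg1 (fst k), snd k), (arg2 (fst k), snd k),
    generic_call k] @ map (exceptional_call k) (exceptions (snd k) r) else [])"
  have "fst d < fst k" if "d \<in> set ds" for d
  proof -
    have pos: "0 < tag (fst k)" using that by (auto simp: ds_def split: if_splits)
    then have "arg (fst k) < fst k" by (rule prod_decode_less)
    moreover have "arg1 (fst k) \<le> arg (fst k)" "arg2 (fst k) \<le> arg (fst k)" by (rule prod_decode_le)+
    ultimately show ?thesis
      using that pos by (auto simp: ds_def generic_call_def exceptional_call_def)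
  qed
  moreover have "qe_ready T k"
    if T: "\<forall>e\<in>set T. snd e = qe (fm_of (fst (fst e))) (snd (fst e))" and ds: "set ds \<subseteq> fst ` set T" for T
  proof (cases "0 < tag (fst k)")
    case True
    then have mem: "(arg (fst k), snd k) \<in> set (map fst T)" "(arg1 (fst k), snd k) \<in> set (map fst T)"
      "(arg2 (fst k), snd k) \<in> set (map fst T)" "generic_call k \<in> set (map fst T)"
      "\<forall>h\<in>set (exceptions (snd k) r). exceptional_call k h \<in> set (map fst T)"
      using ds by (auto simp: ds_def)
    moreover have "table_value T (generic_call k) = r"
      unfolding r_def by (rule table_value_eq[OF T mem(4)])
    ultimately show ?thesis by (simp add: qe_ready_def)
  qed (simp add: qe_ready_def)
  ultimately show "\<exists>ds. (\<forall>d\<in>set ds. fst d < fst k) \<and>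
    (\<forall>T. (\<forall>e\<in>set T. snd e = qe (fm_of (fst (fst e))) (snd (fst e))) \<longrightarrow> set ds \<subseteq> fst ` set T \<longrightarrow> qe_ready T k)"
    by blast
qed

theorem decidable_theory: "decidable_theory K"
proof -
  define P where "P n \<longleftrightarrow> fm_code (fm_of n) = n \<and> free_var_list (fm_of n) = [] \<and>
    (\<exists>c\<in>set (snd (qe (fm_of n) [])).
      (\<forall>h\<in>set (fst c). coef h 0 = zer) \<and> (\<forall>h\<in>set (snd c). 0 < \<nu> (coef h 0)))" for n
  have "computable (\<lambda>n. qe (fm_of n) [])"
    using computable_compose[OF computable_qe computable_Pair[OF computable_id computable_const]] by simp
  then have "decidable P"
    unfolding P_def
    by (intro computable_intros computable_compose[OF computable_fm_code_of] computable_compose[OF computable_free_var_list])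
  moreover have "n \<in> {fm_code \<phi> |\<phi>. map_fm \<nu> \<phi> \<in> theory_of K} \<longleftrightarrow> P n" for n
  proof -
    have "map_fm \<nu> \<phi> \<in> theory_of K \<longleftrightarrow> free_vars \<phi> = {} \<and> (\<forall>e. sat e (map_fm \<nu> \<phi>))" for \<phi>
      by (auto simp: theory_of_def fm.set_map)
    then have "map_fm \<nu> (fm_of n) \<in> theory_of K \<longleftrightarrow> free_var_list (fm_of n) = [] \<and>
      (\<exists>c\<in>set (snd (qe (fm_of n) [])). (\<forall>h\<in>set (fst c). coef h 0 = zer) \<and> (\<forall>h\<in>set (snd c). 0 < \<nu> (coef h 0)))"
      using sentence_iff[of "fm_of n"] set_free_var_list[of "fm_of n"] by (metis set_empty)
    moreover have "n \<in> {fm_code \<phi> |\<phi>. map_fm \<nu> \<phi> \<in> theory_of K} \<longleftrightarrow>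
      fm_code (fm_of n) = n \<and> map_fm \<nu> (fm_of n) \<in> theory_of K"
      by auto (metis fm_of_code)
    ultimately show ?thesis by (simp add: P_def)
  qed
  ultimately have "decidable_set {fm_code \<phi> |\<phi>. map_fm \<nu> \<phi> \<in> theory_of K}"
    by (simp add: decidable_def decidable_set_def computable_iff_computable1)
  then show ?thesis using bij unfolding decidable_theory_def by blast
qed

end

section \<open>Presentations from decidable theories\<close>

text \<open>Rests on \<open>Suc n div 2 = n - n div 2\<close>.\<close>

lemma computable_half [computable_intros]:
  assumes "computable f" shows "computable (\<lambda>x. f x div 2 :: nat)"
proof -
  have "computable (\<lambda>x. rec_nat 0 (\<lambda>m r. m - r) (f x))"
    by (intro computable_intros assms)
  moreover have "rec_nat 0 (\<lambda>m r. m - r) n = n div 2" for n :: nat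
    by (induction n) auto
  ultimately show ?thesis by simp
qed

lemma decidable_bit [computable_intros]:
  assumes "computable f" "computable g" shows "decidable (\<lambda>x. g x \<in> set_decode (f x))"
proof -
  have "decidable (\<lambda>x. odd (rec_nat (f x) (\<lambda>_ r. r div 2) (g x)))"
    by (intro computable_intros assms)
  moreover have "rec_nat n (\<lambda>_ r. r div 2) i = n div 2 ^ i" for n i :: nat
    by (induction i) (simp_all add: power_Suc2 div_mult2_eq del: power_Suc)
  ultimately show ?thesis by (simp add: set_decode_def)
qed

section \<open>Sentences expressing linear dependence\<close>

primrec sum_trm :: "nat \<Rightarrow> nat \<Rightarrow> nat trm" where
  "sum_trm n 0 = Zero"
| "sum_trm n (Suc i) = (if i \<in> set_decode n then Plus (sum_trm n i) (Lam i (Var i)) else sum_trm n i)"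

primrec rational_fm :: "nat \<Rightarrow> nat fm" where
  "rational_fm 0 = Eq Zero Zero"
| "rational_fm (Suc i) = Conj (rational_fm i) (InQ (Var i))"

primrec zero_fm :: "nat \<Rightarrow> nat \<Rightarrow> nat fm" where
  "zero_fm n 0 = Eq Zero Zero"
| "zero_fm n (Suc i) = (if i \<in> set_decode n then Conj (zero_fm n i) (Eq (Var i) Zero) else zero_fm n i)"

primrec Exs :: "nat \<Rightarrow> 'k fm \<Rightarrow> 'k fm" where
  "Exs 0 \<phi> = \<phi>"
| "Exs (Suc i) \<phi> = Ex i (Exs i \<phi>)"

text \<open>The unknown rational coefficients are variables and the elements of \<open>K\<close> are
  function symbols, so the combination is a term. Members of \<open>set_decode n\<close> are smaller
  than \<open>n\<close>, so binding the variables below \<open>n\<close> closes the formula.\<close>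

definition dependence_fm :: "nat \<Rightarrow> nat fm" where
  "dependence_fm n = Exs n (Conj (rational_fm n) (Conj (Eq (sum_trm n n) Zero) (Neg (zero_fm n n))))"

lemma set_decode_lessThan: "i \<in> set_decode n \<Longrightarrow> i < n"
proof -
  assume "i \<in> set_decode n"
  then have "odd (n div 2 ^ i)" by (simp add: set_decode_def)
  then have "n div 2 ^ i \<noteq> 0" by (metis even_zero)
  then have "2 ^ i \<le> n" by (simp add: div_eq_0_iff)
  then show ?thesis using less_exp[of i] by linarith
qed

lemma trm_val_sum_trm:
  "trm_val e (map_trm \<nu> (sum_trm n i)) = (\<Sum>j | j \<in> set_decode n \<and> j < i. \<nu> j * e j)"
proof (induction i)
  case (Suc i)
  have "{j. j \<in> set_decode n \<and> j < Suc i} =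
    (if i \<in> set_decode n then insert i {j. j \<in> set_decode n \<and> j < i} else {j. j \<in> set_decode n \<and> j < i})"
    by (auto simp: less_Suc_eq)
  then show ?case using Suc by simp
qed simp

lemma sat_rational_fm: "sat e (map_fm \<nu> (rational_fm i)) \<longleftrightarrow> (\<forall>j<i. e j \<in> \<rat>)"
  by (induction i) (auto simp: less_Suc_eq)

lemma sat_zero_fm: "sat e (map_fm \<nu> (zero_fm n i)) \<longleftrightarrow> (\<forall>j\<in>set_decode n. j < i \<longrightarrow> e j = 0)"
  by (induction i) (auto simp: less_Suc_eq)

lemma sat_Exs: "sat e (map_fm \<nu> (Exs i \<phi>)) \<longleftrightarrow> (\<exists>e'. (\<forall>j\<ge>i. e' j = e j) \<and> sat e' (map_fm \<nu> \<phi>))"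
proof (induction i arbitrary: e)
  case 0
  have "e' = e" if "\<forall>j. e' j = e j" for e' using that by auto
  then show ?case by auto
next
  case (Suc i)
  have "(\<exists>a e'. (\<forall>j\<ge>i. e' j = (e(i := a)) j) \<and> sat e' (map_fm \<nu> \<phi>)) \<longleftrightarrow>
    (\<exists>e'. (\<forall>j\<ge>Suc i. e' j = e j) \<and> sat e' (map_fm \<nu> \<phi>))" (is "?l \<longleftrightarrow> ?r")
  proof
    assume ?l
    then obtain a e' where "\<forall>j\<ge>i. e' j = (e(i := a)) j" "sat e' (map_fm \<nu> \<phi>)" by blast
    then show ?r by (intro exI[of _ e']) auto
  next
    assume ?r
    then obtain e' where "\<forall>j\<ge>Suc i. e' j = e j" "sat e' (map_fm \<nu> \<phi>)" by blast
    then show ?l by (intro exI[of _ "e' i"] exI[of _ e']) (auto simp: Suc_le_eq)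
  qed
  then show ?case using Suc by simp
qed

lemma free_vars_dependence_fm: "free_vars (dependence_fm n) = {}"
proof -
  have Exs: "free_vars (Exs i \<phi>) = free_vars \<phi> - {..<i}" for i and \<phi> :: "nat fm"
    by (induction i) (simp_all only: Exs.simps free_vars.simps lessThan_Suc lessThan_0 Diff_empty Diff_insert[of _ _ "{..<_}"])
  have "vars (sum_trm n i) \<subseteq> {..<i}" "free_vars (zero_fm n i) \<subseteq> {..<i}" "free_vars (rational_fm i) \<subseteq> {..<i}" for i
    by (induction i) (auto simp: less_Suc_eq)
  then show ?thesis unfolding dependence_fm_def Exs by force
qed

text \<open>Coefficients are indexed by codes in the formula and by reals in the definition of
  dependence; injectivity of \<open>\<nu>\<close> converts between the two.\<close>

lemma sat_dependence_fm:
  assumes "inj \<nu>"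
  shows "(\<forall>e. sat e (map_fm \<nu> (dependence_fm n))) \<longleftrightarrow> \<not> rat_real.independent (\<nu> ` set_decode n)"
proof -
  let ?S = "set_decode n"
  have less: "j \<in> ?S \<Longrightarrow> j < n" for j by (rule set_decode_lessThan)
  have inj: "inj_on \<nu> ?S" using assms by (rule inj_on_subset) simp
  have "(\<exists>e'. (\<forall>j\<ge>n. e' j = e j) \<and> (\<forall>j<n. e' j \<in> \<rat>) \<and> (\<Sum>j\<in>?S. \<nu> j * e' j) = 0 \<and> (\<exists>j\<in>?S. e' j \<noteq> 0)) \<longleftrightarrow>
    (\<exists>u. (\<exists>v\<in>\<nu> ` ?S. u v \<noteq> 0) \<and> (\<Sum>v\<in>\<nu> ` ?S. of_rat (u v) * v) = 0)" (is "?l \<longleftrightarrow> ?r") for e :: "nat \<Rightarrow> real"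
  proof
    assume ?l
    then obtain e' where e': "\<forall>j<n. e' j \<in> \<rat>" "(\<Sum>j\<in>?S. \<nu> j * e' j) = 0" "\<exists>j\<in>?S. e' j \<noteq> 0" by blast
    from e'(1) have "\<forall>j. \<exists>q. j < n \<longrightarrow> e' j = of_rat q" by (auto simp: Rats_def)
    then obtain q where q: "\<And>j. j < n \<Longrightarrow> e' j = of_rat (q j)" by metis
    have "(\<Sum>v\<in>\<nu> ` ?S. of_rat (q (inv \<nu> v)) * v) = (\<Sum>j\<in>?S. \<nu> j * e' j)"
      using q less assms by (subst sum.reindex[OF inj]) (auto intro!: sum.cong)
    moreover have "\<exists>v\<in>\<nu> ` ?S. q (inv \<nu> v) \<noteq> 0"
      using e'(3) q less assms by auto
    ultimately show ?r using e'(2) by (intro exI[of _ "\<lambda>v. q (inv \<nu> v)"]) simp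
  next
    assume ?r
    then obtain u where u: "\<exists>v\<in>\<nu> ` ?S. u v \<noteq> 0" "(\<Sum>v\<in>\<nu> ` ?S. of_rat (u v) * v) = 0" by blast
    let ?e = "\<lambda>j. if j < n then of_rat (u (\<nu> j)) else e j"
    have "(\<Sum>j\<in>?S. \<nu> j * ?e j) = (\<Sum>v\<in>\<nu> ` ?S. of_rat (u v) * v)"
      using less by (subst sum.reindex[OF inj]) (auto intro!: sum.cong)
    moreover have "\<exists>j\<in>?S. ?e j \<noteq> 0" using u(1) less by auto
    ultimately show ?l using u(2) by (intro exI[of _ ?e]) auto
  qed
  moreover have "{j. j \<in> ?S \<and> j < n} = ?S" using less by auto
  ultimately have "sat e (map_fm \<nu> (dependence_fm n)) \<longleftrightarrow>
    (\<exists>u. (\<exists>v\<in>\<nu> ` ?S. u v \<noteq> 0) \<and> (\<Sum>v\<in>\<nu> ` ?S. of_rat (u v) * v) = 0)" for e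
    using less unfolding dependence_fm_def sat_Exs
    by (simp add: sat_rational_fm sat_zero_fm trm_val_sum_trm Bex_def)
  then show ?thesis
    using rat_real.dependent_finite[of "\<nu> ` ?S"] by simp
qed

text \<open>Each family of formulas is a primitive recursion in its index, carried out directly on
  codes.\<close>

lemma computable_fm_code_dependence_fm: "computable (\<lambda>n. fm_code (dependence_fm n))"
proof -
  have "trm_code (sum_trm n i) = rec_nat (prod_encode (1, 0))
    (\<lambda>i r. if i \<in> set_decode n then
      prod_encode (3, prod_encode (r, prod_encode (4, prod_encode (i, prod_encode (0, i))))) else r) i" for n i
    by (induction i) auto
  moreover have "fm_code (rational_fm i) = rec_nat (prod_encode (0, prod_encode (prod_encode (1, 0), prod_encode (1, 0))))
    (\<lambda>i r. prod_encode (4, prod_encode (r, prod_encode (2, prod_encode (0, i))))) i" for i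
    by (induction i) auto
  moreover have "fm_code (zero_fm n i) = rec_nat (prod_encode (0, prod_encode (prod_encode (1, 0), prod_encode (1, 0))))
    (\<lambda>i r. if i \<in> set_decode n then
      prod_encode (4, prod_encode (r, prod_encode (0, prod_encode (prod_encode (0, i), prod_encode (1, 0))))) else r) i" for n i
    by (induction i) auto
  moreover have "fm_code (Exs i \<phi>) = rec_nat (fm_code \<phi>) (\<lambda>i r. prod_encode (5, prod_encode (i, r))) i" for i \<phi>
    by (induction i) auto
  ultimately show ?thesis
    unfolding dependence_fm_def by (simp only: fm_code.simps trm_code.simps) (intro computable_intros)
qed

text \<open>The term \<open>Lam k One\<close> names \<open>\<nu> k\<close>. The result of an
  operation is found by searching for the \<open>k\<close> whose defining equation belongs to the
  theory; the search ends because \<open>\<nu>\<close> is onto \<open>K\<close>.\<close>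

lemma computable_presentation_of_decidable_theory:
  assumes K: "real_subfield K" and bij: "bij_betw \<nu> UNIV K"
    and A: "decidable_set {fm_code \<phi> |\<phi>. map_fm \<nu> \<phi> \<in> theory_of K}"
  shows "computable_presentation \<nu> K \<and> decidable_rat_independence \<nu>"
proof -
  define true_fm where "true_fm n \<longleftrightarrow> n \<in> {fm_code \<phi> |\<phi>. map_fm \<nu> \<phi> \<in> theory_of K}" for n
  have in_K: "\<nu> i \<in> K" for i using bij by (auto simp: bij_betw_def)
  have surj: "\<exists>k. \<nu> k = x" if "x \<in> K" for x using bij that by (metis bij_betw_def imageE)
  have least: "\<nu> (least_coded (\<lambda>k. \<nu> k = x)) = x" if "x \<in> K" for x
    using surj[OF that] least_codedI[of "\<lambda>k. \<nu> k = x"] by blast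
  have dec: "decidable true_fm"
    using A unfolding true_fm_def decidable_def decidable_set_def computable_iff_computable1 .
  have true_fm: "true_fm (fm_code \<phi>) \<longleftrightarrow> (\<forall>e. sat e (map_fm \<nu> \<phi>))" if "free_vars \<phi> = {}" for \<phi>
    using that in_K by (auto simp: true_fm_def theory_of_def fm.set_map inj_fm_code)
  have "decidable (\<lambda>p. true_fm (fm_code (Eq (Lam (snd p) One) (Plus (Lam (fst (fst p)) One) (Lam (snd (fst p)) One)))))"
    by (simp only: fm_code.simps trm_code.simps) (intro computable_intros decidable_compose[OF dec])
  then have "decidable (\<lambda>p. \<nu> (snd p) = \<nu> (fst (fst p)) + \<nu> (snd (fst p)))"
    by (simp add: true_fm del: fm_code.simps)
  then have add: "computable (\<lambda>p. least_coded (\<lambda>k. \<nu> k = \<nu> (fst p) + \<nu> (snd p)))"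
    by (rule computable_least_coded) (use K in_K surj in \<open>auto simp: real_subfield_def\<close>)
  \<comment> \<open>The language has no multiplication, but composing function symbols multiplies
    their scalars.\<close>
  have "decidable (\<lambda>p. true_fm (fm_code (Eq (Lam (snd p) One) (Lam (fst (fst p)) (Lam (snd (fst p)) One)))))"
    by (simp only: fm_code.simps trm_code.simps) (intro computable_intros decidable_compose[OF dec])
  then have "decidable (\<lambda>p. \<nu> (snd p) = \<nu> (fst (fst p)) * \<nu> (snd (fst p)))"
    by (simp add: true_fm del: fm_code.simps)
  then have mul: "computable (\<lambda>p. least_coded (\<lambda>k. \<nu> k = \<nu> (fst p) * \<nu> (snd p)))"
    by (rule computable_least_coded) (use K in_K surj in \<open>auto simp: real_subfield_def\<close>)
  have "decidable (\<lambda>p. true_fm (fm_code (Eq (Plus (Lam (snd p) One) (Lam (fst p) One)) Zero)))"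
    by (simp only: fm_code.simps trm_code.simps) (intro computable_intros decidable_compose[OF dec])
  then have "decidable (\<lambda>p. \<nu> (snd p) = - \<nu> (fst p))"
    by (simp add: true_fm eq_neg_iff_add_eq_0 del: fm_code.simps)
  then have neg: "computable (\<lambda>i. least_coded (\<lambda>k. \<nu> k = - \<nu> i))"
    by (rule computable_least_coded) (use K in_K surj in \<open>auto simp: real_subfield_def\<close>)
  have "decidable (\<lambda>p. true_fm (fm_code (Less (Lam (fst p) One) (Lam (snd p) One))))"
    by (simp only: fm_code.simps trm_code.simps) (intro computable_intros decidable_compose[OF dec])
  then have less: "decidable (\<lambda>p. \<nu> (fst p) < \<nu> (snd p))"
    by (simp add: true_fm del: fm_code.simps)
  have "decidable (\<lambda>n. \<not> true_fm (fm_code (dependence_fm n)))"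
    by (intro computable_intros decidable_compose[OF dec] computable_fm_code_dependence_fm)
  moreover have "inj \<nu>" using bij by (simp add: bij_betw_def)
  ultimately have "decidable (\<lambda>n. rat_real.independent (\<nu> ` set_decode n))"
    by (simp add: true_fm free_vars_dependence_fm sat_dependence_fm)
  then have indep: "decidable_rat_independence \<nu>"
    by (simp add: decidable_rat_independence_def decidable_set_def decidable_def computable_iff_computable1)
  have "computable_presentation \<nu> K"
    unfolding computable_presentation_def
  proof (intro conjI)
    show "\<exists>add. computable2 add \<and> (\<forall>i j. \<nu> (add i j) = \<nu> i + \<nu> j)"
      using add in_K K
      by (intro exI[of _ "\<lambda>i j. least_coded (\<lambda>k. \<nu> k = \<nu> i + \<nu> j)"])
        (auto simp: computable2_iff real_subfield_def least)
    show "\<exists>neg. computable1 neg \<and> (\<forall>i. \<nu> (neg i) = - \<nu> i)"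
      using neg in_K K
      by (intro exI[of _ "\<lambda>i. least_coded (\<lambda>k. \<nu> k = - \<nu> i)"])
        (auto simp: computable_iff_computable1 real_subfield_def least)
    show "\<exists>mul. computable2 mul \<and> (\<forall>i j. \<nu> (mul i j) = \<nu> i * \<nu> j)"
      using mul in_K K
      by (intro exI[of _ "\<lambda>i j. least_coded (\<lambda>k. \<nu> k = \<nu> i * \<nu> j)"])
        (auto simp: computable2_iff real_subfield_def least)
    show "decidable_rel (\<lambda>i j. \<nu> i < \<nu> j)"
      using less by (simp add: decidable_rel_def decidable_def computable2_iff)
  qed (rule bij)
  with indep show ?thesis by blast
qed

text \<open>Both directions keep the numbering: the one for which the theory is decidable is the
  presentation, and conversely.\<close>

theorem theoremB:
  fixes K :: "real set"
  assumes "real_subfield K" and "\<rat> \<subset> K"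
  shows "decidable_theory K \<longleftrightarrow>
    (\<exists>\<nu>. computable_presentation \<nu> K \<and> decidable_rat_independence \<nu>)"
proof
  assume "decidable_theory K"
  then show "\<exists>\<nu>. computable_presentation \<nu> K \<and> decidable_rat_independence \<nu>"
    unfolding decidable_theory_def using computable_presentation_of_decidable_theory[OF assms(1)] by blast
next
  assume "\<exists>\<nu>. computable_presentation \<nu> K \<and> decidable_rat_independence \<nu>"
  then obtain \<nu> add neg mul where "bij_betw \<nu> UNIV K"
    "computable2 add" "\<And>i j. \<nu> (add i j) = \<nu> i + \<nu> j"
    "computable1 neg" "\<And>i. \<nu> (neg i) = - \<nu> i"
    "computable2 mul" "\<And>i j. \<nu> (mul i j) = \<nu> i * \<nu> j"
    "decidable_rel (\<lambda>i j. \<nu> i < \<nu> j)" "decidable_rat_independence \<nu>"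
    unfolding computable_presentation_def by blast
  then interpret computable_field \<nu> K add neg mul
    using assms by unfold_locales auto
  show "decidable_theory K" by (rule decidable_theory)
qed

end
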